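(* Let $R=\bigoplus_{d\ge 0}R_d$ be a positively graded commutative Noetherian ring which is standard, i.e. $R=R_0[R_1]$, with $R_0$ a local ring with maximal ideal $\mathfrak m_0$ and infinite residue field $R_0/\mathfrak m_0$. Let $R_+=\bigoplus_{i>0}R_i$ and let $M$ be a finitely generated graded $R$-module. Let $J$ be an ideal of $R$ generated by elements of degree zero, let $\mathfrak b_0$ be an ideal of $R_0$ and set $\mathfrak b=\mathfrak b_0+R_+$. Then for every $i\ge 1$, $$H^{i}_{\mathfrak b,J}(M)_n=0$$ for all $n$ sufficiently large.
   Context: For ideals $I,J$ of $R$ and an $R$-module $M$, $\Gamma_{I,J}(M)=\{x\in M : I^{n}x\subseteq Jx \text{ for some integer } n\ge 1\}$, and $H^i_{I,J}$ denotes the $i$-th right derived functor of $\Gamma_{I,J}$. For $I$ and $M$ graded, $H^i_{I,J}(M)$ carries the grading obtained by taking right derived functors of $\Gamma_{I,J}$ on the category of graded $R$-modules, and $H^i_{I,J}(M)_n$ denotes its component of degree $n$. *)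

theory Defs
  imports "HOL-Algebra.Algebra"
begin

subsection \<open>Graded rings and modules\<close>

record 'a graded_ring = "'a ring" +
  rcomp :: "nat \<Rightarrow> 'a set"

record ('a, 'b) graded_module = "('a, 'b) module" +
  mcomp :: "int \<Rightarrow> 'b set"

definition internal_direct_sum :: "('b, 'm) ring_scheme \<Rightarrow> ('i \<Rightarrow> 'b set) \<Rightarrow> bool" where
  "internal_direct_sum G D \<longleftrightarrow>
     (\<forall>i. additive_subgroup (D i) G) \<and>
     (\<forall>x \<in> carrier G. \<exists>!c. (\<forall>i. c i \<in> D i) \<and> finite {i. c i \<noteq> \<zero>\<^bsub>G\<^esub>} \<and>
        x = (\<Oplus>\<^bsub>G\<^esub>i \<in> {i. c i \<noteq> \<zero>\<^bsub>G\<^esub>}. c i))"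

definition is_graded_ring :: "'a graded_ring \<Rightarrow> bool" where
  "is_graded_ring R \<longleftrightarrow> cring R \<and> internal_direct_sum R (rcomp R) \<and>
     (\<forall>i j. \<forall>a \<in> rcomp R i. \<forall>b \<in> rcomp R j. a \<otimes>\<^bsub>R\<^esub> b \<in> rcomp R (i + j))"

definition is_graded_module :: "'a graded_ring \<Rightarrow> ('a, 'b) graded_module \<Rightarrow> bool" where
  "is_graded_module R M \<longleftrightarrow> module R M \<and> internal_direct_sum M (mcomp M) \<and>
     (\<forall>d n. \<forall>a \<in> rcomp R d. \<forall>x \<in> mcomp M n. a \<odot>\<^bsub>M\<^esub> x \<in> mcomp M (int d + n))"

definition degree_zero_ring :: "'a graded_ring \<Rightarrow> 'a graded_ring" where
  "degree_zero_ring R = R\<lparr>carrier := rcomp R 0\<rparr>"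

definition is_standard_graded :: "'a graded_ring \<Rightarrow> bool" where
  "is_standard_graded R \<longleftrightarrow> is_graded_ring R \<and>
     generate_ring R (rcomp R 0 \<union> rcomp R 1) = carrier R"

definition irrelevant_ideal :: "'a graded_ring \<Rightarrow> 'a set" where
  "irrelevant_ideal R =
     {(\<Oplus>\<^bsub>R\<^esub>i \<in> F. c i) | F c. finite F \<and> F \<subseteq> {0<..} \<and> (\<forall>i \<in> F. c i \<in> rcomp R i)}"

definition is_local_ring :: "('a, 'm) ring_scheme \<Rightarrow> 'a set \<Rightarrow> bool" where
  "is_local_ring R m \<longleftrightarrow> cring R \<and> (\<forall>I. maximalideal I R \<longleftrightarrow> I = m)"

definition finitely_generated_module ::
    "('a, 'r) ring_scheme \<Rightarrow> ('a, 'b, 'm) module_scheme \<Rightarrow> bool" where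
  "finitely_generated_module R M \<longleftrightarrow>
     (\<exists>S \<subseteq> carrier M. finite S \<and> carrier M = \<Inter>{N. submodule N R M \<and> S \<subseteq> N})"


subsection \<open>The category of graded modules\<close>

text \<open>Morphisms are the \<open>R\<close>-linear maps preserving degrees.\<close>

definition graded_hom ::
    "'a graded_ring \<Rightarrow> ('a, 'b) graded_module \<Rightarrow> ('a, 'c) graded_module \<Rightarrow> ('b \<Rightarrow> 'c) set" where
  "graded_hom R M N = {h \<in> hom (add_monoid M) (add_monoid N).
     (\<forall>a \<in> carrier R. \<forall>x \<in> carrier M. h (a \<odot>\<^bsub>M\<^esub> x) = a \<odot>\<^bsub>N\<^esub> h x) \<and>
     (\<forall>n. h ` mcomp M n \<subseteq> mcomp N n)}"

text \<open>HOL cannot quantify over types inside a formula, so the modules \<open>A\<close>, \<open>B\<close> in the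
  lifting property range over all graded modules with elements in a type \<open>'u\<close> given as a
  parameter. A larger \<open>'u\<close> makes the notion formally stronger. As soon as \<open>'u\<close> is
  at least as large as the type of elements of \<open>R\<close>, it contains the homogeneous ideals
  of \<open>R\<close> with all their shifts, and by the graded form of Baer's criterion the notion is then
  injectivity in the category of all graded modules, whatever \<open>'u\<close> is.\<close>

definition graded_injective ::
    "'u itself \<Rightarrow> 'a graded_ring \<Rightarrow> ('a, 'c) graded_module \<Rightarrow> bool" where
  "graded_injective U R E \<longleftrightarrow> is_graded_module R E \<and>
     (\<forall>(A :: ('a, 'u) graded_module) (B :: ('a, 'u) graded_module). \<forall>f g.
        is_graded_module R A \<and> is_graded_module R B \<and>
        f \<in> graded_hom R A B \<and> inj_on f (carrier A) \<and> g \<in> graded_hom R A E \<longrightarrow>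
        (\<exists>h \<in> graded_hom R B E. \<forall>x \<in> carrier A. h (f x) = g x))"

text \<open>\<open>0 \<rightarrow> M \<rightarrow> E 0 \<rightarrow> E 1 \<rightarrow> \<dots>\<close> exact, with augmentation \<open>e\<close> and differentials
  \<open>d i\<close> from \<open>E i\<close> to \<open>E (i + 1)\<close>.\<close>

definition graded_injective_resolution ::
    "'u itself \<Rightarrow> 'a graded_ring \<Rightarrow> ('a, 'b) graded_module \<Rightarrow>
     (nat \<Rightarrow> ('a, 'c) graded_module) \<Rightarrow> ('b \<Rightarrow> 'c) \<Rightarrow> (nat \<Rightarrow> 'c \<Rightarrow> 'c) \<Rightarrow> bool" where
  "graded_injective_resolution U R M E e d \<longleftrightarrow>
     is_graded_module R M \<and>
     (\<forall>i. graded_injective U R (E i)) \<and>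
     e \<in> graded_hom R M (E 0) \<and>
     (\<forall>i. d i \<in> graded_hom R (E i) (E (Suc i))) \<and>
     inj_on e (carrier M) \<and>
     e ` carrier M = a_kernel (E 0) (E 1) (d 0) \<and>
     (\<forall>i. d i ` carrier (E i) = a_kernel (E (Suc i)) (E (Suc (Suc i))) (d (Suc i)))"

definition graded_submodule ::
    "('a, 'b) graded_module \<Rightarrow> 'b set \<Rightarrow> ('a, 'b) graded_module" where
  "graded_submodule M N = M\<lparr>carrier := N, mcomp := \<lambda>n. mcomp M n \<inter> N\<rparr>"

text \<open>The fields \<open>mult\<close> and \<open>one\<close> are inherited from the record type of modules
  and play no role in a module.\<close>

definition graded_quotient ::
    "('a, 'b) graded_module \<Rightarrow> 'b set \<Rightarrow> ('a, 'b set) graded_module" where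
  "graded_quotient M N =
     \<lparr>carrier = a_rcosets\<^bsub>M\<^esub> N, monoid.mult = (\<lambda>_ _. N), one = N, ring.zero = N, add = set_add M,
      smult = (\<lambda>a C. \<Union>x \<in> C. N +>\<^bsub>M\<^esub> (a \<odot>\<^bsub>M\<^esub> x)),
      mcomp = (\<lambda>n. (\<lambda>x. N +>\<^bsub>M\<^esub> x) ` mcomp M n)\<rparr>"


subsection \<open>Local cohomology with respect to a pair of ideals\<close>

definition pair_torsion ::
    "('a, 'r) ring_scheme \<Rightarrow> 'a set \<Rightarrow> 'a set \<Rightarrow> ('a, 'b, 'm) module_scheme \<Rightarrow> 'b set" where
  "pair_torsion R I J M =
     {x \<in> carrier M. \<exists>n::nat. n \<ge> 1 \<and>
        (\<lambda>a. a \<odot>\<^bsub>M\<^esub> x) ` (I [^]\<^bsub>ideals_set R\<^esub> n) \<subseteq> (\<lambda>a. a \<odot>\<^bsub>M\<^esub> x) ` J}"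

text \<open>Cocycles and coboundaries of the complex obtained by applying the \<open>(I, J)\<close>-torsion
  functor to the complex \<open>E 0 \<rightarrow> E 1 \<rightarrow> \<dots>\<close>, and its cohomology.\<close>

definition pair_cocycles ::
    "'a graded_ring \<Rightarrow> 'a set \<Rightarrow> 'a set \<Rightarrow> (nat \<Rightarrow> ('a, 'c) graded_module) \<Rightarrow>
     (nat \<Rightarrow> 'c \<Rightarrow> 'c) \<Rightarrow> nat \<Rightarrow> 'c set" where
  "pair_cocycles R I J E d i = {x \<in> pair_torsion R I J (E i). d i x = \<zero>\<^bsub>E (Suc i)\<^esub>}"

definition pair_coboundaries ::
    "'a graded_ring \<Rightarrow> 'a set \<Rightarrow> 'a set \<Rightarrow> (nat \<Rightarrow> ('a, 'c) graded_module) \<Rightarrow>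
     (nat \<Rightarrow> 'c \<Rightarrow> 'c) \<Rightarrow> nat \<Rightarrow> 'c set" where
  "pair_coboundaries R I J E d i =
     (case i of 0 \<Rightarrow> {\<zero>\<^bsub>E 0\<^esub>} | Suc k \<Rightarrow> d k ` pair_torsion R I J (E k))"

text \<open>When \<open>E\<close>, \<open>d\<close> is a graded injective resolution of \<open>M\<close>, this is \<open>H\<^sup>i\<^sub>I\<^sub>,\<^sub>J(M)\<close>
  with its grading.\<close>

definition pair_local_cohomology ::
    "'a graded_ring \<Rightarrow> 'a set \<Rightarrow> 'a set \<Rightarrow> (nat \<Rightarrow> ('a, 'c) graded_module) \<Rightarrow>
     (nat \<Rightarrow> 'c \<Rightarrow> 'c) \<Rightarrow> nat \<Rightarrow> ('a, 'c set) graded_module" where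
  "pair_local_cohomology R I J E d i =
     graded_quotient (graded_submodule (E i) (pair_cocycles R I J E d i))
       (pair_coboundaries R I J E d i)"

end

theory Submission
  imports Defs
begin

text \<open>Let \<open>S\<close> generate \<open>J\<close>. If \<open>S\<close> contains a unit then \<open>J = R\<close> and every element is torsion. Otherwise
  Nakayama's lemma, applied to each \<open>R\<^sub>j\<close>, shows that a homogeneous element is torsion only if its
  annihilator contains all \<open>R\<^sub>j\<close> with \<open>j\<close> large. So it is enough to find \<open>n\<^sub>0\<close> such that every
  homogeneous cocycle \<open>x\<close> of degree \<open>n \<ge> n\<^sub>0\<close> with such an annihilator is \<open>d w\<close> with \<open>w\<close>
  killed by the annihilator of \<open>x\<close>: then \<open>w\<close> is torsion as well.
  In other words \<open>Ext\<^sup>q(R/A, M)\<^sub>n = 0\<close> for \<open>n \<ge> n\<^sub>0\<close>, uniformly in the homogeneous ideals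
  \<open>A\<close> that contain a power of \<open>R\<^sub>+\<close>. For \<open>A = R\<^sub>+\<close> this holds because \<open>Ext\<^sup>q(R/R\<^sub>+, M)\<close> is a finitely
  generated module killed by \<open>R\<^sub>+\<close>; larger and then smaller ideals are reached by adjoining one
  homogeneous element \<open>a\<close> at a time, using \<open>0 \<rightarrow> R/(A : a) \<rightarrow> R/A \<rightarrow> R/(A + Ra) \<rightarrow> 0\<close>, where the
  shift of the first term only increases the degree. Injectivity of the \<open>E q\<close> enters only through
  the divisibility property \<open>injective_divisible\<close>.\<close>

subsection \<open>Homogeneous components\<close>

text \<open>The obstacle is uniformity. The annihilator of a torsion cocycle varies with the
  cocycle, so a separate degree bound for each Ext^q(R/A, M) would not be enough. One bound serves
  all ideals because R has no elements of negative degree: passing from A to A + Ra involves A : a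
  only in degree n + e, where e >= 0 is the degree of \<open>a\<close>, so a bound that held before
  still applies. The passage does lower q, and for this reason the final bound is a maximum over all
  p <= q of the bounds for R_+. Long exact sequences are never formed. Since Hom(R/A, E q) is
  \<open>kill (E q) A\<close>, all arguments take place among submodules of the fixed modules
  \<open>E q\<close>: the map induced by \<open>a\<close> is multiplication by \<open>a\<close>, and
  the connecting map is replaced by a choice of w with d w = x. Finiteness of Ext is likewise an
  ascending chain condition between two submodules of \<open>E q\<close>. It originates in the
  kernel of \<open>d 0\<close>, which is a copy of M, and climbs to all q by dimension
  shifting.\<close>

definition hcomp :: "('b, 'm) ring_scheme \<Rightarrow> ('i \<Rightarrow> 'b set) \<Rightarrow> 'i \<Rightarrow> 'b \<Rightarrow> 'b" where
  "hcomp G D k x = (THE c. (\<forall>i. c i \<in> D i) \<and> finite {i. c i \<noteq> \<zero>\<^bsub>G\<^esub>} \<and>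
     x = (\<Oplus>\<^bsub>G\<^esub>i \<in> {i. c i \<noteq> \<zero>\<^bsub>G\<^esub>}. c i)) k"

locale graded_group = abelian_group G for G (structure) +
  fixes D :: "'i \<Rightarrow> 'a set"
  assumes direct_sum: "internal_direct_sum G D"
begin

lemma subgrp: "additive_subgroup (D i) G"
  using direct_sum by (simp add: internal_direct_sum_def)

lemma hom_carrier: "x \<in> D i \<Longrightarrow> x \<in> carrier G"
  using additive_subgroup.a_Hcarr[OF subgrp] .

lemma hom_zero: "\<zero> \<in> D i"
  using additive_subgroup.zero_closed[OF subgrp] .

lemma hom_add: "x \<in> D i \<Longrightarrow> y \<in> D i \<Longrightarrow> x \<oplus> y \<in> D i"
  using additive_subgroup.a_closed[OF subgrp] .

lemma hom_neg: "x \<in> D i \<Longrightarrow> \<ominus> x \<in> D i"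
  using additive_subgroup.a_inv_closed[OF subgrp] abelian_group_axioms by blast

lemma hcomp_ex1:
  assumes "x \<in> carrier G"
  shows "\<exists>!c. (\<forall>i. c i \<in> D i) \<and> finite {i. c i \<noteq> \<zero>} \<and> x = (\<Oplus>i \<in> {i. c i \<noteq> \<zero>}. c i)"
  using direct_sum assms by (simp add: internal_direct_sum_def)

lemma hcomp_props:
  assumes "x \<in> carrier G"
  shows "hcomp G D i x \<in> D i" "finite {i. hcomp G D i x \<noteq> \<zero>}"
    "x = (\<Oplus>i \<in> {i. hcomp G D i x \<noteq> \<zero>}. hcomp G D i x)"
  using theI'[OF hcomp_ex1[OF assms]] by (simp_all add: hcomp_def)

lemma hcomp_carrier [simp]: "x \<in> carrier G \<Longrightarrow> hcomp G D i x \<in> carrier G"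
  using hcomp_props(1) hom_carrier by blast

text \<open>\<open>F\<close> may exceed the support of \<open>c\<close>. Thus a sum over a common
  index set determines the components even if some summands cancel, as happens in
  \<open>hcomp_add\<close>.\<close>

lemma hcomp_unique:
  assumes x: "x \<in> carrier G" and c: "\<And>i. c i \<in> D i" and F: "finite F" "\<And>i. i \<notin> F \<Longrightarrow> c i = \<zero>"
    and xs: "x = (\<Oplus>i \<in> F. c i)"
  shows "hcomp G D i x = c i"
proof -
  have sub: "{i. c i \<noteq> \<zero>} \<subseteq> F" using F by blast
  have "x = (\<Oplus>i \<in> {i. c i \<noteq> \<zero>}. c i)"
    unfolding xs using sub F hom_carrier[OF c]
    by (intro add.finprod_mono_neutral_cong_right) (auto simp: Pi_def)
  then have "(\<lambda>i. hcomp G D i x) = c"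
    using hcomp_ex1[OF x] hcomp_props[OF x] c finite_subset[OF sub F(1)]
    by (smt (verit) Collect_cong)
  then show ?thesis by metis
qed

lemma hcomp_hom: assumes "x \<in> D j" shows "hcomp G D i x = (if i = j then x else \<zero>)"
  using hcomp_unique[of x "\<lambda>i. if i = j then x else \<zero>" "{j}" i] assms hom_carrier hom_zero
  by auto

lemma hcomp_same [simp]: "x \<in> D j \<Longrightarrow> hcomp G D j x = x"
  by (simp add: hcomp_hom)

lemma hcomp_zero [simp]: "hcomp G D i \<zero> = \<zero>"
  using hcomp_hom[OF hom_zero] by metis

lemma hcomp_add:
  assumes x: "x \<in> carrier G" and y: "y \<in> carrier G"
  shows "hcomp G D i (x \<oplus> y) = hcomp G D i x \<oplus> hcomp G D i y"
proof -
  let ?F = "{i. hcomp G D i x \<noteq> \<zero>} \<union> {i. hcomp G D i y \<noteq> \<zero>}"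
  have fin: "finite ?F" using hcomp_props x y by blast
  have ext: "z = (\<Oplus>i\<in>?F. hcomp G D i z)"
    if z: "z \<in> carrier G" "{i. hcomp G D i z \<noteq> \<zero>} \<subseteq> ?F" for z
  proof -
    have "(\<Oplus>i\<in>{i. hcomp G D i z \<noteq> \<zero>}. hcomp G D i z) = (\<Oplus>i\<in>?F. hcomp G D i z)"
      using z fin by (intro add.finprod_mono_neutral_cong_left) auto
    with hcomp_props(3)[OF z(1)] show ?thesis by simp
  qed
  have "x \<oplus> y = (\<Oplus>i\<in>?F. hcomp G D i x) \<oplus> (\<Oplus>i\<in>?F. hcomp G D i y)"
    using ext[OF x] ext[OF y] by auto
  also have "\<dots> = (\<Oplus>i\<in>?F. hcomp G D i x \<oplus> hcomp G D i y)"
    using x y by (subst finsum_addf) auto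
  finally show ?thesis
    using x y fin hcomp_props(1) hom_add
    by (intro hcomp_unique[where F = ?F]) auto
qed

lemma hcomp_neg:
  assumes x: "x \<in> carrier G"
  shows "hcomp G D i (\<ominus> x) = \<ominus> hcomp G D i x"
proof -
  have "hcomp G D i (\<ominus> x) \<oplus> hcomp G D i x = \<zero>"
    using hcomp_add[of "\<ominus> x" x i] x by (simp add: l_neg)
  then show ?thesis using x by (simp add: minus_equality)
qed

lemma hcomp_minus:
  assumes "x \<in> carrier G" "y \<in> carrier G"
  shows "hcomp G D i (x \<ominus> y) = hcomp G D i x \<ominus> hcomp G D i y"
  using assms by (simp add: a_minus_def hcomp_add hcomp_neg)

text \<open>An element is the finite sum of its components. The case \<open>hom\<close> speaks only
  of components of the given \<open>x\<close>, not of all homogeneous elements, so it may use facts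
  about \<open>x\<close> such as its membership in a homogeneous ideal.\<close>

lemma hom_induct [consumes 1, case_names zero add hom]:
  assumes x: "x \<in> carrier G" and zero: "P \<zero>"
    and add: "\<And>x y. x \<in> carrier G \<Longrightarrow> y \<in> carrier G \<Longrightarrow> P x \<Longrightarrow> P y \<Longrightarrow> P (x \<oplus> y)"
    and hom: "\<And>i. P (hcomp G D i x)"
  shows "P x"
proof -
  have "finite F \<Longrightarrow> P (\<Oplus>i\<in>F. hcomp G D i x)" for F
  proof (induction F rule: finite_induct)
    case (insert j F)
    then show ?case using x by (simp add: add hom)
  qed (simp add: zero)
  then show ?thesis using hcomp_props[OF x] by metis
qed

end

section \<open>Graded rings and graded modules over them\<close>

locale gr_ring = cring R for R :: "'a graded_ring" (structure) +
  assumes graded: "is_graded_ring R"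

sublocale gr_ring \<subseteq> G: graded_group R "rcomp R"
  using graded by unfold_locales (simp add: is_graded_ring_def)

context gr_ring
begin

abbreviation rc :: "nat \<Rightarrow> 'a \<Rightarrow> 'a" where "rc \<equiv> hcomp R (rcomp R)"

lemma rcomp_mult: "a \<in> rcomp R i \<Longrightarrow> b \<in> rcomp R j \<Longrightarrow> a \<otimes> b \<in> rcomp R (i + j)"
  using graded by (auto simp: is_graded_ring_def)

end

text \<open>For an ideal \<open>A\<close> this is the submodule (0 : A) of \<open>M\<close>, that is
  Hom(R/A, M), a homomorphism being identified with its value at the class of 1.\<close>

definition kill :: "('a, 'b) graded_module \<Rightarrow> 'a set \<Rightarrow> 'b set" where
  "kill M A = {x \<in> carrier M. \<forall>a\<in>A. a \<odot>\<^bsub>M\<^esub> x = \<zero>\<^bsub>M\<^esub>}"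

definition ann :: "'a graded_ring \<Rightarrow> ('a, 'b) graded_module \<Rightarrow> 'b \<Rightarrow> 'a set" where
  "ann R M x = {r \<in> carrier R. r \<odot>\<^bsub>M\<^esub> x = \<zero>\<^bsub>M\<^esub>}"

locale gr_mod = gr_ring R + module R M for R :: "'a graded_ring" (structure) and M :: "('a, 'b) graded_module" (structure) +
  assumes graded_mod: "is_graded_module R M"

sublocale gr_mod \<subseteq> M: graded_group M "mcomp M"
  using graded_mod by unfold_locales (simp add: is_graded_module_def)

context gr_mod
begin

abbreviation mc :: "int \<Rightarrow> 'b \<Rightarrow> 'b" where "mc \<equiv> hcomp M (mcomp M)"

lemma mcomp_smult: "a \<in> rcomp R i \<Longrightarrow> x \<in> mcomp M n \<Longrightarrow> a \<odot>\<^bsub>M\<^esub> x \<in> mcomp M (int i + n)"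
  using graded_mod by (auto simp: is_graded_module_def)

lemma mc_smult:
  assumes a: "a \<in> rcomp R i" and x: "x \<in> carrier M"
  shows "mc (int i + n) (a \<odot>\<^bsub>M\<^esub> x) = a \<odot>\<^bsub>M\<^esub> mc n x"
proof -
  have aR: "a \<in> carrier R" using a G.hom_carrier by blast
  have "\<forall>n. mc (int i + n) (a \<odot>\<^bsub>M\<^esub> x) = a \<odot>\<^bsub>M\<^esub> mc n x" using x
  proof (induction rule: M.hom_induct)
    case (add x y)
    then show ?case using aR by (simp add: smult_r_distr M.hcomp_add)
  next
    case (hom k)
    then show ?case using aR mcomp_smult[OF a M.hcomp_props(1)[OF x, of k]]
      by (auto simp: M.hcomp_hom M.hcomp_hom[OF M.hcomp_props(1)[OF x, of k]])
  qed (use aR in simp)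
  then show ?thesis by blast
qed

lemma mc_smult_hom:
  assumes r: "r \<in> carrier R" and x: "x \<in> mcomp M n"
  shows "mc (int k + n) (r \<odot>\<^bsub>M\<^esub> x) = rc k r \<odot>\<^bsub>M\<^esub> x"
proof -
  have xM: "x \<in> carrier M" using x M.hom_carrier by blast
  have "\<forall>k. mc (int k + n) (r \<odot>\<^bsub>M\<^esub> x) = rc k r \<odot>\<^bsub>M\<^esub> x" using r
  proof (induction rule: G.hom_induct)
    case (add a b)
    then show ?case using xM by (simp add: smult_l_distr M.hcomp_add G.hcomp_add)
  next
    case (hom j)
    then show ?case using xM mcomp_smult[OF G.hcomp_props(1)[OF r, of j] x]
      by (auto simp: M.hcomp_hom G.hcomp_hom[OF G.hcomp_props(1)[OF r, of j]])
  qed (use xM in simp)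
  then show ?thesis by blast
qed

lemma killD: "x \<in> kill M A \<Longrightarrow> a \<in> A \<Longrightarrow> a \<odot>\<^bsub>M\<^esub> x = \<zero>\<^bsub>M\<^esub>" "x \<in> kill M A \<Longrightarrow> x \<in> carrier M"
  by (auto simp: kill_def)

lemma kill_submodule: assumes "A \<subseteq> carrier R" shows "submodule (kill M A) R M"
proof (rule submoduleI)
  fix r x assume r: "r \<in> carrier R" and x: "x \<in> kill M A"
  have "a \<odot>\<^bsub>M\<^esub> (r \<odot>\<^bsub>M\<^esub> x) = \<zero>\<^bsub>M\<^esub>" if a: "a \<in> A" for a
  proof -
    have "a \<odot>\<^bsub>M\<^esub> (r \<odot>\<^bsub>M\<^esub> x) = r \<odot>\<^bsub>M\<^esub> (a \<odot>\<^bsub>M\<^esub> x)"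
      using smult_assoc1[of a r x] smult_assoc1[of r a x] m_comm[of a r] subsetD[OF assms a] r killD(2)[OF x]
      by simp
    then show ?thesis using killD(1)[OF x a] r by simp
  qed
  then show "r \<odot>\<^bsub>M\<^esub> x \<in> kill M A" using r killD[OF x] by (simp add: kill_def)
qed (use assms in \<open>auto simp: kill_def smult_r_distr smult_r_minus subset_iff\<close>)

end

section \<open>Homogeneous ideals and their shifts as graded modules\<close>

context gr_ring
begin

text \<open>This is \<open>A(-n)\<close>, the homogeneous ideal \<open>A\<close> with \<open>A(-n)\<^sub>k = A\<^sub>k\<^sub>-\<^sub>n\<close>.\<close>

definition twist :: "'a set \<Rightarrow> int \<Rightarrow> ('a, 'a) graded_module" where
  "twist A n = \<lparr>carrier = A, monoid.mult = monoid.mult R, one = \<one>, ring.zero = \<zero>, add = add R,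
     smult = monoid.mult R, mcomp = (\<lambda>k. if k \<ge> n then A \<inter> rcomp R (nat (k - n)) else {\<zero>})\<rparr>"

definition hideal :: "'a set \<Rightarrow> bool" where
  "hideal A \<longleftrightarrow> ideal A R \<and> (\<forall>x\<in>A. \<forall>k. rc k x \<in> A)"

lemma hideal_ideal: "hideal A \<Longrightarrow> ideal A R"
  by (simp add: hideal_def)

lemma hideal_carrier: "hideal A \<Longrightarrow> A \<subseteq> carrier R"
  using ideal.Icarr by (auto simp: hideal_def)

lemma hideal_rc: "hideal A \<Longrightarrow> x \<in> A \<Longrightarrow> rc k x \<in> A"
  by (simp add: hideal_def)

lemma hideal_closed:
  assumes "hideal A"
  shows "\<zero> \<in> A" "x \<in> A \<Longrightarrow> y \<in> A \<Longrightarrow> x \<oplus> y \<in> A" "x \<in> A \<Longrightarrow> \<ominus> x \<in> A"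
    "x \<in> A \<Longrightarrow> y \<in> A \<Longrightarrow> x \<ominus> y \<in> A"
    "x \<in> A \<Longrightarrow> r \<in> carrier R \<Longrightarrow> r \<otimes> x \<in> A" "x \<in> A \<Longrightarrow> r \<in> carrier R \<Longrightarrow> x \<otimes> r \<in> A"
proof -
  interpret ideal A R using assms by (rule hideal_ideal)
  show "\<zero> \<in> A" "x \<in> A \<Longrightarrow> y \<in> A \<Longrightarrow> x \<oplus> y \<in> A" "x \<in> A \<Longrightarrow> \<ominus> x \<in> A"
    "x \<in> A \<Longrightarrow> y \<in> A \<Longrightarrow> x \<ominus> y \<in> A"
    "x \<in> A \<Longrightarrow> r \<in> carrier R \<Longrightarrow> r \<otimes> x \<in> A" "x \<in> A \<Longrightarrow> r \<in> carrier R \<Longrightarrow> x \<otimes> r \<in> A"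
    by (auto simp: a_minus_def I_l_closed I_r_closed)
qed

lemma hidealI:
  assumes "A \<subseteq> carrier R" "\<zero> \<in> A" "\<And>x y. x \<in> A \<Longrightarrow> y \<in> A \<Longrightarrow> x \<oplus> y \<in> A"
    "\<And>x r. x \<in> A \<Longrightarrow> r \<in> carrier R \<Longrightarrow> r \<otimes> x \<in> A" "\<And>x k. x \<in> A \<Longrightarrow> rc k x \<in> A"
  shows "hideal A"
proof -
  have "\<ominus> x \<in> A" if "x \<in> A" for x
    using assms(4)[OF that, of "\<ominus> \<one>"] that assms(1) by (simp add: l_minus subsetD)
  then have "ideal A R"
    using assms
    by (intro idealI) (auto simp: ring_axioms m_comm subset_iff intro!: add.subgroupI simp flip: a_inv_def)
  then show ?thesis using assms(5) by (simp add: hideal_def)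
qed

lemma hideal_zero: "hideal {\<zero>}"
  by (rule hidealI) auto

text \<open>The substance is the direct sum decomposition: degrees of \<open>R\<close> are natural
  numbers and those of the shift are integers, so the unique decomposition in \<open>R\<close> has
  to be transported along the map from j to n + j.\<close>

lemma graded_module_twist:
  assumes A: "hideal A"
  shows "is_graded_module R (twist A n)"
proof -
  interpret A: ideal A R using A by (rule hideal_ideal)
  have AG: "abelian_group (twist A n)"
  proof (rule abelian_groupI)
    fix x assume "x \<in> carrier (twist A n)"
    then have "x \<in> A" "\<ominus> x \<in> A" "x \<in> carrier R"
      using hideal_closed(3)[OF A] hideal_carrier[OF A] by (auto simp: twist_def)
    then show "\<exists>y\<in>carrier (twist A n). y \<oplus>\<^bsub>twist A n\<^esub> x = \<zero>\<^bsub>twist A n\<^esub>"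
      by (intro bexI[of _ "\<ominus> x"]) (simp_all add: twist_def l_neg)
  qed (use hideal_closed(1,2)[OF A] hideal_carrier[OF A] in \<open>auto simp: twist_def a_ac subset_iff\<close>)
  then interpret T: abelian_group "twist A n" .
  have mod: "module R (twist A n)"
    using hideal_closed[OF A] hideal_carrier[OF A] AG
    by (intro moduleI) (auto simp: twist_def is_cring l_distr r_distr m_assoc subset_iff)
  \<comment> \<open>\<open>finsum\<close> takes the whole record as argument, so the sums in
    \<open>twist A n\<close> and in \<open>R\<close> are identified by induction, although the two
    records share their addition.\<close>
  have finsum: "finsum (twist A n) c F = finsum R c F"
    if "finite F" "\<And>i. i \<in> F \<Longrightarrow> c i \<in> A" for c :: "int \<Rightarrow> 'a" and F
    using that
  proof (induction rule: finite_induct)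
    case empty
    have "\<zero>\<^bsub>twist A n\<^esub> = \<zero>" by (simp add: twist_def)
    then show ?case by (metis T.finsum_empty finsum_empty)
  next
    case (insert j F)
    then have cA: "c \<in> F \<rightarrow> A" "c j \<in> A" by auto
    then have "finsum (twist A n) c (insert j F) = c j \<oplus>\<^bsub>twist A n\<^esub> finsum (twist A n) c F"
      using insert by (intro T.finsum_insert) (auto simp: twist_def)
    also have "\<dots> = c j \<oplus> finsum R c F" using insert by (simp add: twist_def)
    also have "\<dots> = finsum R c (insert j F)"
      using cA insert hideal_carrier[OF A] by (subst finsum_insert) auto
    finally show ?case .
  qed
  have sub: "additive_subgroup (mcomp (twist A n) k) (twist A n)" for k
  proof
    show "mcomp (twist A n) k \<subseteq> carrier (add_monoid (twist A n))"
      using hideal_closed[OF A] by (auto simp: twist_def)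
    show "\<one>\<^bsub>add_monoid (twist A n)\<^esub> \<in> mcomp (twist A n) k"
      using hideal_closed[OF A] by (auto simp: twist_def G.hom_zero)
    fix x y assume x: "x \<in> mcomp (twist A n) k" 
    then have xA: "x \<in> A" "\<ominus> x \<in> A" using hideal_closed[OF A] by (auto simp: twist_def split: if_splits)
    have "x \<in> carrier R" using xA hideal_carrier[OF A] by blast
    then have "inv\<^bsub>add_monoid (twist A n)\<^esub> x = \<ominus> x"
      using T.minus_equality[of "\<ominus> x" x] xA by (simp add: twist_def l_neg a_inv_def)
    moreover have "\<ominus> x \<in> mcomp (twist A n) k"
      using x xA by (auto simp: twist_def G.hom_neg split: if_splits)
    ultimately show "inv\<^bsub>add_monoid (twist A n)\<^esub> x \<in> mcomp (twist A n) k" by simp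
    assume y: "y \<in> mcomp (twist A n) k" 
    show "x \<otimes>\<^bsub>add_monoid (twist A n)\<^esub> y \<in> mcomp (twist A n) k"
      using x y hideal_closed[OF A] by (auto simp: twist_def G.hom_add split: if_splits)
  qed
  have ex1: "\<exists>!c. (\<forall>i. c i \<in> mcomp (twist A n) i) \<and> finite {i. c i \<noteq> \<zero>\<^bsub>twist A n\<^esub>} \<and>
        x = (\<Oplus>\<^bsub>twist A n\<^esub>i \<in> {i. c i \<noteq> \<zero>\<^bsub>twist A n\<^esub>}. c i)" (is "\<exists>!c. ?P c")
    if x: "x \<in> carrier (twist A n)" for x
  proof
    have xA: "x \<in> A" using x by (simp add: twist_def)
    then have xR: "x \<in> carrier R" using hideal_carrier[OF A] by blast
    have z: "\<zero>\<^bsub>twist A n\<^esub> = \<zero>" by (simp add: twist_def)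
    have eq: "c k = (if k \<ge> n then rc (nat (k - n)) x else \<zero>)" if "?P c" for c k
    proof -
      have c: "c i \<in> A" "i \<ge> n \<Longrightarrow> c i \<in> rcomp R (nat (i - n))" "i < n \<Longrightarrow> c i = \<zero>" for i
        using that hideal_closed[OF A] by (auto simp: twist_def split: if_splits dest!: spec[of _ i])
      have fin: "finite {i. c i \<noteq> \<zero>}" using that z by simp
      have "finite ((\<lambda>j. n + int j) ` {j. c (n + int j) \<noteq> \<zero>})"
        by (rule finite_subset[OF _ fin]) auto
      then have fin': "finite {j. c (n + int j) \<noteq> \<zero>}"
        by (rule finite_imageD) (auto intro: inj_onI)
      have "x = (\<Oplus>\<^bsub>twist A n\<^esub>i \<in> {i. c i \<noteq> \<zero>}. c i)" using that z by simp
      also have "\<dots> = (\<Oplus>i \<in> {i. c i \<noteq> \<zero>}. c i)" using c fin by (intro finsum) auto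
      also have "{i. c i \<noteq> \<zero>} = (\<lambda>j. n + int j) ` {j. c (n + int j) \<noteq> \<zero>}"
      proof (intro Set.set_eqI iffI)
        fix i assume i: "i \<in> {i. c i \<noteq> \<zero>}"
        then have "i \<ge> n" using c(3)[of i] by (cases "i < n") auto
        then show "i \<in> (\<lambda>j. n + int j) ` {j. c (n + int j) \<noteq> \<zero>}"
          using i by (intro image_eqI[of _ _ "nat (i - n)"]) auto
      qed auto
      also have "(\<Oplus>i \<in> \<dots>. c i) = (\<Oplus>j \<in> {j. c (n + int j) \<noteq> \<zero>}. c (n + int j))"
        using c hideal_carrier[OF A] by (subst finsum_reindex) (auto intro: inj_onI)
      finally have xsum: "x = (\<Oplus>j \<in> {j. c (n + int j) \<noteq> \<zero>}. c (n + int j))" .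
      have "rc j x = c (n + int j)" for j
        using xR fin' xsum c(2)
        by (intro G.hcomp_unique[where F = "{j. c (n + int j) \<noteq> \<zero>}"])
          (auto, metis add_diff_cancel_left' le_add_same_cancel1 nat_int of_nat_0_le_iff)
      then show ?thesis using c(3) by simp
    qed
    let ?c = "\<lambda>k. if k \<ge> n then rc (nat (k - n)) x else \<zero>"
    have supp: "{k. ?c k \<noteq> \<zero>} = (\<lambda>j. n + int j) ` {j. rc j x \<noteq> \<zero>}"
    proof (intro Set.set_eqI iffI)
      fix i assume i: "i \<in> {k. ?c k \<noteq> \<zero>}"
      then show "i \<in> (\<lambda>j. n + int j) ` {j. rc j x \<noteq> \<zero>}"
        by (intro image_eqI[of _ _ "nat (i - n)"]) (auto split: if_splits)
    qed auto
    have "x = (\<Oplus>j \<in> {j. rc j x \<noteq> \<zero>}. rc j x)" using G.hcomp_props[OF xR] by simp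
    also have "\<dots> = (\<Oplus>k \<in> (\<lambda>j. n + int j) ` {j. rc j x \<noteq> \<zero>}. ?c k)"
      using xR by (subst finsum_reindex) (auto intro: inj_onI)
    also have "\<dots> = (\<Oplus>\<^bsub>twist A n\<^esub>k \<in> {k. ?c k \<noteq> \<zero>}. ?c k)"
      using G.hcomp_props[OF xR] hideal_rc[OF A xA] hideal_closed[OF A]
      unfolding supp by (intro finsum[symmetric]) auto
    finally have "?P ?c"
      using z G.hcomp_props[OF xR] hideal_rc[OF A xA] supp
      by (auto simp: twist_def[of A n])
    then show "?P ?c" .
    show "c = ?c" if "?P c" for c
      using eq[OF that] by blast
  qed
  have "\<forall>d k. \<forall>a \<in> rcomp R d. \<forall>x \<in> mcomp (twist A n) k. a \<odot>\<^bsub>twist A n\<^esub> x \<in> mcomp (twist A n) (int d + k)"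
    using rcomp_mult hideal_closed[OF A] G.hom_carrier
    by (auto simp: twist_def nat_add_distrib add_diff_eq[symmetric] G.hom_zero)
  then show ?thesis
    using mod sub ex1 by (auto simp: is_graded_module_def internal_direct_sum_def)
qed

end

subsection \<open>Homogeneous ideals and divisibility in injective modules\<close>

context abelian_group
begin

lemma minus_eq_zero_iff:
  assumes "x \<in> carrier G" "y \<in> carrier G"
  shows "x \<ominus> y = \<zero> \<longleftrightarrow> x = y"
  using assms minus_equality[of x "\<ominus> y"] by (auto simp: a_minus_def r_neg)

lemma minus_add_self:
  assumes "x \<in> carrier G" "y \<in> carrier G"
  shows "(x \<ominus> y) \<oplus> y = x"
  using assms by (simp add: a_minus_def a_assoc l_neg)

end

context cring
begin

lemma add_minus_cancel: "\<lbrakk>x \<in> carrier R; y \<in> carrier R\<rbrakk> \<Longrightarrow> (x \<oplus> y) \<ominus> y = x"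
  by algebra

lemma minus_self: "x \<in> carrier R \<Longrightarrow> x \<ominus> x = \<zero>"
  by algebra

lemma minus_diff_eq:
  "\<lbrakk>x \<in> carrier R; b \<in> carrier R; r \<in> carrier R; s \<in> carrier R\<rbrakk>
    \<Longrightarrow> (s \<ominus> r) \<otimes> b = (x \<ominus> r \<otimes> b) \<ominus> (x \<ominus> s \<otimes> b)"
  by algebra

lemma minus_mult_add:
  "\<lbrakk>x \<in> carrier R; y \<in> carrier R; b \<in> carrier R; r \<in> carrier R; s \<in> carrier R\<rbrakk>
    \<Longrightarrow> x \<oplus> y \<ominus> (r \<oplus> s) \<otimes> b = (x \<ominus> r \<otimes> b) \<oplus> (y \<ominus> s \<otimes> b)"
  by algebra

lemma minus_mult_mult:
  "\<lbrakk>x \<in> carrier R; a \<in> carrier R; b \<in> carrier R; r \<in> carrier R\<rbrakk>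
    \<Longrightarrow> a \<otimes> x \<ominus> (a \<otimes> r) \<otimes> b = a \<otimes> (x \<ominus> r \<otimes> b)"
  by algebra

end

section \<open>Colon ideals and adjunction of one element\<close>

context gr_ring
begin

definition colon :: "'a set \<Rightarrow> 'a \<Rightarrow> 'a set" where
  "colon A b = {r \<in> carrier R. r \<otimes> b \<in> A}"

definition adjoin :: "'a set \<Rightarrow> 'a \<Rightarrow> 'a set" where
  "adjoin A b = {x. \<exists>c\<in>A. \<exists>r\<in>carrier R. x = c \<oplus> r \<otimes> b}"

lemma adjoinI: "c \<in> A \<Longrightarrow> r \<in> carrier R \<Longrightarrow> c \<oplus> r \<otimes> b \<in> adjoin A b"
  by (auto simp: adjoin_def)

text \<open>Degrees in \<open>R\<close> are natural numbers, so \<open>k - e\<close> is truncated.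
  For \<open>k < e\<close> it would select \<open>rc 0 r\<close>, hence the separate case.\<close>

lemma rc_mult:
  assumes b: "b \<in> rcomp R e" and r: "r \<in> carrier R"
  shows "rc k (r \<otimes> b) = (if e \<le> k then rc (k - e) r \<otimes> b else \<zero>)"
proof -
  have bR: "b \<in> carrier R" using b G.hom_carrier by blast
  have "\<forall>k. rc k (r \<otimes> b) = (if e \<le> k then rc (k - e) r \<otimes> b else \<zero>)" using r
  proof (induction rule: G.hom_induct)
    case (add x y)
    then show ?case using bR by (simp add: l_distr G.hcomp_add)
  next
    case (hom j)
    have *: "rc j r \<otimes> b \<in> rcomp R (j + e)" "rc j r \<in> rcomp R j"
      using rcomp_mult[OF _ b] G.hcomp_props(1)[OF r] by blast+
    show ?case using bR
      by (auto simp: G.hcomp_hom[OF *(1)] G.hcomp_hom[OF *(2)])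
  qed (use bR in simp)
  then show ?thesis by blast
qed

text \<open>Comparing components of degree i in 1 r = r, for r of degree i, shows that the degree
  zero component of 1 fixes every homogeneous element. It is therefore neutral and equal to
  1.\<close>

lemma one_hom: "\<one> \<in> rcomp R 0"
proof -
  let ?e = "rc 0 \<one>"
  have e: "?e \<in> rcomp R 0" using G.hcomp_props(1) by blast
  have "r \<otimes> ?e = r" if r: "r \<in> carrier R" for r
  proof (use r in \<open>induction rule: G.hom_induct\<close>)
    case (hom i)
    have "?e \<otimes> rc i r = rc i (\<one> \<otimes> rc i r)"
      using rc_mult[OF G.hcomp_props(1)[OF r, of i], of \<one> i] by simp
    also have "\<dots> = rc i r" using r G.hcomp_props(1) by simp
    finally show ?case using r by (simp add: m_comm)
  qed (simp_all add: l_distr)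
  from this[of \<one>] show ?thesis using e by simp
qed

lemma hideal_carrier_R: "hideal (carrier R)"
  by (rule hidealI) auto

lemma hideal_colon:
  assumes A: "hideal A" and b: "b \<in> rcomp R e"
  shows "hideal (colon A b)"
proof (rule hidealI)
  have bR: "b \<in> carrier R" using b G.hom_carrier by blast
  fix x k assume "x \<in> colon A b"
  then show "rc k x \<in> colon A b"
    using rc_mult[OF b, of x "k + e"] hideal_rc[OF A, of "x \<otimes> b" "k + e"] by (simp add: colon_def)
qed (use hideal_closed[OF A] G.hom_carrier[OF b] in \<open>auto simp: colon_def l_distr m_assoc\<close>)

lemma colon_superset: "hideal A \<Longrightarrow> b \<in> carrier R \<Longrightarrow> A \<subseteq> colon A b"
  using hideal_closed(6)[of A] hideal_carrier[of A] by (auto simp: colon_def)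

lemma hideal_adjoin:
  assumes A: "hideal A" and b: "b \<in> rcomp R e"
  shows "hideal (adjoin A b)"
proof (rule hidealI)
  have bR: "b \<in> carrier R" using b G.hom_carrier by blast
  note Ac = hideal_closed[OF A] subsetD[OF hideal_carrier[OF A]]
  show "adjoin A b \<subseteq> carrier R" using bR Ac by (auto simp: adjoin_def)
  show "\<zero> \<in> adjoin A b" using bR Ac by (auto simp: adjoin_def intro!: bexI[of _ \<zero>])
  fix x assume "x \<in> adjoin A b"
  then obtain c r where x: "c \<in> A" "r \<in> carrier R" "x = c \<oplus> r \<otimes> b" by (auto simp: adjoin_def)
  show "rc k x \<in> adjoin A b" for k
  proof (cases "e \<le> k")
    case True
    then have "rc k x = rc k c \<oplus> rc (k - e) r \<otimes> b"
      using x bR Ac by (simp add: G.hcomp_add rc_mult[OF b])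
    then show ?thesis using adjoinI[OF hideal_rc[OF A x(1)] G.hcomp_carrier[OF x(2)]] by simp
  next
    case False
    then have "rc k x = rc k c \<oplus> \<zero> \<otimes> b"
      using x bR Ac by (simp add: G.hcomp_add rc_mult[OF b])
    then show ?thesis using adjoinI[OF hideal_rc[OF A x(1)] zero_closed] by simp
  qed
  show "s \<otimes> x \<in> adjoin A b" if s: "s \<in> carrier R" for s
  proof -
    have "s \<otimes> x = s \<otimes> c \<oplus> (s \<otimes> r) \<otimes> b" using x s bR Ac by (simp add: r_distr m_assoc)
    then show ?thesis using adjoinI[OF Ac(5)[OF x(1) s] m_closed[OF s x(2)]] by simp
  qed
  fix y assume "y \<in> adjoin A b"
  then obtain d t where y: "d \<in> A" "t \<in> carrier R" "y = d \<oplus> t \<otimes> b" by (auto simp: adjoin_def)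
  have "x \<oplus> y = (c \<oplus> d) \<oplus> (r \<oplus> t) \<otimes> b"
    using x y bR Ac by (simp add: l_distr a_ac)
  then show "x \<oplus> y \<in> adjoin A b"
    using adjoinI[OF Ac(2)[OF x(1) y(1)] a_closed[OF x(2) y(2)]] by simp
qed

lemma adjoin_superset: "hideal A \<Longrightarrow> b \<in> carrier R \<Longrightarrow> A \<subseteq> adjoin A b"
proof
  fix c assume *: "hideal A" "b \<in> carrier R" "c \<in> A"
  then have "c = c \<oplus> \<zero> \<otimes> b" using hideal_carrier by (simp add: subset_iff)
  then show "c \<in> adjoin A b" using * unfolding adjoin_def by blast
qed

lemma adjoin_self: "hideal A \<Longrightarrow> b \<in> carrier R \<Longrightarrow> b \<in> adjoin A b"
proof -
  assume *: "hideal A" "b \<in> carrier R"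
  then have "b = \<zero> \<oplus> \<one> \<otimes> b" by simp
  then show "b \<in> adjoin A b" using * hideal_closed(1) unfolding adjoin_def by blast
qed

lemma adjoin_least:
  assumes "A \<subseteq> C" "hideal C" "b \<in> C"
  shows "adjoin A b \<subseteq> C"
  using assms hideal_closed[OF assms(2)] by (auto simp: adjoin_def)

end

context gr_mod
begin

text \<open>Each component of an element of \<open>A\<close> lies in \<open>A\<close> and kills
  \<open>x\<close>; being homogeneous, it kills every component of \<open>x\<close>
  separately.\<close>

lemma kill_hideal:
  assumes A: "hideal A" and x: "x \<in> kill M A"
  shows "mc k x \<in> kill M A"
proof -
  have xM: "x \<in> carrier M" using killD x by blast
  have "a \<odot>\<^bsub>M\<^esub> mc k x = \<zero>\<^bsub>M\<^esub>" if a: "a \<in> A" for a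
  proof -
    have aR: "a \<in> carrier R" using hideal_carrier[OF A] a by blast
    from aR show ?thesis
    proof (induction rule: G.hom_induct)
      case (hom i)
      have "rc i a \<odot>\<^bsub>M\<^esub> mc k x = mc (int i + k) (rc i a \<odot>\<^bsub>M\<^esub> x)"
        using mc_smult[OF G.hcomp_props(1)[OF aR, of i] xM] by simp
      also have "\<dots> = \<zero>\<^bsub>M\<^esub>" using killD(1)[OF x hideal_rc[OF A a]] by simp
      finally show ?case .
    qed (use xM in \<open>simp_all add: smult_l_distr\<close>)
  qed
  then show ?thesis using xM by (simp add: kill_def)
qed

lemma ann_hideal:
  assumes x: "x \<in> mcomp M n"
  shows "hideal (ann R M x)"
proof (rule hidealI)
  fix r k assume "r \<in> ann R M x"
  then show "rc k r \<in> ann R M x"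
    using mc_smult_hom[OF _ x, of r k] by (simp add: ann_def)
qed (use M.hom_carrier[OF x] in \<open>auto simp: ann_def smult_l_distr smult_assoc1\<close>)

text \<open>Together with \<open>kill_adjoinD\<close> and \<open>smult_kill_colon\<close> this is
  the left exactness of Hom(-, M) on 0 -> R/(A : b) -> R/A -> R/(A + Rb) -> 0, the map of the first
  term being multiplication by \<open>b\<close>.\<close>

lemma kill_adjoin:
  assumes "x \<in> kill M A" "b \<in> carrier R" "b \<odot>\<^bsub>M\<^esub> x = \<zero>\<^bsub>M\<^esub>" "A \<subseteq> carrier R"
  shows "x \<in> kill M (adjoin A b)"
  using assms by (auto simp: kill_def adjoin_def smult_l_distr smult_assoc1 subset_iff)

lemma kill_adjoinD:
  assumes "x \<in> kill M (adjoin A b)" "hideal A" "b \<in> carrier R"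
  shows "x \<in> kill M A" "b \<odot>\<^bsub>M\<^esub> x = \<zero>\<^bsub>M\<^esub>"
  using assms adjoin_superset[of A b] adjoin_self[of A b] by (auto simp: kill_def)

lemma smult_kill_colon:
  assumes "x \<in> kill M A" "b \<in> carrier R" "A \<subseteq> carrier R"
  shows "b \<odot>\<^bsub>M\<^esub> x \<in> kill M (colon A b)"
proof -
  have "r \<odot>\<^bsub>M\<^esub> (b \<odot>\<^bsub>M\<^esub> x) = \<zero>\<^bsub>M\<^esub>" if "r \<in> colon A b" for r
    using that assms killD[OF assms(1)] smult_assoc1[of r b x] by (simp add: colon_def)
  then show ?thesis using assms(2) killD(2)[OF assms(1)] by (simp add: kill_def)
qed

text \<open>Maps out of \<open>(A + Rb)(-n)\<close> that vanish on \<open>A\<close> correspond to elements killed by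
  the colon ideal of \<open>A\<close> and \<open>b\<close>; such a map extends to \<open>R(-n)\<close>.\<close>

lemma injective_divisible:
  assumes inj: "graded_injective TYPE('a) R M"
    and A: "hideal A" and b: "b \<in> rcomp R e" and v: "v \<in> mcomp M (int e + n)" "v \<in> kill M (colon A b)"
  shows "\<exists>w\<in>mcomp M n. w \<in> kill M A \<and> b \<odot>\<^bsub>M\<^esub> w = v"
proof -
  define C where "C = adjoin A b"
  have bR: "b \<in> carrier R" using b G.hom_carrier by blast
  have vM: "v \<in> carrier M" using v M.hom_carrier by blast
  have C: "hideal C" using hideal_adjoin[OF A b] by (simp add: C_def)
  note Ac = hideal_closed[OF A] subsetD[OF hideal_carrier[OF A]]
  note Cc = hideal_closed[OF C] subsetD[OF hideal_carrier[OF C]]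
  \<comment> \<open>\<open>rep x\<close> is a coefficient of \<open>b\<close> in one way of writing
    \<open>x\<close>; the map \<open>g\<close> is meant to send c + r b to r v.\<close>
  define rep where "rep x = (SOME r. r \<in> carrier R \<and> x \<ominus> r \<otimes> b \<in> A)" for x
  have rep: "rep x \<in> carrier R \<and> x \<ominus> rep x \<otimes> b \<in> A" if x: "x \<in> C" for x
  proof -
    obtain c r where cr: "c \<in> A" "r \<in> carrier R" "x = c \<oplus> r \<otimes> b" using x by (auto simp: C_def adjoin_def)
    then have "x \<ominus> r \<otimes> b = c" using Ac bR by (simp add: add_minus_cancel)
    then show ?thesis
      using cr someI[of "\<lambda>r. r \<in> carrier R \<and> x \<ominus> r \<otimes> b \<in> A" r] by (simp add: rep_def)
  qed
  define g where "g x = rep x \<odot>\<^bsub>M\<^esub> v" for x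
  \<comment> \<open>Two coefficients of the same \<open>x\<close> differ by an element of
    \<open>colon A b\<close>, which kills \<open>v\<close>. So \<open>g\<close> may be computed from
    any coefficient, and additivity, linearity and homogeneity follow by choosing a convenient
    one.\<close>
  have g: "g x = r \<odot>\<^bsub>M\<^esub> v" if x: "x \<in> C" and r: "r \<in> carrier R" "x \<ominus> r \<otimes> b \<in> A" for x r
  proof -
    note rx = rep[OF x]
    have xR: "x \<in> carrier R" by (rule Cc(7)[OF x])
    have "(rep x \<ominus> r) \<otimes> b = (x \<ominus> r \<otimes> b) \<ominus> (x \<ominus> rep x \<otimes> b)"
      using minus_diff_eq[of x b r "rep x"] rx r bR xR by blast
    then have "(rep x \<ominus> r) \<otimes> b \<in> A" using Ac(4) rx r by simp
    then have "(rep x \<ominus> r) \<odot>\<^bsub>M\<^esub> v = \<zero>\<^bsub>M\<^esub>" using rx r by (intro killD(1)[OF v(2)]) (simp add: colon_def)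
    then have "rep x \<odot>\<^bsub>M\<^esub> v \<ominus>\<^bsub>M\<^esub> r \<odot>\<^bsub>M\<^esub> v = \<zero>\<^bsub>M\<^esub>"
      using rx r vM by (simp add: a_minus_def smult_l_distr smult_l_minus)
    then show ?thesis using rx r vM by (simp add: g_def M.minus_eq_zero_iff)
  qed
  have "g \<in> graded_hom R (twist C n) M"
    unfolding graded_hom_def hom_def
  proof (intro CollectI conjI ballI allI funcsetI)
    show "x \<in> carrier (add_monoid (twist C n)) \<Longrightarrow> g x \<in> carrier (add_monoid M)" for x
      using rep vM by (simp add: twist_def g_def)
    show "g (x \<otimes>\<^bsub>add_monoid (twist C n)\<^esub> y) = g x \<otimes>\<^bsub>add_monoid M\<^esub> g y"
      if "x \<in> carrier (add_monoid (twist C n))" "y \<in> carrier (add_monoid (twist C n))" for x y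
    proof -
      have xy: "x \<in> C" "y \<in> C" using that by (simp_all add: twist_def)
      have xyR: "x \<in> carrier R" "y \<in> carrier R" using Cc(7)[OF xy(1)] Cc(7)[OF xy(2)] by blast+
      note r = rep[OF xy(1)] rep[OF xy(2)]
      have "x \<oplus> y \<ominus> (rep x \<oplus> rep y) \<otimes> b = (x \<ominus> rep x \<otimes> b) \<oplus> (y \<ominus> rep y \<otimes> b)"
        using minus_mult_add[of x y b "rep x" "rep y"] r xyR bR by blast
      then have "g (x \<oplus> y) = (rep x \<oplus> rep y) \<odot>\<^bsub>M\<^esub> v"
        using r xy Ac(2) Cc(2) by (intro g) simp_all
      then show ?thesis using r vM by (simp add: twist_def g_def smult_l_distr)
    qed
    show "g (a \<odot>\<^bsub>twist C n\<^esub> x) = a \<odot>\<^bsub>M\<^esub> g x" if a: "a \<in> carrier R" and "x \<in> carrier (twist C n)" for a x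
    proof -
      have x: "x \<in> C" using that by (simp add: twist_def)
      have xR: "x \<in> carrier R" by (rule Cc(7)[OF x])
      note r = rep[OF x]
      have "a \<otimes> x \<ominus> (a \<otimes> rep x) \<otimes> b = a \<otimes> (x \<ominus> rep x \<otimes> b)"
        using minus_mult_mult[of x a b "rep x"] r xR bR a by blast
      then have "g (a \<otimes> x) = (a \<otimes> rep x) \<odot>\<^bsub>M\<^esub> v"
        using r x a Ac(5) Cc(5) by (intro g) simp_all
      then show ?thesis using r vM a by (simp add: twist_def g_def smult_assoc1)
    qed
    show "g ` mcomp (twist C n) k \<subseteq> mcomp M k" for k
    proof
      fix y assume "y \<in> g ` mcomp (twist C n) k"
      then obtain x where x: "x \<in> mcomp (twist C n) k" "y = g x" by blast
      have g0: "x \<in> C \<Longrightarrow> x \<in> A \<Longrightarrow> g x \<in> mcomp M k" for x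
        using g[of x \<zero>] vM Ac bR by (simp add: a_minus_def M.hom_zero)
      show "y \<in> mcomp M k"
      proof (cases "k \<ge> n")
        case False
        then show ?thesis using x g0 Ac(1) Cc(1) by (simp add: twist_def)
      next
        case True
        define j where "j = nat (k - n)"
        have xj: "x \<in> rcomp R j" "x \<in> C" using x True by (auto simp: twist_def j_def)
        have xR: "x \<in> carrier R" by (rule Cc(7)[OF xj(2)])
        note r = rep[OF xj(2)]
        \<comment> \<open>In degree \<open>j\<close> the relation still contains all of
          \<open>x\<close>. For \<open>e \<le> j\<close> it exhibits a homogeneous coefficient of
          \<open>x\<close>; otherwise it says that \<open>x\<close> lies in \<open>A\<close>, where
          \<open>g\<close> vanishes.\<close>
        have "rc j (x \<ominus> rep x \<otimes> b) \<in> A" using hideal_rc[OF A] r by blast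
        then have *: "x \<ominus> rc j (rep x \<otimes> b) \<in> A" using xj xR r bR by (simp add: G.hcomp_minus)
        show ?thesis
        proof (cases "e \<le> j")
          case le: True
          then have "x \<ominus> rc (j - e) (rep x) \<otimes> b \<in> A" using * r by (simp add: rc_mult[OF b])
          then have "g x = rc (j - e) (rep x) \<odot>\<^bsub>M\<^esub> v" using r xj by (intro g) auto
          moreover have "\<dots> \<in> mcomp M (int (j - e) + (int e + n))"
            using G.hcomp_props(1) r by (intro mcomp_smult v(1)) blast
          moreover have "int (j - e) + (int e + n) = k" using le True by (simp add: j_def)
          ultimately show ?thesis using x by simp
        next
          case False
          then have "x \<in> A" using * r xR by (simp add: rc_mult[OF b] a_minus_def)
          then show ?thesis using g0 xj x by simp
        qed
      qed
    qed
  qed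
  moreover have "id \<in> graded_hom R (twist C n) (twist (carrier R) n)"
    using Cc by (auto simp: graded_hom_def hom_def twist_def)
  moreover have "inj_on id (carrier (twist C n))" by simp
  ultimately have "\<exists>h\<in>graded_hom R (twist (carrier R) n) M. \<forall>x\<in>carrier (twist C n). h (id x) = g x"
    using inj[unfolded graded_injective_def, THEN conjunct2, rule_format]
      graded_module_twist[OF C] graded_module_twist[OF hideal_carrier_R] by blast
  then obtain h where h: "h \<in> graded_hom R (twist (carrier R) n) M"
    "\<And>x. x \<in> C \<Longrightarrow> h x = g x"
    by (auto simp: twist_def[of C])
  have lin0: "\<forall>a\<in>carrier R. \<forall>x\<in>carrier R. h (a \<otimes> x) = a \<odot>\<^bsub>M\<^esub> h x"
    using h(1) by (simp add: graded_hom_def twist_def)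
  have lin: "h (r \<otimes> \<one>) = r \<odot>\<^bsub>M\<^esub> h \<one>" if "r \<in> carrier R" for r
    using lin0 that one_closed by blast
  \<comment> \<open>The shift puts \<open>\<one>\<close> in degree \<open>n\<close>, so its image
    under \<open>h\<close> is a homogeneous solution of that degree.\<close>
  have "\<one> \<in> mcomp (twist (carrier R) n) n" using one_hom by (simp add: twist_def)
  then have h1: "h \<one> \<in> mcomp M n" using h(1) unfolding graded_hom_def by blast
  have hx: "x \<odot>\<^bsub>M\<^esub> h \<one> = g x" if "x \<in> C" for x
    using lin[of x] Cc that h(2) by simp
  have "x \<odot>\<^bsub>M\<^esub> h \<one> = \<zero>\<^bsub>M\<^esub>" if "x \<in> A" for x
  proof -
    have "x \<in> C" using adjoin_superset[OF A bR] that by (auto simp: C_def)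
    then show ?thesis using hx g[of x \<zero>] that vM Ac bR by (simp add: a_minus_def)
  qed
  moreover have "b \<odot>\<^bsub>M\<^esub> h \<one> = v"
  proof -
    have "b \<in> C" using adjoin_self[OF A bR] by (simp add: C_def)
    then show ?thesis using hx g[of b \<one>] vM Ac bR minus_self by simp
  qed
  ultimately show ?thesis using h1 M.hom_carrier[OF h1] by (auto simp: kill_def)
qed

text \<open>The components of \<open>v\<close> are divided one at a time. Degrees of
  \<open>M\<close> are integers, so the quotient of \<open>mc k v\<close> can sit in degree
  \<open>k - int e\<close> for every \<open>k\<close>.\<close>

lemma injective_divisible_kill:
  assumes inj: "graded_injective TYPE('a) R M"
    and A: "hideal A" and b: "b \<in> rcomp R e" and v: "v \<in> kill M (colon A b)"
  shows "\<exists>w\<in>kill M A. b \<odot>\<^bsub>M\<^esub> w = v"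
proof -
  have bR: "b \<in> carrier R" using b G.hom_carrier by blast
  interpret K: submodule "kill M A" R M using A by (intro kill_submodule hideal_carrier)
  show ?thesis
  proof (use killD(2)[OF v] in \<open>induction rule: M.hom_induct\<close>)
    case zero
    then show ?case using bR K.one_closed by (intro bexI[of _ "\<zero>\<^bsub>M\<^esub>"]) auto
  next
    case (add x y)
    then obtain w z where "w \<in> kill M A" "z \<in> kill M A" "b \<odot>\<^bsub>M\<^esub> w = x" "b \<odot>\<^bsub>M\<^esub> z = y" by blast
    then show ?case
      using bR killD(2)[of _ A] K.m_closed[of w z]
      by (intro bexI[of _ "w \<oplus>\<^bsub>M\<^esub> z"]) (auto simp: smult_r_distr)
  next
    case (hom k)
    have "mc k v \<in> mcomp M (int e + (k - int e))" using M.hcomp_props(1)[OF killD(2)[OF v]] by simp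
    then show ?case
      using injective_divisible[OF inj A b] kill_hideal[OF hideal_colon[OF A b] v] by blast
  qed
qed

end

subsection \<open>Ascending chains of submodules\<close>

text \<open>In a Noetherian ring a nonempty chain of ideals contains its union, so Zorn's lemma
  applies to any nonempty family of ideals, with no closure condition on the family.\<close>

lemma (in noetherian_ring) ideals_maximal:
  assumes "S \<noteq> {}" "\<And>I. I \<in> S \<Longrightarrow> ideal I R"
  shows "\<exists>I\<in>S. \<forall>I'\<in>S. I \<subseteq> I' \<longrightarrow> I' = I"
proof (rule subset_Zorn_nonempty[OF assms(1)])
  fix C assume C: "C \<noteq> {}" "subset.chain S C"
  then have "C \<subseteq> {I. ideal I R}" using assms(2) unfolding pred_on.chain_def by auto
  then have "subset.chain {I. ideal I R} C" using C(2) unfolding pred_on.chain_def by simp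
  then have "\<Union>C \<in> C" using ideal_chain_is_trivial C(1) by blast
  then show "\<Union>C \<in> S" using C(2) unfolding pred_on.chain_def by blast
qed

lemma (in noetherian_ring) ideals_stabilize:
  assumes "\<And>n. ideal (I n) R" "\<And>n::nat. I n \<subseteq> I (Suc n)"
  shows "\<exists>k. \<forall>n\<ge>k. I n \<subseteq> I k"
proof -
  have "\<exists>J\<in>range I. \<forall>J'\<in>range I. J \<subseteq> J' \<longrightarrow> J' = J"
    by (rule ideals_maximal) (auto simp: assms(1))
  then obtain k where k: "\<And>n. I k \<subseteq> I n \<Longrightarrow> I n = I k" by auto
  have "I k \<subseteq> I n" if "k \<le> n" for n using lift_Suc_mono_le[of I, OF assms(2) that] .
  then show ?thesis using k by blast
qed

text \<open>For submodules \<open>Y\<close> and \<open>Z\<close> this says that Z/Y is Noetherian.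
  Without forming the quotient, all modules compared later remain submodules of one fixed
  module.\<close>

definition acc_between ::
    "('a, 'r) ring_scheme \<Rightarrow> ('a, 'b, 'm) module_scheme \<Rightarrow> 'b set \<Rightarrow> 'b set \<Rightarrow> bool" where
  "acc_between R M Y Z \<longleftrightarrow> (\<forall>L :: nat \<Rightarrow> 'b set.
     (\<forall>n. submodule (L n) R M \<and> Y \<subseteq> L n \<and> L n \<subseteq> Z \<and> L n \<subseteq> L (Suc n)) \<longrightarrow>
     (\<exists>k. \<forall>n\<ge>k. L n \<subseteq> L k))"

lemma acc_betweenD:
  assumes "acc_between R M Y Z" "\<And>n. submodule (L n) R M" "\<And>n. Y \<subseteq> L n" "\<And>n. L n \<subseteq> Z"
    "\<And>n. L n \<subseteq> L (Suc n)"
  shows "\<exists>k. \<forall>n\<ge>k. L n \<subseteq> L k"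
  using assms(1)[unfolded acc_between_def, rule_format, of L] assms(2-) by simp

lemma acc_between_trivial:
  fixes R :: "('a, 'r) ring_scheme" and M :: "('a, 'b, 'm) module_scheme"
  assumes "Z \<subseteq> Y"
  shows "acc_between R M Y Z"
  unfolding acc_between_def
proof (intro allI impI exI)
  fix L :: "nat \<Rightarrow> 'b set" and n :: nat
  assume "\<forall>n. submodule (L n) R M \<and> Y \<subseteq> L n \<and> L n \<subseteq> Z \<and> L n \<subseteq> L (Suc n)"
  then have "L n \<subseteq> Z" "Y \<subseteq> L 0" by blast+
  then show "L n \<subseteq> L 0" using assms by blast
qed

section \<open>Submodules and Noetherian modules\<close>

context module
begin

lemma submodule_add:
  assumes "submodule N R M" "submodule K R M"
  shows "submodule {x \<oplus>\<^bsub>M\<^esub> y | x y. x \<in> N \<and> y \<in> K} R M"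
proof -
  note N = submoduleE[OF assms(1)] subgroup.one_closed[OF submodule.axioms(1)[OF assms(1)]]
  note K = submoduleE[OF assms(2)] subgroup.one_closed[OF submodule.axioms(1)[OF assms(2)]]
  have 0: "\<zero>\<^bsub>M\<^esub> \<in> N" "\<zero>\<^bsub>M\<^esub> \<in> K" using N(7) K(7) by simp_all
  show ?thesis
  proof (rule submoduleI)
    show "{x \<oplus>\<^bsub>M\<^esub> y | x y. x \<in> N \<and> y \<in> K} \<subseteq> carrier M" using N(1) K(1) by auto
    show "\<zero>\<^bsub>M\<^esub> \<in> {x \<oplus>\<^bsub>M\<^esub> y | x y. x \<in> N \<and> y \<in> K}"
      using 0 M.l_zero[OF M.zero_closed] by (intro CollectI exI[of _ "\<zero>\<^bsub>M\<^esub>"]) simp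
    fix a assume "a \<in> {x \<oplus>\<^bsub>M\<^esub> y | x y. x \<in> N \<and> y \<in> K}"
    then obtain x y where a: "x \<in> N" "y \<in> K" "a = x \<oplus>\<^bsub>M\<^esub> y" by blast
    have xy: "x \<in> carrier M" "y \<in> carrier M" using a N(1) K(1) by auto
    have "\<ominus>\<^bsub>M\<^esub> a = \<ominus>\<^bsub>M\<^esub> x \<oplus>\<^bsub>M\<^esub> \<ominus>\<^bsub>M\<^esub> y" using a xy M.minus_add by simp
    then show "\<ominus>\<^bsub>M\<^esub> a \<in> {x \<oplus>\<^bsub>M\<^esub> y | x y. x \<in> N \<and> y \<in> K}" using a N(3) K(3) by blast
    show "r \<odot>\<^bsub>M\<^esub> a \<in> {x \<oplus>\<^bsub>M\<^esub> y | x y. x \<in> N \<and> y \<in> K}" if r: "r \<in> carrier R" for r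
    proof -
      have "r \<odot>\<^bsub>M\<^esub> a = r \<odot>\<^bsub>M\<^esub> x \<oplus>\<^bsub>M\<^esub> r \<odot>\<^bsub>M\<^esub> y" using a xy r smult_r_distr by simp
      then show ?thesis using a N(4) K(4) r by blast
    qed
    fix b assume "b \<in> {x \<oplus>\<^bsub>M\<^esub> y | x y. x \<in> N \<and> y \<in> K}"
    then obtain x' y' where b: "x' \<in> N" "y' \<in> K" "b = x' \<oplus>\<^bsub>M\<^esub> y'" by blast
    have xy': "x' \<in> carrier M" "y' \<in> carrier M" using b N(1) K(1) by auto
    have "a \<oplus>\<^bsub>M\<^esub> b = (x \<oplus>\<^bsub>M\<^esub> x') \<oplus>\<^bsub>M\<^esub> (y \<oplus>\<^bsub>M\<^esub> y')" using a b xy xy' by (simp add: M.a_ac)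
    then show "a \<oplus>\<^bsub>M\<^esub> b \<in> {x \<oplus>\<^bsub>M\<^esub> y | x y. x \<in> N \<and> y \<in> K}" using a b N(5) K(5) by blast
  qed
qed

lemma submodule_inter:
  assumes "submodule N R M" "submodule K R M"
  shows "submodule (N \<inter> K) R M"
proof -
  note N = submoduleE[OF assms(1)] subgroup.one_closed[OF submodule.axioms(1)[OF assms(1)]]
  note K = submoduleE[OF assms(2)] subgroup.one_closed[OF submodule.axioms(1)[OF assms(2)]]
  show ?thesis using N(1,3,4,5,7) K(1,3,4,5,7) by (intro submoduleI) auto
qed

lemma submodule_zero: "submodule {\<zero>\<^bsub>M\<^esub>} R M"
  by (rule submoduleI) auto

lemma submodule_minus:
  assumes "submodule N R M" "x \<in> N" "y \<in> N" shows "x \<ominus>\<^bsub>M\<^esub> y \<in> N"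
  using submoduleE(3,5)[OF assms(1)] assms(2,3) by (simp add: a_minus_def)

lemma submodule_zero_in: "submodule N R M \<Longrightarrow> \<zero>\<^bsub>M\<^esub> \<in> N"
  using subgroup.one_closed[OF submodule.axioms(1)] by fastforce

lemma submodule_smult_image:
  assumes a: "a \<in> carrier R" and N: "submodule N R M"
  shows "submodule ((\<lambda>x. a \<odot>\<^bsub>M\<^esub> x) ` N) R M"
proof (rule submoduleI)
  note N' = submoduleE[OF N] submodule_zero_in[OF N]
  have C: "x \<in> N \<Longrightarrow> x \<in> carrier M" for x using N' by blast
  show "(\<lambda>x. a \<odot>\<^bsub>M\<^esub> x) ` N \<subseteq> carrier M" using a C by auto
  show "\<zero>\<^bsub>M\<^esub> \<in> (\<lambda>x. a \<odot>\<^bsub>M\<^esub> x) ` N"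
    using a N'(7) by (intro image_eqI[of _ _ "\<zero>\<^bsub>M\<^esub>"]) auto
  fix y assume "y \<in> (\<lambda>x. a \<odot>\<^bsub>M\<^esub> x) ` N"
  then obtain x where x: "x \<in> N" "y = a \<odot>\<^bsub>M\<^esub> x" by blast
  show "\<ominus>\<^bsub>M\<^esub> y \<in> (\<lambda>x. a \<odot>\<^bsub>M\<^esub> x) ` N"
    using x a C N'(3) by (intro image_eqI[of _ _ "\<ominus>\<^bsub>M\<^esub> x"]) (auto simp: smult_r_minus)
  show "r \<odot>\<^bsub>M\<^esub> y \<in> (\<lambda>x. a \<odot>\<^bsub>M\<^esub> x) ` N" if r: "r \<in> carrier R" for r
  proof (rule image_eqI[of _ _ "r \<odot>\<^bsub>M\<^esub> x"])
    show "r \<odot>\<^bsub>M\<^esub> y = a \<odot>\<^bsub>M\<^esub> (r \<odot>\<^bsub>M\<^esub> x)"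
      using smult_assoc1[of a r x] smult_assoc1[of r a x] R.m_comm[of a r] a r C[OF x(1)] x(2) by simp
  qed (use N'(4) r x in auto)
  fix z assume "z \<in> (\<lambda>x. a \<odot>\<^bsub>M\<^esub> x) ` N"
  then obtain w where w: "w \<in> N" "z = a \<odot>\<^bsub>M\<^esub> w" by blast
  show "y \<oplus>\<^bsub>M\<^esub> z \<in> (\<lambda>x. a \<odot>\<^bsub>M\<^esub> x) ` N"
    using x w a C N'(5) by (intro image_eqI[of _ _ "x \<oplus>\<^bsub>M\<^esub> w"]) (auto simp: smult_r_distr)
qed

lemma span_submodule: "submodule (\<Inter>{N. submodule N R M \<and> S \<subseteq> N}) R M" if "S \<subseteq> carrier M"
proof -
  let ?F = "{N. submodule N R M \<and> S \<subseteq> N}"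
  show ?thesis
  proof (rule submoduleI)
    show "\<Inter>?F \<subseteq> carrier M" using carrier_is_submodule that by blast
    show "\<zero>\<^bsub>M\<^esub> \<in> \<Inter>?F" using submodule_zero_in by blast
    show "x \<in> \<Inter>?F \<Longrightarrow> \<ominus>\<^bsub>M\<^esub> x \<in> \<Inter>?F" for x using submoduleE(3) by blast
    show "x \<in> \<Inter>?F \<Longrightarrow> y \<in> \<Inter>?F \<Longrightarrow> x \<oplus>\<^bsub>M\<^esub> y \<in> \<Inter>?F" for x y using submoduleE(5) by blast
    show "a \<in> carrier R \<Longrightarrow> x \<in> \<Inter>?F \<Longrightarrow> a \<odot>\<^bsub>M\<^esub> x \<in> \<Inter>?F" for a x
      using submoduleE(4) by blast
  qed
qed

text \<open>Induction on the generators. When \<open>s\<close> is added to a span T, two chains are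
  derived from a chain of submodules: its intersections with T, and the ideals of coefficients of
  \<open>s\<close> modulo T. Once both are stationary, so is the chain itself.\<close>

lemma acc_between_span:
  assumes noeth: "noetherian_ring R" and fin: "finite S" and S: "S \<subseteq> carrier M"
  shows "acc_between R M {\<zero>\<^bsub>M\<^esub>} (\<Inter>{N. submodule N R M \<and> S \<subseteq> N})"
  using fin S
proof (induction rule: finite_induct)
  case empty
  have "\<Inter>{N. submodule N R M \<and> {} \<subseteq> N} \<subseteq> {\<zero>\<^bsub>M\<^esub>}"
    by (rule Inter_lower) (simp add: submodule_zero)
  then show ?case by (rule acc_between_trivial)
next
  case (insert s S)
  let ?T = "\<Inter>{N. submodule N R M \<and> S \<subseteq> N}" and ?T' = "\<Inter>{N. submodule N R M \<and> insert s S \<subseteq> N}"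
  have T: "submodule ?T R M" using span_submodule insert by simp
  note T' = submoduleE[OF T] submodule_zero_in[OF T]
  have s: "s \<in> carrier M" using insert by simp
  let ?K = "{r \<odot>\<^bsub>M\<^esub> s \<oplus>\<^bsub>M\<^esub> y | r y. r \<in> carrier R \<and> y \<in> ?T}"
  have Rs: "submodule ((\<lambda>r. r \<odot>\<^bsub>M\<^esub> s) ` carrier R) R M"
  proof (rule submoduleI)
    fix x assume "x \<in> (\<lambda>r. r \<odot>\<^bsub>M\<^esub> s) ` carrier R"
    then obtain r where r: "r \<in> carrier R" "x = r \<odot>\<^bsub>M\<^esub> s" by blast
    show "\<ominus>\<^bsub>M\<^esub> x \<in> (\<lambda>r. r \<odot>\<^bsub>M\<^esub> s) ` carrier R"
      using r s by (intro image_eqI[of _ _ "\<ominus> r"]) (auto simp: smult_l_minus)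
    show "a \<odot>\<^bsub>M\<^esub> x \<in> (\<lambda>r. r \<odot>\<^bsub>M\<^esub> s) ` carrier R" if "a \<in> carrier R" for a
      using r s that by (intro image_eqI[of _ _ "a \<otimes> r"]) (auto simp: smult_assoc1)
    fix y assume "y \<in> (\<lambda>r. r \<odot>\<^bsub>M\<^esub> s) ` carrier R"
    then obtain t where t: "t \<in> carrier R" "y = t \<odot>\<^bsub>M\<^esub> s" by blast
    show "x \<oplus>\<^bsub>M\<^esub> y \<in> (\<lambda>r. r \<odot>\<^bsub>M\<^esub> s) ` carrier R"
      using r s t by (intro image_eqI[of _ _ "r \<oplus> t"]) (auto simp: smult_l_distr)
  qed (use s in \<open>auto intro!: image_eqI[of _ _ \<zero>]\<close>)
  have "submodule {x \<oplus>\<^bsub>M\<^esub> y | x y. x \<in> (\<lambda>r. r \<odot>\<^bsub>M\<^esub> s) ` carrier R \<and> y \<in> ?T} R M"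
    using submodule_add[OF Rs T] .
  also have "{x \<oplus>\<^bsub>M\<^esub> y | x y. x \<in> (\<lambda>r. r \<odot>\<^bsub>M\<^esub> s) ` carrier R \<and> y \<in> ?T} = ?K" by blast
  finally have K: "submodule ?K R M" .
  have "insert s S \<subseteq> ?K"
  proof -
    have "s = \<one> \<odot>\<^bsub>M\<^esub> s \<oplus>\<^bsub>M\<^esub> \<zero>\<^bsub>M\<^esub>" using s by simp
    then have "s \<in> ?K" using T'(7) by blast
    moreover have "t \<in> ?K" if t: "t \<in> S" for t
    proof -
      have "t = \<zero> \<odot>\<^bsub>M\<^esub> s \<oplus>\<^bsub>M\<^esub> t" using s t insert by auto
      then show ?thesis using t by blast
    qed
    ultimately show ?thesis by blast
  qed
  then have TK: "?T' \<subseteq> ?K" using K by blast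
  show ?case
    unfolding acc_between_def
  proof (intro allI impI)
    fix L :: "nat \<Rightarrow> 'c set"
    assume L: "\<forall>n. submodule (L n) R M \<and> {\<zero>\<^bsub>M\<^esub>} \<subseteq> L n \<and> L n \<subseteq> ?T' \<and> L n \<subseteq> L (Suc n)"
    have Ls: "submodule (L n) R M" and LT: "L n \<subseteq> ?T'" and LSuc: "L n \<subseteq> L (Suc n)" for n
      using L by blast+
    note Ln = submoduleE[OF Ls] submodule_zero_in[OF Ls]
    have mono: "L n \<subseteq> L m" if "n \<le> m" for n m by (rule lift_Suc_mono_le[of L, OF LSuc that])
    \<comment> \<open>These are the r for which r s lies in L n + T.\<close>
    define I where "I n = {r \<in> carrier R. \<exists>y\<in>?T. r \<odot>\<^bsub>M\<^esub> s \<oplus>\<^bsub>M\<^esub> y \<in> L n}" for n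
    have T'c: "y \<in> ?T \<Longrightarrow> y \<in> carrier M" for y using T'(1) by blast
    have "ideal (I n) R" for n
    proof (rule idealI)
      show "subgroup (I n) (add_monoid R)"
      proof (rule R.add.subgroupI)
        have "\<zero> \<odot>\<^bsub>M\<^esub> s \<oplus>\<^bsub>M\<^esub> \<zero>\<^bsub>M\<^esub> \<in> L n" using s Ln(7)[of n] by simp
        then have "\<zero> \<in> I n" unfolding I_def using T'(7) by blast
        then show "I n \<noteq> {}" by blast
        fix r assume "r \<in> I n"
        then obtain y where r: "r \<in> carrier R" "y \<in> ?T" "r \<odot>\<^bsub>M\<^esub> s \<oplus>\<^bsub>M\<^esub> y \<in> L n" by (auto simp: I_def)
        have "\<ominus>\<^bsub>M\<^esub> (r \<odot>\<^bsub>M\<^esub> s \<oplus>\<^bsub>M\<^esub> y) = (\<ominus> r) \<odot>\<^bsub>M\<^esub> s \<oplus>\<^bsub>M\<^esub> \<ominus>\<^bsub>M\<^esub> y"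
          using r s T'c[OF r(2)] M.minus_add by (simp add: smult_l_minus)
        then have "(\<ominus> r) \<odot>\<^bsub>M\<^esub> s \<oplus>\<^bsub>M\<^esub> \<ominus>\<^bsub>M\<^esub> y \<in> L n" using Ln(3)[OF r(3)] by simp
        then show "\<ominus> r \<in> I n" unfolding I_def using r(1) T'(3)[OF r(2)] by blast
        fix t assume "t \<in> I n"
        then obtain z where t: "t \<in> carrier R" "z \<in> ?T" "t \<odot>\<^bsub>M\<^esub> s \<oplus>\<^bsub>M\<^esub> z \<in> L n" by (auto simp: I_def)
        have "(r \<odot>\<^bsub>M\<^esub> s \<oplus>\<^bsub>M\<^esub> y) \<oplus>\<^bsub>M\<^esub> (t \<odot>\<^bsub>M\<^esub> s \<oplus>\<^bsub>M\<^esub> z) = (r \<oplus> t) \<odot>\<^bsub>M\<^esub> s \<oplus>\<^bsub>M\<^esub> (y \<oplus>\<^bsub>M\<^esub> z)"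
          using r t s T'c[OF r(2)] T'c[OF t(2)] by (simp add: smult_l_distr M.a_ac)
        then have "(r \<oplus> t) \<odot>\<^bsub>M\<^esub> s \<oplus>\<^bsub>M\<^esub> (y \<oplus>\<^bsub>M\<^esub> z) \<in> L n" using Ln(5)[OF r(3) t(3)] by simp
        then show "r \<oplus> t \<in> I n" unfolding I_def using r(1) t(1) T'(5)[OF r(2) t(2)] by blast
      qed (auto simp: I_def)
      fix a r assume "r \<in> I n" and a: "a \<in> carrier R"
      then obtain y where r: "r \<in> carrier R" "y \<in> ?T" "r \<odot>\<^bsub>M\<^esub> s \<oplus>\<^bsub>M\<^esub> y \<in> L n" by (auto simp: I_def)
      have "a \<odot>\<^bsub>M\<^esub> (r \<odot>\<^bsub>M\<^esub> s \<oplus>\<^bsub>M\<^esub> y) = (a \<otimes> r) \<odot>\<^bsub>M\<^esub> s \<oplus>\<^bsub>M\<^esub> a \<odot>\<^bsub>M\<^esub> y"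
        using r a s T'c[OF r(2)] by (simp add: smult_r_distr smult_assoc1)
      then have "(a \<otimes> r) \<odot>\<^bsub>M\<^esub> s \<oplus>\<^bsub>M\<^esub> a \<odot>\<^bsub>M\<^esub> y \<in> L n" using Ln(4)[OF a r(3)] by simp
      then show "a \<otimes> r \<in> I n" unfolding I_def using r(1) a T'(4)[OF a r(2)] by blast
      then show "r \<otimes> a \<in> I n" using R.m_comm a r by simp
    qed (rule R.ring_axioms)
    moreover have "I n \<subseteq> I (Suc n)" for n using LSuc[of n] unfolding I_def by blast
    ultimately obtain k1 where k1: "\<And>n. n \<ge> k1 \<Longrightarrow> I n \<subseteq> I k1"
      using noetherian_ring.ideals_stabilize[OF noeth, of I] by blast
    have "\<exists>k. \<forall>n\<ge>k. L n \<inter> ?T \<subseteq> L k \<inter> ?T"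
    proof (rule acc_betweenD[OF insert.IH, where L = "\<lambda>n. L n \<inter> ?T"])
      show "S \<subseteq> carrier M" using insert.prems by simp
      show "submodule (L n \<inter> ?T) R M" for n by (rule submodule_inter[OF Ls T])
      show "{\<zero>\<^bsub>M\<^esub>} \<subseteq> L n \<inter> ?T" for n using T'(7) Ln(7)[of n] by blast
      show "L n \<inter> ?T \<subseteq> L (Suc n) \<inter> ?T" for n using LSuc[of n] by blast
    qed simp
    then obtain k2 where k2: "\<And>n. n \<ge> k2 \<Longrightarrow> L n \<inter> ?T \<subseteq> L k2 \<inter> ?T" by blast
    show "\<exists>k. \<forall>n\<ge>k. L n \<subseteq> L k"
    proof (intro exI[of _ "max k1 k2"] allI impI subsetI)
      fix n x assume n: "n \<ge> max k1 k2" and x: "x \<in> L n"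
      then obtain r y where r: "r \<in> carrier R" "y \<in> ?T" "x = r \<odot>\<^bsub>M\<^esub> s \<oplus>\<^bsub>M\<^esub> y"
        using TK LT[of n] by blast
      then have "r \<in> I n" using x by (auto simp: I_def)
      then have "r \<in> I k1" using k1 n by auto
      then obtain z where z: "z \<in> ?T" "r \<odot>\<^bsub>M\<^esub> s \<oplus>\<^bsub>M\<^esub> z \<in> L k1" by (auto simp: I_def)
      \<comment> \<open>\<open>w\<close> lies in the stable stage and has the same coefficient of
        \<open>s\<close> as \<open>x\<close>, so the difference lies in the span of \<open>S\<close>
        and is caught by the intersections.\<close>
      define w where "w = r \<odot>\<^bsub>M\<^esub> s \<oplus>\<^bsub>M\<^esub> z"
      have w: "w \<in> L (max k1 k2)" "w \<in> L n" using z(2) mono[of k1 "max k1 k2"] mono[of k1 n] n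
        by (auto simp: w_def)
      have wx: "w \<in> carrier M" "x \<in> carrier M" using w(2) x Ln(1)[of n] by blast+
      have "x \<ominus>\<^bsub>M\<^esub> w = y \<ominus>\<^bsub>M\<^esub> z"
      proof -
        have "(r \<odot>\<^bsub>M\<^esub> s \<oplus>\<^bsub>M\<^esub> y) \<oplus>\<^bsub>M\<^esub> (\<ominus>\<^bsub>M\<^esub> z \<oplus>\<^bsub>M\<^esub> \<ominus>\<^bsub>M\<^esub> (r \<odot>\<^bsub>M\<^esub> s)) = y \<oplus>\<^bsub>M\<^esub> \<ominus>\<^bsub>M\<^esub> z"
          using r s T'c[OF r(2)] T'c[OF z(1)] by (simp add: M.a_ac M.r_neg1 M.r_neg2 M.r_neg M.l_neg)
        then show ?thesis using r s T'c[OF z(1)] by (simp add: a_minus_def w_def M.minus_add M.a_comm)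
      qed
      moreover have "x \<ominus>\<^bsub>M\<^esub> w \<in> L n" using submodule_minus[OF Ls x w(2)] .
      moreover have "y \<ominus>\<^bsub>M\<^esub> z \<in> ?T" using submodule_minus[OF T r(2) z(1)] .
      ultimately have "x \<ominus>\<^bsub>M\<^esub> w \<in> L n \<inter> ?T" by simp
      then have "x \<ominus>\<^bsub>M\<^esub> w \<in> L (max k1 k2)" using k2[of n] n mono[of k2 "max k1 k2"] by auto
      then have "(x \<ominus>\<^bsub>M\<^esub> w) \<oplus>\<^bsub>M\<^esub> w \<in> L (max k1 k2)" using w(1) Ln(5) by blast
      then show "x \<in> L (max k1 k2)" using wx by (simp add: a_minus_def M.a_assoc M.l_neg)
    qed
  qed
qed

end

subsection \<open>Complexes of graded injective modules\<close>

text \<open>The module M has disappeared: its image is the kernel of \<open>d 0\<close>, and its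
  finite generation survives in the form of \<open>acc_H0\<close>.\<close>

locale gr_complex = gr_ring R for R :: "'a graded_ring" (structure) +
  fixes E :: "nat \<Rightarrow> ('a, 'c) graded_module" and d :: "nat \<Rightarrow> 'c \<Rightarrow> 'c"
  assumes noeth: "noetherian_ring R"
    and injective: "graded_injective TYPE('a) R (E q)"
    and diff: "d q \<in> graded_hom R (E q) (E (Suc q))"
    and diff_diff: "w \<in> carrier (E q) \<Longrightarrow> d (Suc q) (d q w) = \<zero>\<^bsub>E (Suc (Suc q))\<^esub>"
    and exact: "x \<in> carrier (E (Suc q)) \<Longrightarrow> d (Suc q) x = \<zero>\<^bsub>E (Suc (Suc q))\<^esub> \<Longrightarrow>
      \<exists>w\<in>carrier (E q). d q w = x"
    and acc_H0: "acc_between R (E 0) {\<zero>\<^bsub>E 0\<^esub>} {x \<in> carrier (E 0). d 0 x = \<zero>\<^bsub>E (Suc 0)\<^esub>}"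
begin

lemma E_graded: "is_graded_module R (E q)"
  using injective by (simp add: graded_injective_def)

lemma E_gr_mod: "gr_mod R (E q)"
  using gr_ring_axioms E_graded[of q]
  by (simp add: gr_mod_def gr_mod_axioms_def is_graded_module_def)

end

sublocale gr_complex \<subseteq> E: gr_mod R "E q" for q
  by (rule E_gr_mod)

context gr_complex
begin

abbreviation ec :: "nat \<Rightarrow> int \<Rightarrow> 'c \<Rightarrow> 'c" where "ec q \<equiv> hcomp (E q) (mcomp (E q))"

lemma d_closed: "x \<in> carrier (E q) \<Longrightarrow> d q x \<in> carrier (E (Suc q))"
  using diff[of q] by (auto simp: graded_hom_def hom_def)

lemma d_add:
  "x \<in> carrier (E q) \<Longrightarrow> y \<in> carrier (E q) \<Longrightarrow> d q (x \<oplus>\<^bsub>E q\<^esub> y) = d q x \<oplus>\<^bsub>E (Suc q)\<^esub> d q y"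
  using diff[of q] by (auto simp: graded_hom_def hom_def)

lemma d_smult:
  "r \<in> carrier R \<Longrightarrow> x \<in> carrier (E q) \<Longrightarrow> d q (r \<odot>\<^bsub>E q\<^esub> x) = r \<odot>\<^bsub>E (Suc q)\<^esub> d q x"
  using diff[of q] by (auto simp: graded_hom_def)

lemma d_hom: "x \<in> mcomp (E q) n \<Longrightarrow> d q x \<in> mcomp (E (Suc q)) n"
  using diff[of q] unfolding graded_hom_def by blast

lemma d_zero: "d q \<zero>\<^bsub>E q\<^esub> = \<zero>\<^bsub>E (Suc q)\<^esub>"
  using d_smult[of \<zero> "\<zero>\<^bsub>E q\<^esub>" q] d_closed[of "\<zero>\<^bsub>E q\<^esub>" q] by simp

lemma d_neg: "x \<in> carrier (E q) \<Longrightarrow> d q (\<ominus>\<^bsub>E q\<^esub> x) = \<ominus>\<^bsub>E (Suc q)\<^esub> d q x"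
  using d_smult[of "\<ominus> \<one>" x q] d_closed[of x q] by (simp add: E.smult_l_minus)

lemma d_minus:
  "x \<in> carrier (E q) \<Longrightarrow> y \<in> carrier (E q) \<Longrightarrow> d q (x \<ominus>\<^bsub>E q\<^esub> y) = d q x \<ominus>\<^bsub>E (Suc q)\<^esub> d q y"
  by (simp add: a_minus_def d_add d_neg)

lemma d_ec:
  assumes x: "x \<in> carrier (E q)"
  shows "ec (Suc q) k (d q x) = d q (ec q k x)"
  using x
proof (induction rule: E.M.hom_induct)
  case (add y z)
  then show ?case by (simp add: d_add d_closed E.M.hcomp_add)
next
  case (hom i)
  have "ec q i x \<in> mcomp (E q) i" using E.M.hcomp_props(1)[OF x] .
  then show ?case using d_hom[of "ec q i x" q i]
    by (simp add: E.M.hcomp_hom d_zero)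
qed (simp add: d_zero)

text \<open>For homogeneous \<open>A\<close> the modules \<open>kill (E q) A\<close> form the
  complex Hom(R/A, E), so \<open>cocycles q A\<close> modulo \<open>cobounds q A\<close> is
  Ext^q(R/A, M) when \<open>E\<close> resolves M.\<close>

definition cocycles :: "nat \<Rightarrow> 'a set \<Rightarrow> 'c set" where
  "cocycles q A = {x \<in> kill (E q) A. d q x = \<zero>\<^bsub>E (Suc q)\<^esub>}"

definition cobounds :: "nat \<Rightarrow> 'a set \<Rightarrow> 'c set" where
  "cobounds q A = (case q of 0 \<Rightarrow> {\<zero>\<^bsub>E 0\<^esub>} | Suc p \<Rightarrow> d p ` kill (E p) A)"

lemma cobounds_simps [simp]:
  "cobounds 0 A = {\<zero>\<^bsub>E 0\<^esub>}" "cobounds (Suc p) A = d p ` kill (E p) A"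
  by (simp_all add: cobounds_def)

lemma kill_sub: "hideal A \<Longrightarrow> submodule (kill (E q) A) R (E q)"
  by (intro E.kill_submodule hideal_carrier)

lemma kill_carrier: "x \<in> kill (E q) A \<Longrightarrow> x \<in> carrier (E q)"
  by (rule E.killD(2))

lemma d_kill:
  assumes "x \<in> kill (E q) A" "hideal A"
  shows "d q x \<in> kill (E (Suc q)) A"
proof -
  have x: "x \<in> carrier (E q)" using kill_carrier assms(1) by blast
  have "a \<odot>\<^bsub>E (Suc q)\<^esub> d q x = \<zero>\<^bsub>E (Suc q)\<^esub>" if a: "a \<in> A" for a
  proof -
    have "a \<in> carrier R" using hideal_carrier assms(2) a by blast
    then have "a \<odot>\<^bsub>E (Suc q)\<^esub> d q x = d q (a \<odot>\<^bsub>E q\<^esub> x)" using d_smult x by simp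
    also have "\<dots> = \<zero>\<^bsub>E (Suc q)\<^esub>" using E.killD(1)[OF assms(1) a] d_zero by simp
    finally show ?thesis .
  qed
  then show ?thesis using d_closed[OF x] by (simp add: kill_def)
qed

lemma d_image_sub:
  assumes N: "submodule N R (E q)"
  shows "submodule (d q ` N) R (E (Suc q))"
proof (rule E.submoduleI)
  note N' = E.submoduleE[OF N] E.submodule_zero_in[OF N]
  have C: "x \<in> carrier (E q)" if "x \<in> N" for x using N'(1) that by blast
  show "d q ` N \<subseteq> carrier (E (Suc q))" using C d_closed by blast
  show "\<zero>\<^bsub>E (Suc q)\<^esub> \<in> d q ` N" using N'(7) d_zero by (intro image_eqI[of _ _ "\<zero>\<^bsub>E q\<^esub>"]) simp_all
  fix y assume "y \<in> d q ` N"
  then obtain x where x: "x \<in> N" "y = d q x" by blast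
  show "\<ominus>\<^bsub>E (Suc q)\<^esub> y \<in> d q ` N"
    using x(2) d_neg[OF C[OF x(1)]] N'(3)[OF x(1)] by (intro image_eqI[of _ _ "\<ominus>\<^bsub>E q\<^esub> x"]) simp_all
  show "r \<odot>\<^bsub>E (Suc q)\<^esub> y \<in> d q ` N" if r: "r \<in> carrier R" for r
    using x(2) d_smult[OF r C[OF x(1)]] N'(4)[OF r x(1)] by (intro image_eqI[of _ _ "r \<odot>\<^bsub>E q\<^esub> x"]) simp_all
  fix z assume "z \<in> d q ` N"
  then obtain w where w: "w \<in> N" "z = d q w" by blast
  show "y \<oplus>\<^bsub>E (Suc q)\<^esub> z \<in> d q ` N"
    using x(2) w(2) d_add[OF C[OF x(1)] C[OF w(1)]] N'(5)[OF x(1) w(1)]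
    by (intro image_eqI[of _ _ "x \<oplus>\<^bsub>E q\<^esub> w"]) simp_all
qed

lemma d_preimage_sub:
  assumes N: "submodule N R (E (Suc q))"
  shows "submodule {x \<in> carrier (E q). d q x \<in> N} R (E q)"
proof (rule E.submoduleI)
  note N' = E.submoduleE[OF N] E.submodule_zero_in[OF N]
  show "\<zero>\<^bsub>E q\<^esub> \<in> {x \<in> carrier (E q). d q x \<in> N}" using N'(7) by (simp add: d_zero)
  show "\<ominus>\<^bsub>E q\<^esub> x \<in> {x \<in> carrier (E q). d q x \<in> N}" if "x \<in> {x \<in> carrier (E q). d q x \<in> N}" for x
    using that N'(3) by (simp add: d_neg)
  show "x \<oplus>\<^bsub>E q\<^esub> y \<in> {x \<in> carrier (E q). d q x \<in> N}"
    if "x \<in> {x \<in> carrier (E q). d q x \<in> N}" "y \<in> {x \<in> carrier (E q). d q x \<in> N}" for x y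
    using that N'(5) by (simp add: d_add)
  show "r \<odot>\<^bsub>E q\<^esub> x \<in> {x \<in> carrier (E q). d q x \<in> N}"
    if "r \<in> carrier R" "x \<in> {x \<in> carrier (E q). d q x \<in> N}" for r x
    using that N'(4) by (simp add: d_smult)
qed blast

lemma kernel_sub: "submodule {x \<in> carrier (E q). d q x = \<zero>\<^bsub>E (Suc q)\<^esub>} R (E q)"
  using d_preimage_sub[OF E.submodule_zero[of "Suc q"]] by simp

lemma cocycles_sub: "hideal A \<Longrightarrow> submodule (cocycles q A) R (E q)"
proof -
  assume "hideal A"
  moreover have "cocycles q A = kill (E q) A \<inter> {x \<in> carrier (E q). d q x = \<zero>\<^bsub>E (Suc q)\<^esub>}"
    using kill_carrier by (auto simp: cocycles_def)
  ultimately show ?thesis using E.submodule_inter[OF kill_sub kernel_sub, of A q] by simp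
qed

lemma cobounds_sub: "hideal A \<Longrightarrow> submodule (cobounds q A) R (E q)"
  by (cases q) (simp_all add: E.submodule_zero d_image_sub kill_sub)

lemma cobounds_cocycles:
  assumes A: "hideal A" shows "cobounds q A \<subseteq> cocycles q A"
proof (cases q)
  case 0
  then show ?thesis using E.submodule_zero_in[OF cocycles_sub[OF A], of 0] by simp
next
  case (Suc p)
  show ?thesis
  proof
    fix x assume "x \<in> cobounds q A"
    then obtain w where w: "w \<in> kill (E p) A" "x = d p w" using Suc by auto
    then show "x \<in> cocycles q A"
      using Suc d_kill[OF w(1) A] diff_diff[OF kill_carrier[OF w(1)]] by (simp add: cocycles_def)
  qed
qed

lemma cobounds_ec:
  assumes A: "hideal A" and x: "x \<in> cobounds q A"
  shows "ec q k x \<in> cobounds q A"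
proof (cases q)
  case 0
  then show ?thesis using x by simp
next
  case (Suc p)
  then obtain w where w: "w \<in> kill (E p) A" "x = d p w" using x by auto
  then have "ec q k x = d p (ec p k w)" using Suc d_ec[OF kill_carrier[OF w(1)]] by simp
  then show ?thesis using Suc E.kill_hideal[OF A w(1)] by simp
qed

lemma kill_antimono: "A \<subseteq> A' \<Longrightarrow> kill (E q) A' \<subseteq> kill (E q) A"
  by (auto simp: kill_def)

lemma cocycles_antimono: "A \<subseteq> A' \<Longrightarrow> cocycles q A' \<subseteq> cocycles q A"
  using kill_antimono[of A A' q] by (auto simp: cocycles_def)

lemma cobounds_antimono: "A \<subseteq> A' \<Longrightarrow> cobounds q A' \<subseteq> cobounds q A"
  using kill_antimono[of A A' "q - 1"] by (cases q) (auto simp: image_mono)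

text \<open>Injectivity makes multiplication by \<open>a\<close> from Hom(R/A, E p) to Hom(R/(A :
  a), E p) surjective; applying \<open>d p\<close> transports this to coboundaries one degree
  higher. In degree 0 all coboundaries are zero.\<close>

lemma cobounds_divide:
  assumes A: "hideal A" and a: "a \<in> rcomp R e" and b: "b \<in> cobounds q (colon A a)"
  shows "\<exists>y\<in>cobounds q A. a \<odot>\<^bsub>E q\<^esub> y = b"
proof (cases q)
  case 0
  then show ?thesis using b G.hom_carrier[OF a] by simp
next
  case (Suc p)
  then obtain v where v: "v \<in> kill (E p) (colon A a)" "b = d p v" using b by auto
  obtain w where w: "w \<in> kill (E p) A" "a \<odot>\<^bsub>E p\<^esub> w = v"
    using E.injective_divisible_kill[OF injective A a v(1)] by blast
  have "a \<odot>\<^bsub>E q\<^esub> d p w = b"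
    using d_smult[OF G.hom_carrier[OF a] kill_carrier[OF w(1)]] w v Suc by simp
  then show ?thesis using w(1) Suc by auto
qed

lemma cobounds_divide_hom:
  assumes A: "hideal A" and a: "a \<in> rcomp R e" and b: "b \<in> cobounds q (colon A a)"
    "b \<in> mcomp (E q) (int e + n)"
  shows "\<exists>y\<in>cobounds q A. y \<in> mcomp (E q) n \<and> a \<odot>\<^bsub>E q\<^esub> y = b"
proof -
  obtain y where y: "y \<in> cobounds q A" "a \<odot>\<^bsub>E q\<^esub> y = b" using cobounds_divide[OF A a b(1)] by blast
  have yE: "y \<in> carrier (E q)" using y(1) E.submoduleE(1)[OF cobounds_sub[OF A]] by blast
  have "a \<odot>\<^bsub>E q\<^esub> ec q n y = b" using E.mc_smult[OF a yE, of n] y(2) b(2) by simp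
  then show ?thesis using cobounds_ec[OF A y(1), of n] E.M.hcomp_props(1)[OF yE] by blast
qed

end

subsection \<open>The Noetherian property of Ext modules\<close>

context gr_ring
begin

text \<open>Components of elements of \<open>C\<close> stay in \<open>C\<close>, and if all of them
  were in \<open>A\<close> then so would be their sums. This supplies the homogeneous element to
  adjoin in each maximality argument.\<close>

lemma hideal_hom_witness:
  assumes A: "hideal A" and "C \<subseteq> carrier R" "\<not> C \<subseteq> A" "hideal C"
  shows "\<exists>a e. a \<in> rcomp R e \<and> a \<in> C \<and> a \<notin> A"
proof (rule ccontr)
  assume no: "\<nexists>a e. a \<in> rcomp R e \<and> a \<in> C \<and> a \<notin> A"
  have "x \<in> A" if x: "x \<in> C" for x
  proof -
    have xR: "x \<in> carrier R" using x assms(2) by blast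
    have comp: "rc i x \<in> A" for i
      using no hideal_rc[OF assms(4) x, of i] G.hcomp_props(1)[OF xR, of i] by blast
    from xR show ?thesis
      by (induction rule: G.hom_induct) (use comp hideal_closed(1,2)[OF A] in blast)+
  qed
  then show False using assms(3) by blast
qed

end

context gr_complex
begin

definition cyc :: "nat \<Rightarrow> 'c set" where
  "cyc q = {x \<in> carrier (E q). d q x = \<zero>\<^bsub>E (Suc q)\<^esub>}"

text \<open>By injectivity of \<open>E q\<close> a homomorphism \<open>A \<rightarrow> E q\<close> is multiplication with an element \<open>w\<close>; it is
  a cocycle iff \<open>w \<in> conn q A\<close>, and it is the restriction of a cocycle \<open>R \<rightarrow> E q\<close> iff
  \<open>w \<in> triv q A\<close>. Hence \<open>conn q A / triv q A\<close> is the image of \<open>Ext\<^sup>q(A, M)\<close> in \<open>Ext\<^sup>q\<^sup>+\<^sup>1(R/A, M)\<close>.\<close>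

definition conn :: "nat \<Rightarrow> 'a set \<Rightarrow> 'c set" where
  "conn q A = {w \<in> carrier (E q). d q w \<in> kill (E (Suc q)) A}"

definition triv :: "nat \<Rightarrow> 'a set \<Rightarrow> 'c set" where
  "triv q A = {u \<oplus>\<^bsub>E q\<^esub> z | u z. u \<in> kill (E q) A \<and> z \<in> cyc q}"

lemma cyc_sub: "submodule (cyc q) R (E q)"
  using kernel_sub by (simp add: cyc_def)

lemma conn_sub: "hideal A \<Longrightarrow> submodule (conn q A) R (E q)"
  using d_preimage_sub[OF kill_sub] by (simp add: conn_def)

lemma triv_sub: "hideal A \<Longrightarrow> submodule (triv q A) R (E q)"
  using E.submodule_add[OF kill_sub cyc_sub] by (simp add: triv_def)

lemma kill_triv: "u \<in> kill (E q) A \<Longrightarrow> u \<in> triv q A"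
proof -
  assume u: "u \<in> kill (E q) A"
  then have "u = u \<oplus>\<^bsub>E q\<^esub> \<zero>\<^bsub>E q\<^esub>" using kill_carrier by simp
  then show "u \<in> triv q A" using u E.submodule_zero_in[OF cyc_sub, of q] unfolding triv_def by blast
qed

lemma cyc_triv: "hideal A \<Longrightarrow> z \<in> cyc q \<Longrightarrow> z \<in> triv q A"
proof -
  assume A: "hideal A" and z: "z \<in> cyc q"
  then have "z = \<zero>\<^bsub>E q\<^esub> \<oplus>\<^bsub>E q\<^esub> z" by (simp add: cyc_def)
  then show "z \<in> triv q A" using z E.submodule_zero_in[OF kill_sub[OF A], of q] unfolding triv_def by blast
qed

lemma triv_conn: assumes A: "hideal A" shows "triv q A \<subseteq> conn q A"
proof
  fix x assume "x \<in> triv q A"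
  then obtain u z where x: "u \<in> kill (E q) A" "z \<in> cyc q" "x = u \<oplus>\<^bsub>E q\<^esub> z" by (auto simp: triv_def)
  have c: "u \<in> carrier (E q)" "z \<in> carrier (E q)" "d q z = \<zero>\<^bsub>E (Suc q)\<^esub>"
    using kill_carrier[OF x(1)] x(2) by (auto simp: cyc_def)
  have "d q x = d q u" using x(3) c d_closed[OF c(1)] by (simp add: d_add)
  then show "x \<in> conn q A" using d_kill[OF x(1) A] c x(3) by (simp add: conn_def)
qed

lemma conn_antimono: "A \<subseteq> A' \<Longrightarrow> conn q A' \<subseteq> conn q A"
  using kill_antimono[of A A' "Suc q"] by (auto simp: conn_def)

text \<open>Two auxiliary chains control a given one. Adding \<open>triv q A\<close> gives a chain
  between \<open>triv q A\<close> and \<open>conn q A\<close>; multiplying the part killed by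
  \<open>A\<close> with \<open>a\<close>, and adding coboundaries, gives one between coboundaries
  and cocycles for A : a. What escapes both is killed by A + Ra up to a cocycle, hence lies in
  \<open>triv q (adjoin A a)\<close>.\<close>

lemma acc_conn_adjoin:
  assumes A: "hideal A" and a: "a \<in> rcomp R e"
    and acc: "acc_between R (E q) (triv q A) (conn q A)"
    and IH: "\<And>B. hideal B \<Longrightarrow> acc_between R (E q) (cobounds q B) (cocycles q B)"
  shows "acc_between R (E q) (triv q (adjoin A a)) (conn q (adjoin A a))"
  unfolding acc_between_def
proof (intro allI impI)
  let ?C = "adjoin A a" and ?B = "colon A a"
  fix L :: "nat \<Rightarrow> 'c set"
  assume L: "\<forall>n. submodule (L n) R (E q) \<and> triv q ?C \<subseteq> L n \<and> L n \<subseteq> conn q ?C \<and> L n \<subseteq> L (Suc n)"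
  have Ls: "submodule (L n) R (E q)" and tL: "triv q ?C \<subseteq> L n" and Lc: "L n \<subseteq> conn q ?C"
    and LSuc: "L n \<subseteq> L (Suc n)" for n using L by blast+
  have mono: "L n \<subseteq> L m" if "n \<le> m" for n m by (rule lift_Suc_mono_le[of L, OF LSuc that])
  have aR: "a \<in> carrier R" using G.hom_carrier[OF a] .
  have C: "hideal ?C" and B: "hideal ?B" using hideal_adjoin[OF A a] hideal_colon[OF A a] .
  have AC: "A \<subseteq> ?C" using adjoin_superset[OF A aR] .
  have AR: "A \<subseteq> carrier R" using hideal_carrier[OF A] .
  have LE: "x \<in> carrier (E q)" if "x \<in> L n" for x n using E.submoduleE(1)[OF Ls] that by blast

  define L' where "L' n = {x \<oplus>\<^bsub>E q\<^esub> y | x y. x \<in> L n \<and> y \<in> triv q A}" for n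
  have "\<exists>k. \<forall>n\<ge>k. L' n \<subseteq> L' k"
  proof (rule acc_betweenD[OF acc])
    fix n
    show "submodule (L' n) R (E q)"
      unfolding L'_def by (rule E.submodule_add[OF Ls triv_sub[OF A]])
    show "L' n \<subseteq> L' (Suc n)" unfolding L'_def using LSuc[of n] by blast
    show "triv q A \<subseteq> L' n"
    proof
      fix y assume y: "y \<in> triv q A"
      then have "y = \<zero>\<^bsub>E q\<^esub> \<oplus>\<^bsub>E q\<^esub> y" using E.submoduleE(1)[OF triv_sub[OF A]] by (simp add: subset_iff)
      then show "y \<in> L' n" unfolding L'_def using y E.submodule_zero_in[OF Ls, of n] by blast
    qed
    show "L' n \<subseteq> conn q A"
    proof
      fix w assume "w \<in> L' n"
      then obtain x y where w: "x \<in> L n" "y \<in> triv q A" "w = x \<oplus>\<^bsub>E q\<^esub> y" by (auto simp: L'_def)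
      have "x \<in> conn q A" "y \<in> conn q A"
        using w(1,2) Lc[of n] conn_antimono[OF AC, of q] triv_conn[OF A, of q] by blast+
      then show "w \<in> conn q A" using w(3) E.submoduleE(5)[OF conn_sub[OF A]] by simp
    qed
  qed
  then obtain k1 where k1: "\<And>n. n \<ge> k1 \<Longrightarrow> L' n \<subseteq> L' k1" by blast

  \<comment> \<open>For \<open>u\<close> in \<open>L n\<close> the element d u is killed by
    \<open>a\<close>, so a u is a cocycle; if \<open>u\<close> is killed by \<open>A\<close> as
    well, then a u is killed by the colon ideal. Adding the coboundaries puts the chain in the range
    of \<open>IH\<close>.\<close>
  define P where "P n = {x \<oplus>\<^bsub>E q\<^esub> y | x y. x \<in> (\<lambda>u. a \<odot>\<^bsub>E q\<^esub> u) ` (L n \<inter> kill (E q) A) \<and> y \<in> cobounds q ?B}" for n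
  have "\<exists>k. \<forall>n\<ge>k. P n \<subseteq> P k"
  proof (rule acc_betweenD[OF IH[OF B]])
    fix n
    have I: "submodule ((\<lambda>u. a \<odot>\<^bsub>E q\<^esub> u) ` (L n \<inter> kill (E q) A)) R (E q)"
      by (intro E.submodule_smult_image[OF aR] E.submodule_inter Ls kill_sub A)
    show "submodule (P n) R (E q)"
      unfolding P_def by (rule E.submodule_add[OF I cobounds_sub[OF B]])
    show "P n \<subseteq> P (Suc n)" unfolding P_def using LSuc[of n] by blast
    show "cobounds q ?B \<subseteq> P n"
    proof
      fix y assume y: "y \<in> cobounds q ?B"
      then have "y = \<zero>\<^bsub>E q\<^esub> \<oplus>\<^bsub>E q\<^esub> y" using E.submoduleE(1)[OF cobounds_sub[OF B]] by (simp add: subset_iff)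
      then show "y \<in> P n" unfolding P_def using y E.submodule_zero_in[OF I] by blast
    qed
    show "P n \<subseteq> cocycles q ?B"
    proof
      fix w assume "w \<in> P n"
      then obtain u y where w: "u \<in> L n" "u \<in> kill (E q) A" "y \<in> cobounds q ?B" "w = a \<odot>\<^bsub>E q\<^esub> u \<oplus>\<^bsub>E q\<^esub> y"
        by (auto simp: P_def)
      have "d q u \<in> kill (E (Suc q)) ?C" using w(1) Lc[of n] by (auto simp: conn_def)
      then have "a \<odot>\<^bsub>E (Suc q)\<^esub> d q u = \<zero>\<^bsub>E (Suc q)\<^esub>" using E.kill_adjoinD(2)[OF _ A aR] by blast
      then have "d q (a \<odot>\<^bsub>E q\<^esub> u) = \<zero>\<^bsub>E (Suc q)\<^esub>" using d_smult[OF aR LE[OF w(1)]] by simp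
      then have "a \<odot>\<^bsub>E q\<^esub> u \<in> cocycles q ?B"
        using E.smult_kill_colon[OF w(2) aR AR] by (simp add: cocycles_def)
      moreover have "y \<in> cocycles q ?B" using w(3) cobounds_cocycles[OF B] by blast
      ultimately show "w \<in> cocycles q ?B" using w(4) E.submoduleE(5)[OF cocycles_sub[OF B]] by simp
    qed
  qed
  then obtain k2 where k2: "\<And>n. n \<ge> k2 \<Longrightarrow> P n \<subseteq> P k2" by blast

  show "\<exists>k. \<forall>n\<ge>k. L n \<subseteq> L k"
  proof (intro exI[of _ "max k1 k2"] allI impI subsetI)
    fix n x assume n: "n \<ge> max k1 k2" and x: "x \<in> L n"
    let ?k = "max k1 k2"
    have xE: "x \<in> carrier (E q)" using LE[OF x] .
    have "x = x \<oplus>\<^bsub>E q\<^esub> \<zero>\<^bsub>E q\<^esub>" using xE by simp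
    then have "x \<in> L' n" unfolding L'_def using x E.submodule_zero_in[OF triv_sub[OF A], of q] by blast
    then have "x \<in> L' k1" using k1 n by auto
    then obtain x1 y where x1: "x1 \<in> L k1" "y \<in> triv q A" "x = x1 \<oplus>\<^bsub>E q\<^esub> y" by (auto simp: L'_def)
    then obtain u z where uz: "u \<in> kill (E q) A" "z \<in> cyc q" "y = u \<oplus>\<^bsub>E q\<^esub> z" by (auto simp: triv_def)
    \<comment> \<open>The cocycle \<open>z\<close> is moved to the side of \<open>x1\<close>, since
      every \<open>L m\<close> contains \<open>cyc q\<close>. Only \<open>u\<close>, which is killed
      by \<open>A\<close>, remains to be placed in the stable stage.\<close>
    define w where "w = x1 \<oplus>\<^bsub>E q\<^esub> z"
    have zL: "z \<in> L m" for m using tL[of m] cyc_triv[OF C uz(2)] by blast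
    have x1L: "x1 \<in> L ?k" "x1 \<in> L n" using x1(1) mono[of k1 ?k] mono[of k1 n] n by auto
    have wL: "w \<in> L ?k" "w \<in> L n"
      using E.submoduleE(5)[OF Ls] x1L zL unfolding w_def by blast+
    have carr: "x1 \<in> carrier (E q)" "z \<in> carrier (E q)" "u \<in> carrier (E q)" "w \<in> carrier (E q)"
      using LE x1L zL wL kill_carrier[OF uz(1)] by blast+
    have xuw: "x = u \<oplus>\<^bsub>E q\<^esub> w"
      using x1(3) uz(3) carr by (simp add: w_def E.M.a_ac)
    then have "u = x \<ominus>\<^bsub>E q\<^esub> w" using carr by (simp add: a_minus_def E.M.a_assoc E.M.r_neg)
    then have uL: "u \<in> L n" using E.submodule_minus[OF Ls x wL(2)] by simp
    have "a \<odot>\<^bsub>E q\<^esub> u = a \<odot>\<^bsub>E q\<^esub> u \<oplus>\<^bsub>E q\<^esub> \<zero>\<^bsub>E q\<^esub>" using carr aR by simp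
    then have "a \<odot>\<^bsub>E q\<^esub> u \<in> P n"
      unfolding P_def using uL uz(1) E.submodule_zero_in[OF cobounds_sub[OF B], of q] by blast
    then have "a \<odot>\<^bsub>E q\<^esub> u \<in> P k2" using k2 n by auto
    then obtain v b where v: "v \<in> L k2" "v \<in> kill (E q) A" "b \<in> cobounds q ?B"
      "a \<odot>\<^bsub>E q\<^esub> u = a \<odot>\<^bsub>E q\<^esub> v \<oplus>\<^bsub>E q\<^esub> b" by (auto simp: P_def)
    \<comment> \<open>Dividing \<open>b\<close> by \<open>a\<close> inside the coboundaries for
      \<open>A\<close> produces an element of \<open>cyc q\<close>; then u - (v + b') is killed by
      \<open>A\<close> and by \<open>a\<close>.\<close>
    obtain b' where b': "b' \<in> cobounds q A" "a \<odot>\<^bsub>E q\<^esub> b' = b"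
      using cobounds_divide[OF A a v(3)] by blast
    have b'c: "b' \<in> cocycles q A" using b'(1) cobounds_cocycles[OF A] by blast
    then have b'k: "b' \<in> kill (E q) A" "b' \<in> cyc q" using kill_carrier by (auto simp: cocycles_def cyc_def)
    have carr': "v \<in> carrier (E q)" "b' \<in> carrier (E q)" using kill_carrier v(2) b'k(1) by blast+
    let ?t = "u \<ominus>\<^bsub>E q\<^esub> (v \<oplus>\<^bsub>E q\<^esub> b')"
    have vb: "v \<oplus>\<^bsub>E q\<^esub> b' \<in> kill (E q) A" using E.submoduleE(5)[OF kill_sub[OF A] v(2) b'k(1)] .
    have tk: "?t \<in> kill (E q) A" using E.submodule_minus[OF kill_sub[OF A] uz(1) vb] .
    have "a \<odot>\<^bsub>E q\<^esub> ?t = a \<odot>\<^bsub>E q\<^esub> u \<ominus>\<^bsub>E q\<^esub> (a \<odot>\<^bsub>E q\<^esub> v \<oplus>\<^bsub>E q\<^esub> a \<odot>\<^bsub>E q\<^esub> b')"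
      using aR carr carr' by (simp add: a_minus_def E.smult_r_distr E.smult_r_minus)
    also have "\<dots> = \<zero>\<^bsub>E q\<^esub>"
      using v(4) b'(2) aR carr by (simp add: E.M.minus_eq_zero_iff flip: v(4))
    finally have "?t \<in> kill (E q) ?C" using E.kill_adjoin[OF tk aR _ AR] by blast
    then have tL': "?t \<in> L ?k" using kill_triv tL[of ?k] by blast
    have "v \<in> L ?k" using v(1) mono[of k2 ?k] by auto
    moreover have "b' \<in> L ?k" using cyc_triv[OF C b'k(2)] tL[of ?k] by blast
    ultimately have "v \<oplus>\<^bsub>E q\<^esub> b' \<in> L ?k" using E.submoduleE(5)[OF Ls] by blast
    then have "?t \<oplus>\<^bsub>E q\<^esub> (v \<oplus>\<^bsub>E q\<^esub> b') \<in> L ?k" using E.submoduleE(5)[OF Ls] tL' by blast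
    then have "u \<in> L ?k" using E.M.minus_add_self[of u q "v \<oplus>\<^bsub>E q\<^esub> b'"] carr carr' by simp
    then show "x \<in> L ?k" using xuw wL(1) E.submoduleE(5)[OF Ls] by blast
  qed
qed

lemma hideals_maximal:
  assumes "P A\<^sub>0" "\<And>A. P A \<Longrightarrow> hideal A"
  obtains A where "P A" "\<And>B. P B \<Longrightarrow> A \<subseteq> B \<Longrightarrow> B = A"
proof -
  have "\<exists>A\<in>{A. P A}. \<forall>B\<in>{A. P A}. A \<subseteq> B \<longrightarrow> B = A"
    using assms hideal_ideal by (intro noetherian_ring.ideals_maximal[OF noeth]) auto
  then show ?thesis using that by auto
qed

text \<open>The start is the zero ideal, which kills everything, so that the interval collapses. A
  maximal \<open>A'\<close> inside \<open>A\<close> with the chain condition cannot be enlarged by a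
  homogeneous element of \<open>A\<close>, so it is \<open>A\<close>.\<close>

lemma acc_conn:
  assumes A: "hideal A"
    and IH: "\<And>B. hideal B \<Longrightarrow> acc_between R (E q) (cobounds q B) (cocycles q B)"
  shows "acc_between R (E q) (triv q A) (conn q A)"
proof -
  define P where "P A' \<longleftrightarrow> hideal A' \<and> A' \<subseteq> A \<and> acc_between R (E q) (triv q A') (conn q A')" for A'
  have "conn q {\<zero>} \<subseteq> triv q {\<zero>}"
    using kill_triv[of _ q "{\<zero>}"] by (auto simp: conn_def kill_def)
  then have "P {\<zero>}"
    using hideal_zero hideal_closed(1)[OF A] acc_between_trivial by (auto simp: P_def)
  then obtain A' where "P A'" and max: "\<And>I. P I \<Longrightarrow> A' \<subseteq> I \<Longrightarrow> I = A'"
    by (rule hideals_maximal) (auto simp: P_def)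
  then have A': "hideal A'" "A' \<subseteq> A" "acc_between R (E q) (triv q A') (conn q A')"
    by (simp_all add: P_def)
  have "A \<subseteq> A'"
  proof (rule ccontr)
    assume "\<not> A \<subseteq> A'"
    then obtain a e where a: "a \<in> rcomp R e" "a \<in> A" "a \<notin> A'"
      using hideal_hom_witness[OF A'(1) hideal_carrier[OF A] _ A] by blast
    have aR: "a \<in> carrier R" using G.hom_carrier[OF a(1)] .
    have "P (adjoin A' a)"
      using hideal_adjoin[OF A'(1) a(1)] adjoin_least[OF A'(2) A a(2)]
        acc_conn_adjoin[OF A'(1) a(1) A'(3) IH] by (simp add: P_def)
    then have "adjoin A' a = A'" using max adjoin_superset[OF A'(1) aR] by blast
    then show False using a(3) adjoin_self[OF A'(1) aR] by simp
  qed
  then show ?thesis using A' by (simp add: subset_antisym)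
qed

text \<open>Dimension shifting: preimages under \<open>d q\<close> turn a chain in degree q + 1 into
  one between \<open>triv q A\<close> and \<open>conn q A\<close>, and exactness recovers the chain
  from its preimages. \<open>A\<close> is arbitrary in the induction because \<open>acc_conn\<close>
  requires the hypothesis for colon ideals too. In degree 0 the cocycles lie in the kernel of
  \<open>d 0\<close>.\<close>

lemma acc_cocycles:
  assumes "hideal A"
  shows "acc_between R (E q) (cobounds q A) (cocycles q A)"
  using assms
proof (induction q arbitrary: A)
  case 0
  show ?case
    unfolding acc_between_def
  proof (intro allI impI)
    fix L :: "nat \<Rightarrow> 'c set"
    assume L: "\<forall>n. submodule (L n) R (E 0) \<and> cobounds 0 A \<subseteq> L n \<and> L n \<subseteq> cocycles 0 A \<and> L n \<subseteq> L (Suc n)"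
    have sub: "cocycles 0 A \<subseteq> {x \<in> carrier (E 0). d 0 x = \<zero>\<^bsub>E (Suc 0)\<^esub>}"
      using kill_carrier by (auto simp: cocycles_def)
    show "\<exists>k. \<forall>n\<ge>k. L n \<subseteq> L k"
    proof (rule acc_betweenD[OF acc_H0])
      fix n
      show "submodule (L n) R (E 0)" "L n \<subseteq> L (Suc n)" using L by blast+
      show "{\<zero>\<^bsub>E 0\<^esub>} \<subseteq> L n" using L by auto
      have "L n \<subseteq> cocycles 0 A" using L by blast
      then show "L n \<subseteq> {x \<in> carrier (E 0). d 0 x = \<zero>\<^bsub>E (Suc 0)\<^esub>}" using sub by blast
    qed
  qed
next
  case (Suc q)
  note acc = acc_conn[OF Suc.prems Suc.IH]
  show ?case
    unfolding acc_between_def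
  proof (intro allI impI)
    fix L :: "nat \<Rightarrow> 'c set"
    assume L: "\<forall>n. submodule (L n) R (E (Suc q)) \<and> cobounds (Suc q) A \<subseteq> L n \<and>
      L n \<subseteq> cocycles (Suc q) A \<and> L n \<subseteq> L (Suc n)"
    have Ls: "submodule (L n) R (E (Suc q))" and bL: "cobounds (Suc q) A \<subseteq> L n"
      and Lc: "L n \<subseteq> cocycles (Suc q) A" and LSuc: "L n \<subseteq> L (Suc n)" for n using L by blast+
    define K where "K n = {x \<in> carrier (E q). d q x \<in> L n}" for n
    have "\<exists>k. \<forall>n\<ge>k. K n \<subseteq> K k"
    proof (rule acc_betweenD[OF acc])
      fix n
      show "submodule (K n) R (E q)" unfolding K_def by (rule d_preimage_sub[OF Ls])
      show "K n \<subseteq> K (Suc n)" using LSuc[of n] by (auto simp: K_def)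
      show "K n \<subseteq> conn q A" using Lc[of n] by (auto simp: K_def conn_def cocycles_def)
      show "triv q A \<subseteq> K n"
      proof
        fix x assume "x \<in> triv q A"
        then obtain u z where x: "u \<in> kill (E q) A" "z \<in> cyc q" "x = u \<oplus>\<^bsub>E q\<^esub> z" by (auto simp: triv_def)
        have c: "u \<in> carrier (E q)" "z \<in> carrier (E q)" "d q z = \<zero>\<^bsub>E (Suc q)\<^esub>"
          using kill_carrier[OF x(1)] x(2) by (auto simp: cyc_def)
        have "d q x = d q u" using x(3) c d_closed[OF c(1)] by (simp add: d_add)
        moreover have "d q u \<in> L n" using bL[of n] x(1) by auto
        ultimately show "x \<in> K n" using x(3) c by (simp add: K_def)
      qed
    qed
    then obtain k where k: "\<And>n. n \<ge> k \<Longrightarrow> K n \<subseteq> K k" by blast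
    show "\<exists>k. \<forall>n\<ge>k. L n \<subseteq> L k"
    proof (intro exI[of _ k] allI impI subsetI)
      fix n x assume n: "n \<ge> k" and x: "x \<in> L n"
      have "x \<in> carrier (E (Suc q))" "d (Suc q) x = \<zero>\<^bsub>E (Suc (Suc q))\<^esub>"
        using x Lc[of n] kill_carrier by (auto simp: cocycles_def)
      then obtain w where w: "w \<in> carrier (E q)" "d q w = x" using exact by blast
      then have "w \<in> K n" using x by (simp add: K_def)
      then show "x \<in> L k" using k[OF n] w(2) by (auto simp: K_def)
    qed
  qed
qed

end

subsection \<open>Vanishing in large degrees\<close>

context gr_ring
begin

definition plus_ideal :: "'a set" where
  "plus_ideal = {r \<in> carrier R. rc 0 r = \<zero>}"

lemma rc0_mult:
  assumes r: "r \<in> carrier R" and x: "x \<in> carrier R"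
  shows "rc 0 (r \<otimes> x) = rc 0 r \<otimes> rc 0 x"
proof (use x in \<open>induction rule: G.hom_induct\<close>)
  case (add x y)
  then show ?case using r by (simp add: r_distr G.hcomp_add)
next
  case (hom j)
  have j: "rc j x \<in> rcomp R j" using G.hcomp_props(1)[OF x] .
  show ?case using r x rc_mult[OF j r, of 0] G.hcomp_hom[OF j, of 0] by auto
qed (use r in simp)

lemma hideal_plus: "hideal plus_ideal"
proof (rule hidealI)
  fix x k assume "x \<in> plus_ideal"
  then have x: "x \<in> carrier R" "rc 0 x = \<zero>" by (auto simp: plus_ideal_def)
  show "rc k x \<in> plus_ideal"
    using x G.hcomp_hom[OF G.hcomp_props(1)[OF x(1), of k], of 0] by (auto simp: plus_ideal_def)
qed (auto simp: plus_ideal_def G.hcomp_add rc0_mult)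

lemma plus_ideal_hom: "a \<in> rcomp R j \<Longrightarrow> j \<ge> 1 \<Longrightarrow> a \<in> plus_ideal"
  using G.hom_carrier[of a j] by (auto simp: plus_ideal_def G.hcomp_hom)

lemma minus_rc0: "r \<in> carrier R \<Longrightarrow> r \<ominus> rc 0 r \<in> plus_ideal"
  using G.hcomp_props(1)[of r 0] by (simp add: plus_ideal_def G.hcomp_minus minus_self)

lemma plus_ideal_subset:
  assumes A: "hideal A" and sub: "\<And>j. j \<ge> 1 \<Longrightarrow> rcomp R j \<subseteq> A"
  shows "plus_ideal \<subseteq> A"
proof (rule ccontr)
  assume "\<not> plus_ideal \<subseteq> A"
  moreover have "plus_ideal \<subseteq> carrier R" by (auto simp: plus_ideal_def)
  ultimately obtain a e where a: "a \<in> rcomp R e" "a \<in> plus_ideal" "a \<notin> A"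
    using hideal_hom_witness[OF A _ _ hideal_plus] by blast
  have "e \<noteq> 0"
  proof
    assume "e = 0"
    then have "a = \<zero>" using a(1,2) by (simp add: plus_ideal_def)
    then show False using a(3) hideal_closed(1)[OF A] by simp
  qed
  then have "rcomp R e \<subseteq> A" by (intro sub) simp
  then show False using a by blast
qed

end

context gr_complex
begin

text \<open>The difference of \<open>r\<close> and \<open>rc 0 r\<close> lies in R_+. Scalars thus
  act on elements killed by R_+ without changing degrees, so conditions on components in large
  degrees define submodules.\<close>

lemma smult_rc0:
  assumes x: "x \<in> kill (E q) plus_ideal" and r: "r \<in> carrier R"
  shows "r \<odot>\<^bsub>E q\<^esub> x = rc 0 r \<odot>\<^bsub>E q\<^esub> x"
proof -
  have xE: "x \<in> carrier (E q)" using kill_carrier x .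
  have "(r \<ominus> rc 0 r) \<odot>\<^bsub>E q\<^esub> x = \<zero>\<^bsub>E q\<^esub>" using E.killD(1)[OF x minus_rc0[OF r]] .
  then have "r \<odot>\<^bsub>E q\<^esub> x \<ominus>\<^bsub>E q\<^esub> rc 0 r \<odot>\<^bsub>E q\<^esub> x = \<zero>\<^bsub>E q\<^esub>"
    using r xE by (simp add: a_minus_def E.smult_l_distr E.smult_l_minus)
  then show ?thesis using r xE by (simp add: E.M.minus_eq_zero_iff)
qed

text \<open>\<open>Ext\<^sup>q(R/R\<^sub>+, M)\<close> is Noetherian and killed by \<open>R\<^sub>+\<close>, hence lives in finitely many degrees.\<close>

lemma cocycles_plus_bounded:
  "\<exists>n\<^sub>0::int. \<forall>n\<ge>n\<^sub>0. \<forall>x\<in>mcomp (E q) n. x \<in> cocycles q plus_ideal \<longrightarrow> x \<in> cobounds q plus_ideal"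
proof -
  let ?Z = "cocycles q plus_ideal" and ?B = "cobounds q plus_ideal"
  note Zs = cocycles_sub[OF hideal_plus, of q] and Bs = cobounds_sub[OF hideal_plus, of q]
  have ZE: "x \<in> carrier (E q)" if "x \<in> ?Z" for x using E.submoduleE(1)[OF Zs] that by blast
  have BZ: "?B \<subseteq> ?Z" using cobounds_cocycles[OF hideal_plus] .
  \<comment> \<open>Because the inequality is strict, a homogeneous cocycle of degree
    \<open>n \<ge> 0\<close> lies in \<open>L (nat n)\<close>: only zero components are tested. Once
    the chain is stationary from \<open>k\<close> on, such a cocycle of degree above
    \<open>k\<close> lies in \<open>L k\<close>, and its own degree is tested there.\<close>
  define L where "L k = {x \<in> ?Z. \<forall>j>int k. ec q j x \<in> ?B}" for k
  have "\<exists>k. \<forall>n\<ge>k. L n \<subseteq> L k"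
  proof (rule acc_betweenD[OF acc_cocycles[OF hideal_plus]])
    fix k
    show "L k \<subseteq> ?Z" "L k \<subseteq> L (Suc k)" by (auto simp: L_def)
    show "?B \<subseteq> L k" using BZ cobounds_ec[OF hideal_plus] by (auto simp: L_def)
    show "submodule (L k) R (E q)"
    proof (rule E.submoduleI)
      show "L k \<subseteq> carrier (E q)" using ZE by (auto simp: L_def)
      show "\<zero>\<^bsub>E q\<^esub> \<in> L k"
        using E.submodule_zero_in[OF Zs] E.submodule_zero_in[OF Bs] by (simp add: L_def)
      fix x assume "x \<in> L k"
      then have x: "x \<in> ?Z" "\<And>j. j > int k \<Longrightarrow> ec q j x \<in> ?B" by (auto simp: L_def)
      show "\<ominus>\<^bsub>E q\<^esub> x \<in> L k"
        using x E.submoduleE(3)[OF Zs] E.submoduleE(3)[OF Bs] ZE[OF x(1)]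
        by (simp add: L_def E.M.hcomp_neg)
      show "r \<odot>\<^bsub>E q\<^esub> x \<in> L k" if r: "r \<in> carrier R" for r
      proof -
        have "ec q j (r \<odot>\<^bsub>E q\<^esub> x) \<in> ?B" if j: "j > int k" for j
        proof -
          have "r \<odot>\<^bsub>E q\<^esub> x = rc 0 r \<odot>\<^bsub>E q\<^esub> x"
            using smult_rc0[OF _ r] x(1) by (simp add: cocycles_def)
          then have "ec q j (r \<odot>\<^bsub>E q\<^esub> x) = rc 0 r \<odot>\<^bsub>E q\<^esub> ec q j x"
            using E.mc_smult[OF G.hcomp_props(1)[OF r] ZE[OF x(1)], of 0 j] by simp
          then show ?thesis using E.submoduleE(4)[OF Bs G.hcomp_carrier[OF r] x(2)[OF j]] by simp
        qed
        then show ?thesis using E.submoduleE(4)[OF Zs r x(1)] by (simp add: L_def)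
      qed
      fix y assume "y \<in> L k"
      then have y: "y \<in> ?Z" "\<And>j. j > int k \<Longrightarrow> ec q j y \<in> ?B" by (auto simp: L_def)
      show "x \<oplus>\<^bsub>E q\<^esub> y \<in> L k"
        using x y E.submoduleE(5)[OF Zs] E.submoduleE(5)[OF Bs] ZE[OF x(1)] ZE[OF y(1)]
        by (simp add: L_def E.M.hcomp_add)
    qed
  qed
  then obtain k where k: "\<And>n. n \<ge> k \<Longrightarrow> L n \<subseteq> L k" by blast
  show ?thesis
  proof (intro exI[of _ "int k + 1"] allI impI ballI)
    fix n :: int and x assume n: "n \<ge> int k + 1" and x: "x \<in> mcomp (E q) n" "x \<in> ?Z"
    have "x \<in> L (nat n)"
      using n x E.submodule_zero_in[OF Bs] by (auto simp: L_def E.M.hcomp_hom[OF x(1)])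
    moreover have "k \<le> nat n" using n by arith
    ultimately have "x \<in> L k" using k by blast
    then have "ec q n x \<in> ?B" using n by (simp add: L_def)
    then show "x \<in> ?B" using x(1) by simp
  qed
qed

lemma cobounds_hom_lift:
  assumes A: "hideal A" and x: "x \<in> cobounds (Suc q) A" "x \<in> mcomp (E (Suc q)) n"
  shows "\<exists>w\<in>mcomp (E q) n. w \<in> kill (E q) A \<and> d q w = x"
proof -
  obtain w where w: "w \<in> kill (E q) A" "x = d q w" using x(1) by auto
  have wE: "w \<in> carrier (E q)" using kill_carrier w(1) .
  have "d q (ec q n w) = x" using d_ec[OF wE, of n] w(2) x(2) by simp
  then show ?thesis using E.kill_hideal[OF A w(1)] E.M.hcomp_props(1)[OF wE] by blast
qed

text \<open>If the class of \<open>x\<close> dies after multiplication with \<open>a\<close>, then \<open>x\<close> can be corrected by a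
  coboundary to be killed by \<open>A + Ra\<close>.\<close>

lemma cocycle_correct:
  assumes A: "hideal A" and a: "a \<in> rcomp R e" and w: "w \<in> mcomp (E q) n" "w \<in> kill (E q) A"
    and aw: "a \<odot>\<^bsub>E q\<^esub> w \<in> cobounds q (colon A a)"
  shows "\<exists>y\<in>cobounds q A. y \<in> mcomp (E q) n \<and> w \<ominus>\<^bsub>E q\<^esub> y \<in> mcomp (E q) n \<and>
    w \<ominus>\<^bsub>E q\<^esub> y \<in> kill (E q) (adjoin A a) \<and> d q (w \<ominus>\<^bsub>E q\<^esub> y) = d q w"
proof -
  have aR: "a \<in> carrier R" using G.hom_carrier[OF a] .
  obtain y where y: "y \<in> cobounds q A" "y \<in> mcomp (E q) n" "a \<odot>\<^bsub>E q\<^esub> y = a \<odot>\<^bsub>E q\<^esub> w"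
    using cobounds_divide_hom[OF A a aw E.mcomp_smult[OF a w(1)]] by blast
  have yZ: "y \<in> kill (E q) A" "d q y = \<zero>\<^bsub>E (Suc q)\<^esub>"
    using y(1) cobounds_cocycles[OF A] by (auto simp: cocycles_def)
  have c: "w \<in> carrier (E q)" "y \<in> carrier (E q)" using kill_carrier w(2) yZ(1) by blast+
  have k: "w \<ominus>\<^bsub>E q\<^esub> y \<in> kill (E q) A" using E.submodule_minus[OF kill_sub[OF A] w(2) yZ(1)] .
  have "a \<odot>\<^bsub>E q\<^esub> (w \<ominus>\<^bsub>E q\<^esub> y) = a \<odot>\<^bsub>E q\<^esub> w \<ominus>\<^bsub>E q\<^esub> a \<odot>\<^bsub>E q\<^esub> y"
    using c aR by (simp add: a_minus_def E.smult_r_distr E.smult_r_minus)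
  also have "\<dots> = \<zero>\<^bsub>E q\<^esub>" using y(3) c aR by (simp add: E.M.minus_eq_zero_iff)
  finally have "w \<ominus>\<^bsub>E q\<^esub> y \<in> kill (E q) (adjoin A a)"
    using E.kill_adjoin[OF k aR _ hideal_carrier[OF A]] by blast
  moreover have "w \<ominus>\<^bsub>E q\<^esub> y \<in> mcomp (E q) n"
    using E.M.hom_add[OF w(1) E.M.hom_neg[OF y(2)]] by (simp add: a_minus_def)
  moreover have "d q (w \<ominus>\<^bsub>E q\<^esub> y) = d q w"
    using d_minus[OF c] d_closed[OF c(1)] yZ(2) by (simp add: a_minus_def)
  ultimately show ?thesis using y(1,2) by blast
qed

text \<open>The bound for R_+ gives x = d w with w killed by R_+; the task is to have w killed by
  \<open>B\<close>. Let A be maximal such that some solution w is killed by A. For homogeneous a in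
  \<open>B\<close> the element a w is a cocycle for A : a, because a x = 0, hence a coboundary by
  induction, and w can be corrected to be killed by A + Ra. The induction runs over all
  \<open>B\<close> and \<open>n\<close> since A : a and the degree of a w are new.\<close>

lemma vanish_above_plus:
  assumes n0: "\<forall>p\<le>i. \<forall>n\<ge>n\<^sub>0. \<forall>x\<in>mcomp (E p) n. x \<in> cocycles p plus_ideal \<longrightarrow> x \<in> cobounds p plus_ideal"
    and "q \<le> i" "hideal B" "plus_ideal \<subseteq> B" "n \<ge> n\<^sub>0" "x \<in> mcomp (E q) n" "x \<in> cocycles q B"
  shows "x \<in> cobounds q B"
  using assms(2-)
proof (induction q arbitrary: B n x)
  case 0
  have "x \<in> cocycles 0 plus_ideal" using 0 cocycles_antimono by blast
  then show ?case using n0 0(1,4,5) by auto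
next
  case (Suc q)
  note B = \<open>hideal B\<close>
  have x: "x \<in> kill (E (Suc q)) B" using Suc.prems(6) by (simp add: cocycles_def)
  have "x \<in> cocycles (Suc q) plus_ideal" using Suc.prems(3,6) cocycles_antimono by blast
  then have "x \<in> cobounds (Suc q) plus_ideal" using n0 Suc.prems(1,4,5) by blast
  then obtain w0 where w0: "w0 \<in> mcomp (E q) n" "w0 \<in> kill (E q) plus_ideal" "d q w0 = x"
    using cobounds_hom_lift[OF hideal_plus _ Suc.prems(5)] by blast
  define P where "P A \<longleftrightarrow> hideal A \<and> plus_ideal \<subseteq> A \<and> A \<subseteq> B \<and>
    (\<exists>w\<in>mcomp (E q) n. w \<in> kill (E q) A \<and> d q w = x)" for A
  have "P plus_ideal" using w0 hideal_plus Suc.prems(3) by (auto simp: P_def)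
  then obtain A where "P A" and max: "\<And>I. P I \<Longrightarrow> A \<subseteq> I \<Longrightarrow> I = A"
    by (rule hideals_maximal) (auto simp: P_def)
  then obtain w where A: "hideal A" "plus_ideal \<subseteq> A" "A \<subseteq> B"
    and w: "w \<in> mcomp (E q) n" "w \<in> kill (E q) A" "d q w = x" by (auto simp: P_def)
  have "B \<subseteq> A"
  proof (rule ccontr)
    assume "\<not> B \<subseteq> A"
    then obtain a e where a: "a \<in> rcomp R e" "a \<in> B" "a \<notin> A"
      using hideal_hom_witness[OF A(1) hideal_carrier[OF B] _ B] by blast
    have aR: "a \<in> carrier R" using G.hom_carrier[OF a(1)] .
    have "d q (a \<odot>\<^bsub>E q\<^esub> w) = \<zero>\<^bsub>E (Suc q)\<^esub>"
      using d_smult[OF aR kill_carrier[OF w(2)]] w(3) E.killD(1)[OF x a(2)] by simp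
    then have "a \<odot>\<^bsub>E q\<^esub> w \<in> cocycles q (colon A a)"
      using E.smult_kill_colon[OF w(2) aR hideal_carrier[OF A(1)]] by (simp add: cocycles_def)
    moreover have "plus_ideal \<subseteq> colon A a" using colon_superset[OF A(1) aR] A(2) by blast
    moreover have "int e + n \<ge> n\<^sub>0" using Suc.prems(4) by simp
    ultimately have "a \<odot>\<^bsub>E q\<^esub> w \<in> cobounds q (colon A a)"
      using Suc.IH[OF _ hideal_colon[OF A(1) a(1)] _ _ E.mcomp_smult[OF a(1) w(1)]] Suc.prems(1) by simp
    then have "\<exists>w\<in>mcomp (E q) n. w \<in> kill (E q) (adjoin A a) \<and> d q w = x"
      using cocycle_correct[OF A(1) a(1) w(1,2)] w(3) by blast
    then have "P (adjoin A a)"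
      using hideal_adjoin[OF A(1) a(1)] adjoin_superset[OF A(1) aR] adjoin_least[OF A(3) B a(2)] A(2)
      unfolding P_def by blast
    then have "adjoin A a = A" using max adjoin_superset[OF A(1) aR] by blast
    then show False using a(3) adjoin_self[OF A(1) aR] by simp
  qed
  then have "A = B" using A(3) by blast
  then show ?case using w(2,3) by auto
qed

text \<open>A maximal counterexample A does not contain R_+. Its degrees j >= 1 with R_j not inside
  A are bounded by \<open>t\<close>; taking a outside A in the greatest of them forces R_+ into A :
  a, so the case above R_+ disposes of a x. Correcting x by a coboundary yields a cocycle for A +
  Ra, which by maximality is a coboundary.\<close>

lemma vanish_above_power:
  assumes n0: "\<forall>p\<le>i. \<forall>n\<ge>n\<^sub>0. \<forall>x\<in>mcomp (E p) n. x \<in> cocycles p plus_ideal \<longrightarrow> x \<in> cobounds p plus_ideal"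
    and q: "q \<le> i" and "hideal B" and "\<And>j. j \<ge> t \<Longrightarrow> rcomp R j \<subseteq> B" and "n \<ge> n\<^sub>0"
    and "x \<in> mcomp (E q) n" and "x \<in> cocycles q B"
  shows "x \<in> cobounds q B"
proof (rule ccontr)
  assume notB: "x \<notin> cobounds q B"
  define P where "P A \<longleftrightarrow> hideal A \<and> (\<forall>j\<ge>t. rcomp R j \<subseteq> A) \<and>
    (\<exists>x\<in>mcomp (E q) n. x \<in> cocycles q A \<and> x \<notin> cobounds q A)" for A
  have "P B" using assms notB by (auto simp: P_def)
  then obtain A where "P A" and max: "\<And>I. P I \<Longrightarrow> A \<subseteq> I \<Longrightarrow> I = A"
    by (rule hideals_maximal) (auto simp: P_def)
  then obtain x where A: "hideal A" and At: "\<And>j. j \<ge> t \<Longrightarrow> rcomp R j \<subseteq> A"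
    and x: "x \<in> mcomp (E q) n" "x \<in> cocycles q A" "x \<notin> cobounds q A" by (auto simp: P_def)
  have "\<not> plus_ideal \<subseteq> A" using vanish_above_plus[OF n0 q A _ assms(5) x(1,2)] x(3) by blast
  then have "\<not> (\<forall>j\<ge>1. rcomp R j \<subseteq> A)" using plus_ideal_subset[OF A] by auto
  then obtain j0 where j0: "j0 \<ge> 1" "\<not> rcomp R j0 \<subseteq> A" by blast
  define Q where "Q j \<longleftrightarrow> j \<ge> 1 \<and> \<not> rcomp R j \<subseteq> A" for j
  have Qj0: "Q j0" using j0 by (simp add: Q_def)
  have bound: "j \<le> t" if "Q j" for j
  proof (rule ccontr)
    assume "\<not> j \<le> t"
    then have "rcomp R j \<subseteq> A" using At[of j] by simp
    then show False using that by (simp add: Q_def)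
  qed
  have QG: "Q (Greatest Q)" by (rule GreatestI_nat[of Q j0 t, OF Qj0 bound])
  have jle: "j \<le> Greatest Q" if "Q j" for j by (rule Greatest_le_nat[of Q j t, OF that bound])
  then obtain a where a: "a \<in> rcomp R (Greatest Q)" "a \<notin> A" using QG unfolding Q_def by blast
  have aR: "a \<in> carrier R" using G.hom_carrier[OF a(1)] .
  have "rcomp R k \<subseteq> colon A a" if k: "k \<ge> 1" for k
  proof
    fix r assume r: "r \<in> rcomp R k"
    have "\<not> Q (k + Greatest Q)" using jle[of "k + Greatest Q"] k by auto
    then have "rcomp R (k + Greatest Q) \<subseteq> A" using k by (simp add: Q_def)
    then show "r \<in> colon A a" using rcomp_mult[OF r a(1)] G.hom_carrier[OF r] by (auto simp: colon_def)
  qed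
  then have plus: "plus_ideal \<subseteq> colon A a"
    by (rule plus_ideal_subset[OF hideal_colon[OF A a(1)]])
  have xk: "x \<in> kill (E q) A" "d q x = \<zero>\<^bsub>E (Suc q)\<^esub>" using x(2) by (auto simp: cocycles_def)
  have "a \<odot>\<^bsub>E q\<^esub> x \<in> cocycles q (colon A a)"
    using E.smult_kill_colon[OF xk(1) aR hideal_carrier[OF A]] d_smult[OF aR kill_carrier[OF xk(1)]] xk(2) aR
    by (simp add: cocycles_def)
  moreover have "int (Greatest Q) + n \<ge> n\<^sub>0" using assms(5) by simp
  ultimately have "a \<odot>\<^bsub>E q\<^esub> x \<in> cobounds q (colon A a)"
    using vanish_above_plus[OF n0 q hideal_colon[OF A a(1)] plus _ E.mcomp_smult[OF a(1) x(1)]] by blast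
  then obtain y where y: "y \<in> cobounds q A" "x \<ominus>\<^bsub>E q\<^esub> y \<in> mcomp (E q) n"
    "x \<ominus>\<^bsub>E q\<^esub> y \<in> kill (E q) (adjoin A a)" "d q (x \<ominus>\<^bsub>E q\<^esub> y) = d q x"
    using cocycle_correct[OF A a(1) x(1) xk(1)] by blast
  have AC: "A \<subseteq> adjoin A a" using adjoin_superset[OF A aR] .
  have "adjoin A a \<noteq> A" using a(2) adjoin_self[OF A aR] by auto
  then have "\<not> P (adjoin A a)" using max AC by blast
  moreover have "\<forall>j\<ge>t. rcomp R j \<subseteq> adjoin A a" using At AC by blast
  moreover have "x \<ominus>\<^bsub>E q\<^esub> y \<in> cocycles q (adjoin A a)" using y(3,4) xk(2) by (simp add: cocycles_def)
  ultimately have "x \<ominus>\<^bsub>E q\<^esub> y \<in> cobounds q (adjoin A a)"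
    using hideal_adjoin[OF A a(1)] y(2) unfolding P_def by blast
  \<comment> \<open>A larger ideal has fewer coboundaries, so the corrected cocycle is a coboundary
    for \<open>A\<close> too, and \<open>y\<close> already is one.\<close>
  then have "x \<ominus>\<^bsub>E q\<^esub> y \<in> cobounds q A" using cobounds_antimono[OF AC] by blast
  then have "(x \<ominus>\<^bsub>E q\<^esub> y) \<oplus>\<^bsub>E q\<^esub> y \<in> cobounds q A"
    using E.submoduleE(5)[OF cobounds_sub[OF A] _ y(1)] by blast
  moreover have "y \<in> carrier (E q)" using E.submoduleE(1)[OF cobounds_sub[OF A]] y(1) by blast
  ultimately have "x \<in> cobounds q A"
    using E.M.minus_add_self[of x q y] kill_carrier[OF xk(1)] by simp
  then show False using x(3) by simp
qed

text \<open>\<open>n\<^sub>0\<close> precedes the quantifiers over \<open>B\<close> and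
  \<open>t\<close>, since \<open>B\<close> will be the annihilator of \<open>x\<close>. The maximum
  over all p <= q is taken because the induction uses the bounds for R_+ in every lower
  cohomological degree.\<close>

lemma uniform_vanishing:
  "\<exists>n\<^sub>0::int. \<forall>n\<ge>n\<^sub>0. \<forall>x\<in>mcomp (E q) n. \<forall>B t. hideal B \<longrightarrow> (\<forall>j\<ge>t. rcomp R j \<subseteq> B) \<longrightarrow>
     x \<in> cocycles q B \<longrightarrow> x \<in> cobounds q B"
proof -
  obtain b :: "nat \<Rightarrow> int" where b: "\<And>p n x. n \<ge> b p \<Longrightarrow> x \<in> mcomp (E p) n \<Longrightarrow>
      x \<in> cocycles p plus_ideal \<Longrightarrow> x \<in> cobounds p plus_ideal"
    using cocycles_plus_bounded by metis
  let ?n = "Max (b ` {..q})"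
  have "b p \<le> ?n" if "p \<le> q" for p using that by (intro Max_ge) auto
  then have "x \<in> cobounds p plus_ideal"
    if "p \<le> q" "n \<ge> ?n" "x \<in> mcomp (E p) n" "x \<in> cocycles p plus_ideal" for p n x
    using b[of p n x] that order_trans by blast
  then have n0: "\<forall>p\<le>q. \<forall>n\<ge>?n. \<forall>x\<in>mcomp (E p) n. x \<in> cocycles p plus_ideal \<longrightarrow> x \<in> cobounds p plus_ideal"
    by blast
  show ?thesis
    by (intro exI[of _ ?n] allI ballI impI, rule vanish_above_power[OF n0 order_refl]) blast+
qed

end

subsection \<open>Standard graded rings over a local ring\<close>

text \<open>Intended for R_0, of which only \<open>cring\<close> is at hand; Zorn's lemma applies
  because \<open>\<one>\<close> lies in no member of a chain and hence not in its union.\<close>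

lemma (in cring) exists_maximalideal:
  assumes I: "ideal I R" and 1: "\<one> \<notin> I"
  shows "\<exists>N. maximalideal N R \<and> I \<subseteq> N"
proof -
  let ?S = "{N. ideal N R \<and> \<one> \<notin> N \<and> I \<subseteq> N}"
  have "\<exists>N\<in>?S. \<forall>K\<in>?S. N \<subseteq> K \<longrightarrow> K = N"
  proof (rule subset_Zorn_nonempty)
    show "?S \<noteq> {}" using I 1 by blast
    fix C assume C: "C \<noteq> {}" "subset.chain ?S C"
    have CS: "C \<subseteq> ?S" using C(2) unfolding pred_on.chain_def by simp
    then have "C \<subseteq> {I. ideal I R}" by auto
    then have "subset.chain {I. ideal I R} C" using C(2) unfolding pred_on.chain_def by simp
    then have "ideal (\<Union>C) R" using chain_Union_is_ideal[of C] C(1) by simp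
    then show "\<Union>C \<in> ?S" using CS C(1) by auto
  qed
  then obtain N where N: "ideal N R" "\<one> \<notin> N" "I \<subseteq> N"
    and max: "\<And>K. \<lbrakk>ideal K R; \<one> \<notin> K; I \<subseteq> K; N \<subseteq> K\<rbrakk> \<Longrightarrow> K = N" by auto
  have "maximalideal N R"
  proof (rule maximalidealI[OF N(1)])
    show "carrier R \<noteq> N" using N(2) by auto
    fix K assume K: "ideal K R" "N \<subseteq> K" "K \<subseteq> carrier R"
    show "K = N \<or> K = carrier R"
      using max[OF K(1) _ _ K(2)] N(3) K(2) ideal.one_imp_carrier[OF K(1)] by blast
  qed
  then show ?thesis using N(3) by blast
qed

text \<open>A principal ideal without 1 would lie in a maximal ideal, and the only one is
  \<open>m\<close>.\<close>

lemma local_ring_unit: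
  assumes loc: "is_local_ring A m" and a: "a \<in> carrier A" "a \<notin> m"
  shows "\<exists>t\<in>carrier A. t \<otimes>\<^bsub>A\<^esub> a = \<one>\<^bsub>A\<^esub>"
proof -
  interpret cring A using loc by (simp add: is_local_ring_def)
  have "\<one>\<^bsub>A\<^esub> \<in> PIdl\<^bsub>A\<^esub> a"
  proof (rule ccontr)
    assume "\<one>\<^bsub>A\<^esub> \<notin> PIdl\<^bsub>A\<^esub> a"
    then obtain N where "maximalideal N A" "PIdl\<^bsub>A\<^esub> a \<subseteq> N"
      using exists_maximalideal[OF cgenideal_ideal[OF a(1)]] by blast
    then show False using loc cgenideal_self[OF a(1)] a(2) by (auto simp: is_local_ring_def)
  qed
  then show ?thesis by (auto simp: cgenideal_def)
qed

lemma local_ring_maximalideal: "is_local_ring A m \<Longrightarrow> maximalideal m A"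
  by (simp add: is_local_ring_def)

section \<open>Graded pieces of a standard graded ring\<close>

context gr_ring
begin

lemma prod_comp_mult:
  assumes u: "u \<in> rcomp R i" and v: "v \<in> rcomp R d \<cdot>\<^bsub>R\<^esub> rcomp R 1"
  shows "u \<otimes> v \<in> rcomp R (i + d) \<cdot>\<^bsub>R\<^esub> rcomp R 1"
  using v
proof (induction v rule: ideal_prod.induct)
  case (prod y z)
  have "u \<otimes> (y \<otimes> z) = (u \<otimes> y) \<otimes> z"
    using G.hom_carrier u prod by (simp add: m_assoc)
  then show ?case using ideal_prod.prod[OF rcomp_mult[OF u prod(1)] prod(2)] by simp
next
  case (sum s t)
  have c: "x \<in> carrier R" if "x \<in> rcomp R d \<cdot>\<^bsub>R\<^esub> rcomp R 1" for x
    using that by (induction rule: ideal_prod.induct) (auto intro: G.hom_carrier)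
  have "u \<otimes> (s \<oplus> t) = u \<otimes> s \<oplus> u \<otimes> t"
    using c[OF sum(1)] c[OF sum(2)] G.hom_carrier[OF u] by (simp add: r_distr)
  then show ?case using ideal_prod.sum[OF sum(3,4)] by simp
qed

text \<open>The claim is proved for all positive components of all elements generated by R_0 and
  R_1. Here \<open>ideal_prod\<close> is applied to graded pieces, which need not be ideals of
  \<open>R\<close>, and means finite sums of products. In a product g h the factor h is split into
  homogeneous parts: a part of degree 0 is absorbed into the components of g, and a part of positive
  degree already ends in factors of degree 1.\<close>

lemma standard_comp_Suc:
  assumes std: "is_standard_graded R" and x: "x \<in> rcomp R (Suc d)"
  shows "x \<in> rcomp R d \<cdot>\<^bsub>R\<^esub> rcomp R 1"
proof -
  let ?Q = "\<lambda>d. rcomp R d \<cdot>\<^bsub>R\<^esub> rcomp R 1"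
  have zero: "\<zero> \<in> ?Q d" for d
    using ideal_prod.prod[OF G.hom_zero[of d] G.hom_zero[of 1], where R = R] by simp
  have sub: "rcomp R 0 \<union> rcomp R 1 \<subseteq> carrier R" using G.hom_carrier by blast
  have "\<forall>d. rc (Suc d) h \<in> ?Q d" if "h \<in> generate_ring R (rcomp R 0 \<union> rcomp R 1)" for h
    using that
  proof (induction rule: generate_ring.induct)
    case one
    show ?case using zero by (simp add: G.hcomp_hom[OF one_hom])
  next
    case (incl h)
    show ?case
    proof (cases "h \<in> rcomp R 0")
      case True
      then show ?thesis using zero by (simp add: G.hcomp_hom[OF True])
    next
      case False
      then have h: "h \<in> rcomp R 1" using incl by blast
      have "h = \<one> \<otimes> h" using G.hom_carrier[OF h] by simp
      then have "h \<in> ?Q 0" using ideal_prod.prod[OF one_hom h, where R = R] by simp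
      then show ?thesis using zero by (auto simp: G.hcomp_hom[OF h])
    qed
  next
    case (a_inv h)
    then have h: "h \<in> carrier R" using generate_ring_in_carrier[OF sub] by blast
    have e: "\<ominus> \<one> \<in> rcomp R 0" using G.hom_neg[OF one_hom] .
    show ?case
    proof
      fix d
      have "rc (Suc d) (\<ominus> h) = \<ominus> \<one> \<otimes> rc (Suc d) h"
        using h by (simp add: G.hcomp_neg l_minus)
      then show "rc (Suc d) (\<ominus> h) \<in> ?Q d" using prod_comp_mult[OF e, of "rc (Suc d) h" d] a_inv by simp
    qed
  next
    case (eng_add g h)
    then have "g \<in> carrier R" "h \<in> carrier R" using generate_ring_in_carrier[OF sub] by blast+
    then show ?case using eng_add by (auto simp: G.hcomp_add intro: ideal_prod.sum)
  next
    case (eng_mult g h)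
    then have gh: "g \<in> carrier R" "h \<in> carrier R" using generate_ring_in_carrier[OF sub] by blast+
    have g: "rc (Suc d) g \<in> ?Q d" and h: "rc (Suc d) h \<in> ?Q d" for d using eng_mult by blast+
    from gh(2) show ?case
    proof (induction rule: G.hom_induct)
      case zero
      then show ?case using gh \<open>\<And>d. \<zero> \<in> ?Q d\<close> by simp
    next
      case (add x y)
      then show ?case using gh by (auto simp: r_distr G.hcomp_add intro: ideal_prod.sum)
    next
      case (hom j)
      have hj: "rc j h \<in> rcomp R j" using G.hcomp_props(1)[OF gh(2)] .
      show ?case
      proof
        fix d
        show "rc (Suc d) (g \<otimes> rc j h) \<in> ?Q d"
        proof (cases j)
          case 0
          have "rc (Suc d) (g \<otimes> rc j h) = rc j h \<otimes> rc (Suc d) g"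
            using rc_mult[OF hj gh(1), of "Suc d"] gh 0 by (simp add: m_comm)
          then show ?thesis using prod_comp_mult[OF hj g[of d]] 0 by simp
        next
          case (Suc k)
          show ?thesis
          proof (cases "j \<le> Suc d")
            case True
            then have "rc (Suc d - j) g \<otimes> rc j h \<in> ?Q d"
              using prod_comp_mult[OF G.hcomp_props(1)[OF gh(1), of "d - k"] h[of k]] Suc by simp
            then show ?thesis using rc_mult[OF hj gh(1), of "Suc d"] True Suc by simp
          next
            case False
            then show ?thesis using rc_mult[OF hj gh(1), of "Suc d"] \<open>\<And>d. \<zero> \<in> ?Q d\<close> by simp
          qed
        qed
      qed
    qed
  qed
  moreover have "x \<in> generate_ring R (rcomp R 0 \<union> rcomp R 1)"
    using std G.hom_carrier[OF x] by (simp add: is_standard_graded_def)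
  ultimately have "rc (Suc d) x \<in> ?Q d" by blast
  then show ?thesis using x by simp
qed

lemma comp_subset_power:
  assumes std: "is_standard_graded R" and I: "rcomp R 1 \<subseteq> I"
  shows "m \<le> d \<Longrightarrow> rcomp R d \<subseteq> I [^]\<^bsub>ideals_set R\<^esub> m"
proof (induction m arbitrary: d)
  case 0
  then show ?case using G.hom_carrier by (auto simp: nat_pow_def ideals_set_def)
next
  case (Suc m)
  then obtain e where e: "d = Suc e" "m \<le> e" by (cases d) auto
  have "y \<in> (I [^]\<^bsub>ideals_set R\<^esub> m) \<cdot>\<^bsub>R\<^esub> I" if "y \<in> rcomp R e \<cdot>\<^bsub>R\<^esub> rcomp R 1" for y
    using that
  proof (induction rule: ideal_prod.induct)
    case (prod s t)
    then show ?case using Suc.IH[OF e(2)] I by (intro ideal_prod.prod) auto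
  qed (rule ideal_prod.sum)
  then show ?case using standard_comp_Suc[OF std] e(1) by (auto simp: nat_pow_def ideals_set_def)
qed

text \<open>Nakayama's lemma for R_d modulo the degree d part of \<open>A\<close>, run with a
  maximal homogeneous \<open>A'\<close> over \<open>A\<close> that does not contain R_d. If s g were
  outside \<open>A'\<close>, for s in \<open>S\<close> and g in R_d, maximality would give g = c + r
  s g with c in \<open>A'\<close>, and 1 - r s is a unit since s lies in the maximal ideal. So the
  degree d parts of \<open>Idl S\<close> lie in \<open>A'\<close>, and \<open>cover\<close> forces
  R_d into \<open>A'\<close>.\<close>

lemma nakayama_comp:
  assumes noeth: "noetherian_ring R" and loc: "is_local_ring (degree_zero_ring R) \<mm>"
    and S: "S \<subseteq> rcomp R 0" "S \<subseteq> \<mm>"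
    and A: "hideal A" and cover: "\<And>x. x \<in> rcomp R d \<Longrightarrow> \<exists>a\<in>A. \<exists>j\<in>Idl S. x = a \<oplus> j"
  shows "rcomp R d \<subseteq> A"
proof (rule ccontr)
  assume not: "\<not> rcomp R d \<subseteq> A"
  let ?F = "{A'. hideal A' \<and> A \<subseteq> A' \<and> \<not> rcomp R d \<subseteq> A'}"
  have "\<exists>A'\<in>?F. \<forall>B\<in>?F. A' \<subseteq> B \<longrightarrow> B = A'"
    using A not hideal_ideal by (intro noetherian_ring.ideals_maximal[OF noeth]) auto
  then obtain A' where A'F: "A' \<in> ?F" and maxF: "\<forall>B\<in>?F. A' \<subseteq> B \<longrightarrow> B = A'" by (elim bexE)
  have A': "hideal A'" "A \<subseteq> A'" "\<not> rcomp R d \<subseteq> A'" using A'F by simp_all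
  have max: "B = A'" if "hideal B" "A \<subseteq> B" "\<not> rcomp R d \<subseteq> B" "A' \<subseteq> B" for B
    using maxF that by simp
  have sg: "s \<otimes> g \<in> A'" if s: "s \<in> S" and g: "g \<in> rcomp R d" for s g
  proof (rule ccontr)
    assume nin: "s \<otimes> g \<notin> A'"
    have s0: "s \<in> rcomp R 0" using s S(1) by blast
    have sR: "s \<in> carrier R" and gR: "g \<in> carrier R" using G.hom_carrier s0 g by blast+
    have sgd: "s \<otimes> g \<in> rcomp R d" using rcomp_mult[OF s0 g] by simp
    have sgR: "s \<otimes> g \<in> carrier R" using sR gR by simp
    have "g \<in> adjoin A' (s \<otimes> g)"
      using max[OF hideal_adjoin[OF A'(1) sgd]] adjoin_superset[OF A'(1) sgR] adjoin_self[OF A'(1) sgR]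
        A'(2) nin g by blast
    then obtain c r where c: "c \<in> A'" "r \<in> carrier R" "g = c \<oplus> r \<otimes> (s \<otimes> g)" by (auto simp: adjoin_def)
    have cR: "c \<in> carrier R" using hideal_carrier[OF A'(1)] c(1) by blast
    \<comment> \<open>Taking components of degree \<open>d\<close> replaces the coefficient by one
      in R_0, where locality is available.\<close>
    let ?c = "rc d c" and ?r = "rc 0 r"
    have cA: "?c \<in> A'" using hideal_rc[OF A'(1) c(1)] .
    have r0: "?r \<in> rcomp R 0" using G.hcomp_props(1)[OF c(2)] .
    have rR: "?r \<in> carrier R" using G.hom_carrier[OF r0] .
    have "rc d g = ?c \<oplus> rc d (r \<otimes> (s \<otimes> g))"
      using G.hcomp_add[OF cR m_closed[OF c(2) sgR], of d] c(3) by simp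
    then have geq: "g = ?c \<oplus> ?r \<otimes> (s \<otimes> g)"
      using g rc_mult[OF sgd c(2), of d] by simp
    have rs0: "?r \<otimes> s \<in> rcomp R 0" using rcomp_mult[OF r0 s0] by simp
    let ?u = "\<one> \<ominus> ?r \<otimes> s"
    have u0: "?u \<in> rcomp R 0"
      using G.hom_add[OF one_hom G.hom_neg[OF rs0]] by (simp add: a_minus_def)
    interpret m: maximalideal \<mm> "degree_zero_ring R" using local_ring_maximalideal[OF loc] .
    have um: "?u \<notin> \<mm>"
    proof
      assume u: "?u \<in> \<mm>"
      have "s \<in> \<mm>" using s S(2) by blast
      then have "?r \<otimes> s \<in> \<mm>" using m.I_l_closed[of s ?r] r0 by (simp add: degree_zero_ring_def)
      then have "?u \<oplus> ?r \<otimes> s \<in> \<mm>" using additive_subgroup.a_closed[OF m.additive_subgroup_axioms u] by (simp add: degree_zero_ring_def)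
      moreover have "?u \<oplus> ?r \<otimes> s = \<one>" using rR sR by (simp add: minus_add_self)
      ultimately have "\<one>\<^bsub>degree_zero_ring R\<^esub> \<in> \<mm>" by (simp add: degree_zero_ring_def)
      then show False using m.one_imp_carrier m.I_notcarr by simp
    qed
    obtain t where t: "t \<in> rcomp R 0" "t \<otimes> ?u = \<one>"
      using local_ring_unit[OF loc _ um] u0 by (auto simp: degree_zero_ring_def)
    have tR: "t \<in> carrier R" using G.hom_carrier[OF t(1)] .
    have uR: "?u \<in> carrier R" using rR sR by simp
    have "?u \<otimes> g = g \<ominus> ?r \<otimes> (s \<otimes> g)"
      using rR sR gR by algebra
    also have "\<dots> = ?c" using geq rR sgR cR add_minus_cancel[of ?c "?r \<otimes> (s \<otimes> g)"] by simp
    finally have "t \<otimes> (?u \<otimes> g) \<in> A'" using hideal_closed(5)[OF A'(1) cA tR] by simp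
    then have "g \<in> A'" using t(2) tR uR gR by (simp flip: m_assoc)
    then have "s \<otimes> g \<in> A'" using hideal_closed(5)[OF A'(1) _ sR] by blast
    then show False using nin by simp
  qed
  \<comment> \<open>Quantifying over all multiples makes this an ideal; it contains
    \<open>S\<close>, hence all of \<open>Idl S\<close>.\<close>
  let ?Q = "{r \<in> carrier R. \<forall>u\<in>carrier R. rc d (u \<otimes> r) \<in> A'}"
  have "ideal ?Q R"
  proof (rule idealI)
    show "subgroup ?Q (add_monoid R)"
    proof (rule add.subgroupI)
      show "?Q \<noteq> {}" using hideal_closed(1)[OF A'(1)] by (intro ex_in_conv[THEN iffD1] exI[of _ \<zero>]) simp
      show "\<ominus> a \<in> ?Q" if "a \<in> ?Q" for a
        using that hideal_closed(3)[OF A'(1)] by (auto simp: r_minus G.hcomp_neg)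
      show "a \<oplus> b \<in> ?Q" if "a \<in> ?Q" "b \<in> ?Q" for a b
        using that hideal_closed(2)[OF A'(1)] by (auto simp: r_distr G.hcomp_add)
    qed blast
    fix a x assume a: "a \<in> ?Q" and x: "x \<in> carrier R"
    have "rc d (u \<otimes> (x \<otimes> a)) \<in> A'" if "u \<in> carrier R" for u
      using a x that m_assoc[of u x a] by (metis (mono_tags, lifting) m_closed mem_Collect_eq)
    then show "x \<otimes> a \<in> ?Q" using a x by simp
    then show "a \<otimes> x \<in> ?Q" using a x m_comm[of a x] by simp
  qed (rule ring_axioms)
  moreover have "S \<subseteq> ?Q"
  proof
    fix s assume s: "s \<in> S"
    have s0: "s \<in> rcomp R 0" using s S(1) by blast
    have "rc d (u \<otimes> s) \<in> A'" if u: "u \<in> carrier R" for u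
    proof -
      have "rc d (u \<otimes> s) = s \<otimes> rc d u"
        using rc_mult[OF s0 u, of d] u G.hom_carrier[OF s0] by (simp add: m_comm)
      then show ?thesis using sg[OF s G.hcomp_props(1)[OF u]] by simp
    qed
    then show "s \<in> ?Q" using G.hom_carrier[OF s0] by simp
  qed
  ultimately have JQ: "Idl S \<subseteq> ?Q" by (rule genideal_minimal)
  have "rcomp R d \<subseteq> A'"
  proof
    fix x assume x: "x \<in> rcomp R d"
    then obtain a j where aj: "a \<in> A" "j \<in> Idl S" "x = a \<oplus> j" using cover by blast
    have jQ: "j \<in> carrier R" "rc d (\<one> \<otimes> j) \<in> A'" using JQ aj(2) by blast+
    have aA: "a \<in> A'" using aj(1) A'(2) by blast
    have aR: "a \<in> carrier R" using hideal_carrier[OF A'(1)] aA by blast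
    have "rc d x = rc d a \<oplus> rc d j" using aj(3) aR jQ(1) by (simp add: G.hcomp_add)
    then show "x \<in> A'"
      using x jQ hideal_rc[OF A'(1) aA, of d] hideal_closed(2)[OF A'(1), of "rc d a" "rc d j"] by simp
  qed
  then show False using A'(3) by simp
qed

lemma irrelevant_ideal_eq: "irrelevant_ideal R = plus_ideal"
proof (intro subset_antisym subsetI)
  fix x assume "x \<in> irrelevant_ideal R"
  then obtain F c where F: "finite F" "F \<subseteq> {0<..}" "\<And>i. i \<in> F \<Longrightarrow> c i \<in> rcomp R i"
    "x = (\<Oplus>i\<in>F. c i)" by (auto simp: irrelevant_ideal_def)
  have "(\<Oplus>i\<in>F. c i) \<in> plus_ideal" using F(1-3)
  proof (induction F rule: finite_induct)
    case empty
    then show ?case using hideal_closed(1)[OF hideal_plus] by simp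
  next
    case (insert j F)
    have "c j \<in> plus_ideal" using insert.prems by (intro plus_ideal_hom[of _ j]) auto
    moreover have "c \<in> F \<rightarrow> carrier R" "c j \<in> carrier R" using insert.prems G.hom_carrier by auto
    ultimately show ?case
      using insert hideal_closed(2)[OF hideal_plus] by (subst finsum_insert) auto
  qed
  then show "x \<in> plus_ideal" using F(4) by simp
next
  fix x assume "x \<in> plus_ideal"
  then have x: "x \<in> carrier R" "rc 0 x = \<zero>" by (auto simp: plus_ideal_def)
  have "{i. rc i x \<noteq> \<zero>} \<subseteq> {0<..}" using x(2) by (auto intro: gr0I)
  then show "x \<in> irrelevant_ideal R"
    unfolding irrelevant_ideal_def
    using G.hcomp_props[OF x(1)] by (intro CollectI exI[of _ "{i. rc i x \<noteq> \<zero>}"] exI[of _ "\<lambda>i. rc i x"]) auto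
qed

text \<open>\<open>\<bb>\<close> absorbs multiplication by R_0. For general r the difference of r
  and \<open>rc 0 r\<close> lies in R_+, and so does its product with any element, so the sum
  absorbs all of \<open>R\<close>.\<close>

lemma ideal_plus_extension:
  assumes b: "ideal \<bb> (degree_zero_ring R)"
  shows "ideal (\<bb> <+>\<^bsub>R\<^esub> irrelevant_ideal R) R" "rcomp R 1 \<subseteq> \<bb> <+>\<^bsub>R\<^esub> irrelevant_ideal R"
proof -
  interpret b: ideal \<bb> "degree_zero_ring R" using b .
  have eq: "\<bb> <+>\<^bsub>R\<^esub> irrelevant_ideal R = {x \<oplus> y | x y. x \<in> \<bb> \<and> y \<in> plus_ideal}"
    by (auto simp: irrelevant_ideal_eq set_add_def')
  have b0: "\<zero> \<in> \<bb>" using additive_subgroup.zero_closed[OF ideal.axioms(1)[OF b]] by (simp add: degree_zero_ring_def)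
  have bR0: "x \<in> rcomp R 0" if "x \<in> \<bb>" for x using b.Icarr[OF that] by (simp add: degree_zero_ring_def)
  have badd: "x \<oplus> y \<in> \<bb>" if "x \<in> \<bb>" "y \<in> \<bb>" for x y
    using additive_subgroup.a_closed[OF ideal.axioms(1)[OF b] that] by (simp add: degree_zero_ring_def)
  have bmult: "r \<otimes> x \<in> \<bb>" if "r \<in> rcomp R 0" "x \<in> \<bb>" for r x
    using b.I_l_closed[OF that(2), of r] that(1) by (simp add: degree_zero_ring_def)
  note p = hideal_closed[OF hideal_plus]
  have pR: "y \<in> carrier R" if "y \<in> plus_ideal" for y using that by (simp add: plus_ideal_def)
  have mult: "r \<otimes> z \<in> {x \<oplus> y | x y. x \<in> \<bb> \<and> y \<in> plus_ideal}"
    if r: "r \<in> carrier R" and z: "z \<in> {x \<oplus> y | x y. x \<in> \<bb> \<and> y \<in> plus_ideal}" for r z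
  proof -
    obtain x y where xy: "x \<in> \<bb>" "y \<in> plus_ideal" "z = x \<oplus> y" using z by blast
    have c: "x \<in> carrier R" "y \<in> carrier R" "rc 0 r \<in> carrier R"
      using G.hom_carrier[OF bR0[OF xy(1)]] pR[OF xy(2)] r by auto
    have "r \<otimes> z = rc 0 r \<otimes> x \<oplus> ((r \<ominus> rc 0 r) \<otimes> x \<oplus> r \<otimes> y)"
      unfolding xy(3) using r c by algebra
    moreover have "(r \<ominus> rc 0 r) \<otimes> x \<oplus> r \<otimes> y \<in> plus_ideal"
      using p(2)[OF p(6)[OF minus_rc0[OF r] c(1)] p(5)[OF xy(2) r]] .
    ultimately show ?thesis using bmult[OF G.hcomp_props(1)[OF r] xy(1)] by blast
  qed
  show "ideal (\<bb> <+>\<^bsub>R\<^esub> irrelevant_ideal R) R"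
    unfolding eq
  proof (rule idealI[OF ring_axioms])
    have sub: "{x \<oplus> y | x y. x \<in> \<bb> \<and> y \<in> plus_ideal} \<subseteq> carrier R"
      using G.hom_carrier[OF bR0] pR by auto
    show "subgroup {x \<oplus> y | x y. x \<in> \<bb> \<and> y \<in> plus_ideal} (add_monoid R)"
    proof (rule add.subgroupI[OF sub])
      show "{x \<oplus> y | x y. x \<in> \<bb> \<and> y \<in> plus_ideal} \<noteq> {}" using b0 p(1) by blast
      fix a assume a: "a \<in> {x \<oplus> y | x y. x \<in> \<bb> \<and> y \<in> plus_ideal}"
      have "a \<in> carrier R" using sub a by blast
      then have "\<ominus> a = \<ominus> \<one> \<otimes> a" by (simp add: l_minus)
      then show "\<ominus> a \<in> {x \<oplus> y | x y. x \<in> \<bb> \<and> y \<in> plus_ideal}" using mult[OF _ a, of "\<ominus> \<one>"] by simp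
      fix b assume b: "b \<in> {x \<oplus> y | x y. x \<in> \<bb> \<and> y \<in> plus_ideal}"
      obtain x y where xy: "x \<in> \<bb>" "y \<in> plus_ideal" "a = x \<oplus> y" using a by blast
      obtain x' y' where xy': "x' \<in> \<bb>" "y' \<in> plus_ideal" "b = x' \<oplus> y'" using b by blast
      have "a \<oplus> b = (x \<oplus> x') \<oplus> (y \<oplus> y')"
        using xy(3) xy'(3) G.hom_carrier[OF bR0[OF xy(1)]] G.hom_carrier[OF bR0[OF xy'(1)]]
          pR[OF xy(2)] pR[OF xy'(2)] by (simp add: a_ac)
      then show "a \<oplus> b \<in> {x \<oplus> y | x y. x \<in> \<bb> \<and> y \<in> plus_ideal}"
        using badd[OF xy(1) xy'(1)] p(2)[OF xy(2) xy'(2)] by blast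
    qed
    fix a x assume a: "a \<in> {x \<oplus> y | x y. x \<in> \<bb> \<and> y \<in> plus_ideal}" and x: "x \<in> carrier R"
    show "x \<otimes> a \<in> {x \<oplus> y | x y. x \<in> \<bb> \<and> y \<in> plus_ideal}" using mult[OF x a] .
    then show "a \<otimes> x \<in> {x \<oplus> y | x y. x \<in> \<bb> \<and> y \<in> plus_ideal}"
      using m_comm[of a x] sub a x by (simp add: subset_iff)
  qed
  show "rcomp R 1 \<subseteq> \<bb> <+>\<^bsub>R\<^esub> irrelevant_ideal R"
  proof
    fix y assume y: "y \<in> rcomp R 1"
    have "y = \<zero> \<oplus> y" using G.hom_carrier[OF y] by simp
    then show "y \<in> \<bb> <+>\<^bsub>R\<^esub> irrelevant_ideal R"
      unfolding eq using b0 plus_ideal_hom[OF y] by blast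
  qed
qed

end

subsection \<open>Torsion with respect to a pair of ideals\<close>

lemma (in cring) ideal_pow:
  assumes "ideal I R"
  shows "ideal (I [^]\<^bsub>ideals_set R\<^esub> (n::nat)) R"
proof -
  interpret comm_monoid "ideals_set R" by (rule ideals_set_is_comm_monoid)
  show ?thesis using nat_pow_closed[of I n] assms by (simp add: ideals_set_def)
qed

lemma (in cring) ideal_pow_add:
  assumes "ideal I R"
  shows "I [^]\<^bsub>ideals_set R\<^esub> (n + m :: nat) = (I [^]\<^bsub>ideals_set R\<^esub> n) \<cdot>\<^bsub>R\<^esub> (I [^]\<^bsub>ideals_set R\<^esub> m)"
proof -
  interpret comm_monoid "ideals_set R" by (rule ideals_set_is_comm_monoid)
  have "I \<in> carrier (ideals_set R)" using assms by (simp add: ideals_set_def)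
  then show ?thesis using nat_pow_mult[of I n m] by (simp add: ideals_set_def)
qed

text \<open>The second summand lies in every ideal containing \<open>j\<close> and \<open>k\<close>.
  The two orders of the first product serve two module elements, one killed by a - j and the other
  by b - k.\<close>

lemma (in cring) mult_split:
  assumes "a \<in> carrier R" "b \<in> carrier R" "j \<in> carrier R" "k \<in> carrier R"
  shows "a \<otimes> b = (b \<ominus> k) \<otimes> (a \<ominus> j) \<oplus> (a \<otimes> k \<oplus> j \<otimes> (b \<ominus> k))"
    "a \<otimes> b = (a \<ominus> j) \<otimes> (b \<ominus> k) \<oplus> (a \<otimes> k \<oplus> j \<otimes> (b \<ominus> k))"
  using assms by algebra+

lemma mem_pair_torsion:
  "x \<in> pair_torsion R I J M \<longleftrightarrow> x \<in> carrier M \<and>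
     (\<exists>n::nat. n \<ge> 1 \<and> (\<forall>a\<in>I [^]\<^bsub>ideals_set R\<^esub> n. \<exists>j\<in>J. a \<odot>\<^bsub>M\<^esub> x = j \<odot>\<^bsub>M\<^esub> x))"
  by (simp add: pair_torsion_def image_subset_iff image_iff)

context module
begin

text \<open>Torsion of \<open>x\<close> and of \<open>y\<close> provides witnesses in
  \<open>J\<close> for each scalar, but not the same ones for both. On the product of the two powers
  of \<open>I\<close> a common witness exists, hence the exponent \<open>n + m\<close>.\<close>

lemma pair_torsion_add:
  assumes I: "ideal I R" and J: "ideal J R"
    and x: "x \<in> pair_torsion R I J M" and y: "y \<in> pair_torsion R I J M"
  shows "x \<oplus>\<^bsub>M\<^esub> y \<in> pair_torsion R I J M"
proof -
  obtain n where n: "n \<ge> 1" "\<And>a. a \<in> I [^]\<^bsub>ideals_set R\<^esub> (n::nat) \<Longrightarrow> \<exists>j\<in>J. a \<odot>\<^bsub>M\<^esub> x = j \<odot>\<^bsub>M\<^esub> x"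
    and xM: "x \<in> carrier M" using x unfolding mem_pair_torsion by blast
  obtain m where m: "m \<ge> 1" "\<And>a. a \<in> I [^]\<^bsub>ideals_set R\<^esub> (m::nat) \<Longrightarrow> \<exists>j\<in>J. a \<odot>\<^bsub>M\<^esub> y = j \<odot>\<^bsub>M\<^esub> y"
    and yM: "y \<in> carrier M" using y unfolding mem_pair_torsion by blast
  let ?P = "I [^]\<^bsub>ideals_set R\<^esub> n" and ?Q = "I [^]\<^bsub>ideals_set R\<^esub> m"
  have PR: "a \<in> carrier R" if "a \<in> ?P" for a using ideal.Icarr[OF R.ideal_pow[OF I] that] .
  have QR: "a \<in> carrier R" if "a \<in> ?Q" for a using ideal.Icarr[OF R.ideal_pow[OF I] that] .
  have JR: "j \<in> carrier R" if "j \<in> J" for j using ideal.Icarr[OF J that] .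
  have key: "w \<in> carrier R \<and> (\<exists>j\<in>J. w \<odot>\<^bsub>M\<^esub> x = j \<odot>\<^bsub>M\<^esub> x \<and> w \<odot>\<^bsub>M\<^esub> y = j \<odot>\<^bsub>M\<^esub> y)" if "w \<in> ?P \<cdot>\<^bsub>R\<^esub> ?Q" for w
    using that
  proof (induction w rule: ideal_prod.induct)
    case (prod a b)
    obtain j where j: "j \<in> J" "a \<odot>\<^bsub>M\<^esub> x = j \<odot>\<^bsub>M\<^esub> x" using n(2)[OF prod(1)] by blast
    obtain k where k: "k \<in> J" "b \<odot>\<^bsub>M\<^esub> y = k \<odot>\<^bsub>M\<^esub> y" using m(2)[OF prod(2)] by blast
    have c: "a \<in> carrier R" "b \<in> carrier R" "j \<in> carrier R" "k \<in> carrier R"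
      using PR[OF prod(1)] QR[OF prod(2)] JR j(1) k(1) by blast+
    text \<open>The element \<open>(a - j)(b - k)\<close> kills both \<open>x\<close> and \<open>y\<close>.\<close>
    let ?l = "a \<otimes> k \<oplus> j \<otimes> (b \<ominus> k)"
    have lJ: "?l \<in> J"
      using ideal.I_l_closed[OF J k(1) c(1)] ideal.I_r_closed[OF J j(1), of "b \<ominus> k"] c
        additive_subgroup.a_closed[OF ideal.axioms(1)[OF J]] by simp
    have ax: "(a \<ominus> j) \<odot>\<^bsub>M\<^esub> x = \<zero>\<^bsub>M\<^esub>"
      using c j(2) xM by (simp add: a_minus_def smult_l_distr smult_l_minus M.r_neg)
    have bk: "(b \<ominus> k) \<odot>\<^bsub>M\<^esub> y = \<zero>\<^bsub>M\<^esub>"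
      using c k(2) yM by (simp add: a_minus_def smult_l_distr smult_l_minus M.r_neg)
    have e1: "a \<otimes> b = (b \<ominus> k) \<otimes> (a \<ominus> j) \<oplus> ?l" and e2: "a \<otimes> b = (a \<ominus> j) \<otimes> (b \<ominus> k) \<oplus> ?l"
      using R.mult_split[OF c] by blast+
    have "(a \<otimes> b) \<odot>\<^bsub>M\<^esub> x = (b \<ominus> k) \<odot>\<^bsub>M\<^esub> ((a \<ominus> j) \<odot>\<^bsub>M\<^esub> x) \<oplus>\<^bsub>M\<^esub> ?l \<odot>\<^bsub>M\<^esub> x"
      unfolding e1 using c xM by (simp add: smult_l_distr smult_assoc1)
    then have 1: "(a \<otimes> b) \<odot>\<^bsub>M\<^esub> x = ?l \<odot>\<^bsub>M\<^esub> x" using ax c xM by simp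
    have "(a \<otimes> b) \<odot>\<^bsub>M\<^esub> y = (a \<ominus> j) \<odot>\<^bsub>M\<^esub> ((b \<ominus> k) \<odot>\<^bsub>M\<^esub> y) \<oplus>\<^bsub>M\<^esub> ?l \<odot>\<^bsub>M\<^esub> y"
      unfolding e2 using c yM by (simp add: smult_l_distr smult_assoc1)
    then have 2: "(a \<otimes> b) \<odot>\<^bsub>M\<^esub> y = ?l \<odot>\<^bsub>M\<^esub> y" using bk c yM by simp
    show ?case using 1 2 lJ c by blast
  next
    case (sum s t)
    obtain j where j: "j \<in> J" "s \<odot>\<^bsub>M\<^esub> x = j \<odot>\<^bsub>M\<^esub> x" "s \<odot>\<^bsub>M\<^esub> y = j \<odot>\<^bsub>M\<^esub> y" using sum by blast
    obtain k where k: "k \<in> J" "t \<odot>\<^bsub>M\<^esub> x = k \<odot>\<^bsub>M\<^esub> x" "t \<odot>\<^bsub>M\<^esub> y = k \<odot>\<^bsub>M\<^esub> y" using sum by blast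
    have c: "s \<in> carrier R" "t \<in> carrier R" "j \<in> carrier R" "k \<in> carrier R"
      using sum JR[OF j(1)] JR[OF k(1)] by blast+
    have "j \<oplus> k \<in> J" using additive_subgroup.a_closed[OF ideal.axioms(1)[OF J] j(1) k(1)] .
    moreover have "(s \<oplus> t) \<odot>\<^bsub>M\<^esub> x = (j \<oplus> k) \<odot>\<^bsub>M\<^esub> x" "(s \<oplus> t) \<odot>\<^bsub>M\<^esub> y = (j \<oplus> k) \<odot>\<^bsub>M\<^esub> y"
      using j k c xM yM by (simp_all add: smult_l_distr)
    ultimately show ?case using c by blast
  qed
  have "\<exists>j\<in>J. w \<odot>\<^bsub>M\<^esub> (x \<oplus>\<^bsub>M\<^esub> y) = j \<odot>\<^bsub>M\<^esub> (x \<oplus>\<^bsub>M\<^esub> y)"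
    if w: "w \<in> I [^]\<^bsub>ideals_set R\<^esub> (n + m)" for w
  proof -
    have "w \<in> ?P \<cdot>\<^bsub>R\<^esub> ?Q" using w R.ideal_pow_add[OF I, of n m] by simp
    then obtain j where j: "w \<in> carrier R" "j \<in> J" "w \<odot>\<^bsub>M\<^esub> x = j \<odot>\<^bsub>M\<^esub> x" "w \<odot>\<^bsub>M\<^esub> y = j \<odot>\<^bsub>M\<^esub> y"
      using key by blast
    have "w \<odot>\<^bsub>M\<^esub> (x \<oplus>\<^bsub>M\<^esub> y) = j \<odot>\<^bsub>M\<^esub> (x \<oplus>\<^bsub>M\<^esub> y)"
      using j JR[OF j(2)] xM yM by (simp add: smult_r_distr)
    then show ?thesis using j(2) by blast
  qed
  moreover have "n + m \<ge> 1" using n(1) by simp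
  moreover have "x \<oplus>\<^bsub>M\<^esub> y \<in> carrier M" using xM yM by simp
  ultimately show ?thesis unfolding mem_pair_torsion by blast
qed

lemma pair_torsion_uminus:
  assumes I: "ideal I R" and J: "ideal J R" and x: "x \<in> pair_torsion R I J M"
  shows "\<ominus>\<^bsub>M\<^esub> x \<in> pair_torsion R I J M"
proof -
  obtain n where n: "n \<ge> 1" "\<And>a. a \<in> I [^]\<^bsub>ideals_set R\<^esub> (n::nat) \<Longrightarrow> \<exists>j\<in>J. a \<odot>\<^bsub>M\<^esub> x = j \<odot>\<^bsub>M\<^esub> x"
    and xM: "x \<in> carrier M" using x unfolding mem_pair_torsion by blast
  have "\<exists>j\<in>J. a \<odot>\<^bsub>M\<^esub> (\<ominus>\<^bsub>M\<^esub> x) = j \<odot>\<^bsub>M\<^esub> (\<ominus>\<^bsub>M\<^esub> x)" if a: "a \<in> I [^]\<^bsub>ideals_set R\<^esub> n" for a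
  proof -
    obtain j where j: "j \<in> J" "a \<odot>\<^bsub>M\<^esub> x = j \<odot>\<^bsub>M\<^esub> x" using n(2)[OF a] by blast
    have "a \<in> carrier R" "j \<in> carrier R"
      using ideal.Icarr[OF R.ideal_pow[OF I] a] ideal.Icarr[OF J j(1)] .
    then have "a \<odot>\<^bsub>M\<^esub> (\<ominus>\<^bsub>M\<^esub> x) = j \<odot>\<^bsub>M\<^esub> (\<ominus>\<^bsub>M\<^esub> x)" using j(2) xM by (simp add: smult_r_minus)
    then show ?thesis using j(1) by blast
  qed
  then show ?thesis unfolding mem_pair_torsion using n(1) xM by blast
qed

lemma pair_torsion_zero:
  assumes I: "ideal I R" and J: "ideal J R"
  shows "\<zero>\<^bsub>M\<^esub> \<in> pair_torsion R I J M"
proof -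
  have "\<exists>j\<in>J. a \<odot>\<^bsub>M\<^esub> \<zero>\<^bsub>M\<^esub> = j \<odot>\<^bsub>M\<^esub> \<zero>\<^bsub>M\<^esub>" if a: "a \<in> I [^]\<^bsub>ideals_set R\<^esub> (1::nat)" for a
    using ideal.Icarr[OF R.ideal_pow[OF I] a] additive_subgroup.zero_closed[OF ideal.axioms(1)[OF J]]
    by (intro bexI[of _ \<zero>]) simp_all
  then show ?thesis unfolding mem_pair_torsion by blast
qed

end

section \<open>Torsion cocycles in large degrees\<close>

context gr_complex
begin

text \<open>Let B be the annihilator of \<open>x\<close>. Torsion of \<open>x\<close> says that each
  a in I^m is congruent modulo B to some j in \<open>Idl S\<close>. A preimage of \<open>x\<close>
  killed by B obeys the same congruences, so it is torsion with the same m and the same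
  witnesses.\<close>

lemma torsion_cocycles_vanish:
  assumes std: "is_standard_graded R" and loc: "is_local_ring (degree_zero_ring R) \<mm>"
    and S: "S \<subseteq> rcomp R 0" and I: "ideal I R" "rcomp R 1 \<subseteq> I"
  shows "\<exists>n\<^sub>0::int. \<forall>n\<ge>n\<^sub>0. \<forall>x\<in>mcomp (E (Suc p)) n.
    x \<in> pair_torsion R I (Idl S) (E (Suc p)) \<longrightarrow> d (Suc p) x = \<zero>\<^bsub>E (Suc (Suc p))\<^esub> \<longrightarrow>
    x \<in> d p ` pair_torsion R I (Idl S) (E p)"
proof -
  let ?J = "Idl S"
  have SR: "S \<subseteq> carrier R" using S G.hom_carrier by blast
  have J: "ideal ?J R" using genideal_ideal[OF SR] .
  have JR: "j \<in> carrier R" if "j \<in> ?J" for j using ideal.Icarr[OF J that] .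
  have PR: "a \<in> carrier R" if "a \<in> I [^]\<^bsub>ideals_set R\<^esub> (n::nat)" for a n
    using ideal.Icarr[OF ideal_pow[OF I(1)] that] .
  show ?thesis
  proof (cases "S \<subseteq> \<mm>")
    case True
    obtain n0 :: int where n0: "\<forall>n\<ge>n0. \<forall>x\<in>mcomp (E (Suc p)) n. \<forall>B t. hideal B \<longrightarrow>
        (\<forall>j\<ge>t. rcomp R j \<subseteq> B) \<longrightarrow> x \<in> cocycles (Suc p) B \<longrightarrow> x \<in> cobounds (Suc p) B"
      using exE[OF uniform_vanishing[of "Suc p"]] .
    show ?thesis
    proof (intro exI[of _ n0] allI impI ballI)
      fix n x
      assume n: "n \<ge> n0" and x: "x \<in> mcomp (E (Suc p)) n"
        and tors: "x \<in> pair_torsion R I ?J (E (Suc p))" and dx: "d (Suc p) x = \<zero>\<^bsub>E (Suc (Suc p))\<^esub>"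
      have xE: "x \<in> carrier (E (Suc p))" using E.M.hom_carrier[OF x] .
      obtain m where m: "m \<ge> 1" "\<And>a. a \<in> I [^]\<^bsub>ideals_set R\<^esub> (m::nat) \<Longrightarrow>
          \<exists>j\<in>?J. a \<odot>\<^bsub>E (Suc p)\<^esub> x = j \<odot>\<^bsub>E (Suc p)\<^esub> x"
        using tors unfolding mem_pair_torsion by blast
      let ?B = "ann R (E (Suc p)) x"
      have B: "hideal ?B" using E.ann_hideal[OF x] .
      have diffB: "\<exists>j\<in>?J. a \<ominus> j \<in> ?B" if a: "a \<in> I [^]\<^bsub>ideals_set R\<^esub> m" for a
      proof -
        obtain j where j: "j \<in> ?J" "a \<odot>\<^bsub>E (Suc p)\<^esub> x = j \<odot>\<^bsub>E (Suc p)\<^esub> x" using m(2)[OF a] by blast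
        have "(a \<ominus> j) \<odot>\<^bsub>E (Suc p)\<^esub> x = \<zero>\<^bsub>E (Suc p)\<^esub>"
          using PR[OF a] JR[OF j(1)] j(2) xE
          by (simp add: a_minus_def E.smult_l_distr E.smult_l_minus E.M.r_neg)
        then show ?thesis using j(1) PR[OF a] JR[OF j(1)] by (auto simp: ann_def)
      qed
      have "rcomp R j \<subseteq> ?B" if j: "j \<ge> m" for j
      proof (rule nakayama_comp[OF noeth loc S True B])
        fix r assume r: "r \<in> rcomp R j"
        have rP: "r \<in> I [^]\<^bsub>ideals_set R\<^esub> m" using comp_subset_power[OF std I(2) j] r by blast
        then obtain k where k: "k \<in> ?J" "r \<ominus> k \<in> ?B" using diffB by blast
        have "r = (r \<ominus> k) \<oplus> k" using minus_add_self PR[OF rP] JR[OF k(1)] by simp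
        then show "\<exists>a\<in>?B. \<exists>j\<in>?J. r = a \<oplus> j" using k by blast
      qed
      then have sub: "\<forall>j\<ge>m. rcomp R j \<subseteq> ?B" by blast
      have "x \<in> cocycles (Suc p) ?B" using xE dx by (simp add: cocycles_def kill_def ann_def)
      then have "x \<in> cobounds (Suc p) ?B" using n0 n x B sub by blast
      then obtain w where w: "w \<in> kill (E p) ?B" "x = d p w" by auto
      have wE: "w \<in> carrier (E p)" using kill_carrier[OF w(1)] .
      have "\<exists>j\<in>?J. a \<odot>\<^bsub>E p\<^esub> w = j \<odot>\<^bsub>E p\<^esub> w" if a: "a \<in> I [^]\<^bsub>ideals_set R\<^esub> m" for a
      proof -
        obtain j where j: "j \<in> ?J" "a \<ominus> j \<in> ?B" using diffB[OF a] by blast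
        have "(a \<ominus> j) \<odot>\<^bsub>E p\<^esub> w = \<zero>\<^bsub>E p\<^esub>" using E.killD(1)[OF w(1) j(2)] .
        then have "a \<odot>\<^bsub>E p\<^esub> w \<ominus>\<^bsub>E p\<^esub> j \<odot>\<^bsub>E p\<^esub> w = \<zero>\<^bsub>E p\<^esub>"
          using PR[OF a] JR[OF j(1)] wE by (simp add: a_minus_def E.smult_l_distr E.smult_l_minus)
        then have "a \<odot>\<^bsub>E p\<^esub> w = j \<odot>\<^bsub>E p\<^esub> w"
          using PR[OF a] JR[OF j(1)] wE by (simp add: E.M.minus_eq_zero_iff)
        then show ?thesis using j(1) by blast
      qed
      then have "w \<in> pair_torsion R I ?J (E p)" unfolding mem_pair_torsion using wE m(1) by blast
      then show "x \<in> d p ` pair_torsion R I ?J (E p)" using w(2) by blast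
    qed
  next
    case False
    then obtain s where s: "s \<in> S" "s \<notin> \<mm>" by blast
    then obtain t where t: "t \<in> rcomp R 0" "t \<otimes> s = \<one>"
      using local_ring_unit[OF loc, of s] S by (auto simp: degree_zero_ring_def)
    have "s \<in> ?J" using genideal_self[OF SR] s(1) by blast
    then have "\<one> \<in> ?J" using ideal.I_l_closed[OF J, of s t] t G.hom_carrier by auto
    then have JC: "?J = carrier R" using ideal.one_imp_carrier[OF J] by blast
    have all: "w \<in> pair_torsion R I ?J (E p)" if w: "w \<in> carrier (E p)" for w
    proof -
      have "\<forall>a\<in>I [^]\<^bsub>ideals_set R\<^esub> (1::nat). \<exists>j\<in>?J. a \<odot>\<^bsub>E p\<^esub> w = j \<odot>\<^bsub>E p\<^esub> w"
        unfolding JC using PR[of _ 1] by blast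
      then show ?thesis unfolding mem_pair_torsion using w by blast
    qed
    \<comment> \<open>Exactness alone gives a preimage in every degree, and all elements are
      torsion, so the bound 0 is an arbitrary choice.\<close>
    show ?thesis
    proof (intro exI[of _ 0] allI impI ballI)
      fix n :: int and x
      assume x: "x \<in> mcomp (E (Suc p)) n" and dx: "d (Suc p) x = \<zero>\<^bsub>E (Suc (Suc p))\<^esub>"
      obtain w where "w \<in> carrier (E p)" "d p w = x" using exact[OF E.M.hom_carrier[OF x] dx] by blast
      then show "x \<in> d p ` pair_torsion R I ?J (E p)" using all by blast
    qed
  qed
qed

end

section \<open>From the resolution of M to the components of local cohomology\<close>

lemma (in module) acc_between_fg:
  assumes "noetherian_ring R" "finitely_generated_module R M"
  shows "acc_between R M {\<zero>\<^bsub>M\<^esub>} (carrier M)"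
proof -
  obtain S where S: "S \<subseteq> carrier M" "finite S" "carrier M = \<Inter>{N. submodule N R M \<and> S \<subseteq> N}"
    using assms(2) unfolding finitely_generated_module_def by blast
  show ?thesis using acc_between_span[OF assms(1) S(2,1)] S(3) by simp
qed

text \<open>Finite generation of \<open>M\<close> becomes the chain condition on the kernel of
  \<open>d 0\<close>: preimages under \<open>e\<close> of a chain there stabilise in
  \<open>M\<close>, and they determine the chain because \<open>e\<close> maps onto the
  kernel.\<close>

lemma resolution_gr_complex:
  assumes gr: "is_graded_ring R" and noeth: "noetherian_ring R"
    and fg: "finitely_generated_module R M"
    and res: "graded_injective_resolution TYPE('a) R (M :: ('a, 'b) graded_module) E e d"
  shows "gr_complex R E d"
proof -
  have "cring R" using gr by (simp add: is_graded_ring_def)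
  then interpret gr_ring R using gr by (simp add: gr_ring_def gr_ring_axioms_def)
  have M: "is_graded_module R M" and inj: "\<And>i. graded_injective TYPE('a) R (E i)"
    and e: "e \<in> graded_hom R M (E 0)" and dh: "\<And>i. d i \<in> graded_hom R (E i) (E (Suc i))"
    and ex0: "e ` carrier M = a_kernel (E 0) (E 1) (d 0)"
    and ex: "\<And>i. d i ` carrier (E i) = a_kernel (E (Suc i)) (E (Suc (Suc i))) (d (Suc i))"
    using res unfolding graded_injective_resolution_def by blast+
  have modM: "module R M" using M by (simp add: is_graded_module_def)
  have modE: "module R (E 0)" using inj[of 0] by (simp add: graded_injective_def is_graded_module_def)
  interpret M: module R M by (rule modM)
  interpret E0: module R "E 0" by (rule modE)
  have ecl: "e x \<in> carrier (E 0)" if "x \<in> carrier M" for x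
    using e that unfolding graded_hom_def hom_def by auto
  have eadd: "e (x \<oplus>\<^bsub>M\<^esub> y) = e x \<oplus>\<^bsub>E 0\<^esub> e y" if "x \<in> carrier M" "y \<in> carrier M" for x y
    using e that unfolding graded_hom_def hom_def by auto
  have esm: "e (r \<odot>\<^bsub>M\<^esub> x) = r \<odot>\<^bsub>E 0\<^esub> e x" if "r \<in> carrier R" "x \<in> carrier M" for r x
    using e that unfolding graded_hom_def by auto
  have e0: "e \<zero>\<^bsub>M\<^esub> = \<zero>\<^bsub>E 0\<^esub>"
    using esm[of "\<zero>\<^bsub>R\<^esub>" "\<zero>\<^bsub>M\<^esub>"] ecl[of "\<zero>\<^bsub>M\<^esub>"] by simp
  have eneg: "e (\<ominus>\<^bsub>M\<^esub> x) = \<ominus>\<^bsub>E 0\<^esub> e x" if "x \<in> carrier M" for x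
    using esm[of "\<ominus>\<^bsub>R\<^esub> \<one>\<^bsub>R\<^esub>" x] ecl[OF that] that by (simp add: M.smult_l_minus E0.smult_l_minus)
  have acc: "acc_between R (E 0) {\<zero>\<^bsub>E 0\<^esub>} {x \<in> carrier (E 0). d 0 x = \<zero>\<^bsub>E (Suc 0)\<^esub>}"
    unfolding acc_between_def
  proof (intro allI impI)
    fix L :: "nat \<Rightarrow> 'c set"
    assume L: "\<forall>n. submodule (L n) R (E 0) \<and> {\<zero>\<^bsub>E 0\<^esub>} \<subseteq> L n \<and>
      L n \<subseteq> {x \<in> carrier (E 0). d 0 x = \<zero>\<^bsub>E (Suc 0)\<^esub>} \<and> L n \<subseteq> L (Suc n)"
    have Ls: "submodule (L n) R (E 0)" and Lk: "L n \<subseteq> {x \<in> carrier (E 0). d 0 x = \<zero>\<^bsub>E (Suc 0)\<^esub>}"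
      and LSuc: "L n \<subseteq> L (Suc n)" for n using L by blast+
    define K where "K n = {x \<in> carrier M. e x \<in> L n}" for n
    have "\<exists>k. \<forall>n\<ge>k. K n \<subseteq> K k"
    proof (rule acc_betweenD[OF M.acc_between_fg[OF noeth fg]])
      fix n
      note Ln = E0.submoduleE[OF Ls[of n]]
      show "submodule (K n) R M"
      proof (rule M.submoduleI)
        show "K n \<subseteq> carrier M" by (auto simp: K_def)
        show z: "\<zero>\<^bsub>M\<^esub> \<in> K n" using E0.submodule_zero_in[OF Ls] e0 by (simp add: K_def)
        show "\<ominus>\<^bsub>M\<^esub> x \<in> K n" if "x \<in> K n" for x using that Ln(3) eneg by (simp add: K_def)
        show "x \<oplus>\<^bsub>M\<^esub> y \<in> K n" if "x \<in> K n" "y \<in> K n" for x y using that Ln(5) eadd by (simp add: K_def)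
        show "r \<odot>\<^bsub>M\<^esub> x \<in> K n" if "r \<in> carrier R" "x \<in> K n" for r x using that Ln(4) esm by (simp add: K_def)
      qed
      show "{\<zero>\<^bsub>M\<^esub>} \<subseteq> K n" using E0.submodule_zero_in[OF Ls] e0 by (simp add: K_def)
      show "K n \<subseteq> carrier M" by (auto simp: K_def)
      show "K n \<subseteq> K (Suc n)" using LSuc[of n] by (auto simp: K_def)
    qed
    then obtain k where k: "\<And>n. n \<ge> k \<Longrightarrow> K n \<subseteq> K k" by blast
    show "\<exists>k. \<forall>n\<ge>k. L n \<subseteq> L k"
    proof (intro exI[of _ k] allI impI subsetI)
      fix n x assume n: "n \<ge> k" and x: "x \<in> L n"
      then have "x \<in> a_kernel (E 0) (E 1) (d 0)" using Lk[of n] by (auto simp: a_kernel_def')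
      then obtain y where y: "y \<in> carrier M" "x = e y" using ex0 by blast
      then have "y \<in> K n" using x by (simp add: K_def)
      then show "x \<in> L k" using k[OF n] y(2) by (auto simp: K_def)
    qed
  qed
  show ?thesis
  proof (intro gr_complex.intro gr_complex_axioms.intro)
    show "gr_ring R" by (rule gr_ring_axioms)
    show "d (Suc q) (d q w) = \<zero>\<^bsub>E (Suc (Suc q))\<^esub>" if "w \<in> carrier (E q)" for q w
    proof -
      have "d q w \<in> a_kernel (E (Suc q)) (E (Suc (Suc q))) (d (Suc q))" using ex[of q] that by blast
      then show ?thesis by (simp add: a_kernel_def')
    qed
    show "\<exists>w\<in>carrier (E q). d q w = x"
      if "x \<in> carrier (E (Suc q))" "d (Suc q) x = \<zero>\<^bsub>E (Suc (Suc q))\<^esub>" for x q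
    proof -
      have "x \<in> d q ` carrier (E q)" unfolding ex using that by (simp add: a_kernel_def')
      then show ?thesis by blast
    qed
  qed (use noeth inj dh acc in blast)+
qed

theorem proposition5p2:
  fixes R :: "'a graded_ring"
    and M :: "('a, 'b) graded_module"
    and \<mm>\<^sub>0 \<bb>\<^sub>0 J \<bb> :: "'a set"
    and E :: "nat \<Rightarrow> ('a, 'c) graded_module"
    and e :: "'b \<Rightarrow> 'c"
    and d :: "nat \<Rightarrow> 'c \<Rightarrow> 'c"
    and i :: nat
  assumes "is_standard_graded R"
    and "noetherian_ring R"
    and "is_local_ring (degree_zero_ring R) \<mm>\<^sub>0"
    and "infinite (carrier (degree_zero_ring R Quot \<mm>\<^sub>0))"
    and "is_graded_module R M"
    and "finitely_generated_module R M"
    and "\<exists>S \<subseteq> rcomp R 0. J = Idl\<^bsub>R\<^esub> S"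
    and "ideal \<bb>\<^sub>0 (degree_zero_ring R)"
    and "\<bb> = \<bb>\<^sub>0 <+>\<^bsub>R\<^esub> irrelevant_ideal R"
    and "graded_injective_resolution TYPE('a) R M E e d"
    and "i \<ge> 1"
  shows "\<exists>n\<^sub>0::int. \<forall>n \<ge> n\<^sub>0.
    mcomp (pair_local_cohomology R \<bb> J E d i) n = {\<zero>\<^bsub>pair_local_cohomology R \<bb> J E d i\<^esub>}"
proof -
  have gr: "is_graded_ring R" using assms(1) by (simp add: is_standard_graded_def)
  interpret gr_complex R E d
    by (rule resolution_gr_complex[OF gr assms(2,6,10)])
  obtain p where p: "i = Suc p" using assms(11) by (cases i) auto
  obtain S where S: "S \<subseteq> rcomp R 0" "J = Idl\<^bsub>R\<^esub> S" using assms(7) by blast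
  have SR: "S \<subseteq> carrier R" using S(1) G.hom_carrier by blast
  have J: "ideal J R" using genideal_ideal[OF SR] S(2) by simp
  have \<bb>: "ideal \<bb> R" "rcomp R 1 \<subseteq> \<bb>"
    using ideal_plus_extension[OF assms(8)] assms(9) by simp_all
  obtain n0 :: int where n0: "\<And>n x. \<lbrakk>n \<ge> n0; x \<in> mcomp (E (Suc p)) n;
      x \<in> pair_torsion R \<bb> J (E (Suc p)); d (Suc p) x = \<zero>\<^bsub>E (Suc (Suc p))\<^esub>\<rbrakk>
      \<Longrightarrow> x \<in> d p ` pair_torsion R \<bb> J (E p)"
    using torsion_cocycles_vanish[OF assms(1,3) S(1) \<bb>, of p] S(2) by blast
  define N where "N = d p ` pair_torsion R \<bb> J (E p)"
  define C where "C = pair_cocycles R \<bb> J E d i"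
  have N: "pair_coboundaries R \<bb> J E d i = N" by (simp add: pair_coboundaries_def p N_def)
  have tc: "x \<in> carrier (E q)" if "x \<in> pair_torsion R \<bb> J (E q)" for x q
    using that by (simp add: mem_pair_torsion)
  have Ncl: "x \<oplus>\<^bsub>E i\<^esub> y \<in> N" "\<ominus>\<^bsub>E i\<^esub> x \<in> N" if xy: "x \<in> N" "y \<in> N" for x y
  proof -
    obtain u v where u: "u \<in> pair_torsion R \<bb> J (E p)" "x = d p u"
      and v: "v \<in> pair_torsion R \<bb> J (E p)" "y = d p v" using xy by (auto simp: N_def)
    have "x \<oplus>\<^bsub>E i\<^esub> y = d p (u \<oplus>\<^bsub>E p\<^esub> v)" using d_add[OF tc[OF u(1)] tc[OF v(1)]] u v p by simp
    then show "x \<oplus>\<^bsub>E i\<^esub> y \<in> N" using E.pair_torsion_add[OF \<bb>(1) J u(1) v(1)] unfolding N_def by blast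
    have "\<ominus>\<^bsub>E i\<^esub> x = d p (\<ominus>\<^bsub>E p\<^esub> u)" using d_neg[OF tc[OF u(1)]] u p by simp
    then show "\<ominus>\<^bsub>E i\<^esub> x \<in> N" using E.pair_torsion_uminus[OF \<bb>(1) J u(1)] unfolding N_def by blast
  qed
  have NE: "x \<in> carrier (E i)" if "x \<in> N" for x
    using that d_closed tc p by (auto simp: N_def)
  \<comment> \<open>Elements of the quotient are cosets as sets, with \<open>N\<close> as zero, so a
    component vanishes once the coset of each of its representatives is \<open>N\<close>
    itself.\<close>
  have coset: "N +>\<^bsub>graded_submodule (E i) C\<^esub> x = N" if x: "x \<in> N" for x
  proof -
    have "N +>\<^bsub>graded_submodule (E i) C\<^esub> x = (\<Union>h\<in>N. {h \<oplus>\<^bsub>E i\<^esub> x})"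
      by (simp add: a_r_coset_def' graded_submodule_def)
    also have "\<dots> = N"
    proof (intro subset_antisym subsetI)
      fix y assume "y \<in> (\<Union>h\<in>N. {h \<oplus>\<^bsub>E i\<^esub> x})"
      then show "y \<in> N" using Ncl(1) x by blast
    next
      fix y assume y: "y \<in> N"
      have "y = (y \<ominus>\<^bsub>E i\<^esub> x) \<oplus>\<^bsub>E i\<^esub> x" using E.M.minus_add_self[OF NE[OF y] NE[OF x]] by simp
      moreover have "y \<ominus>\<^bsub>E i\<^esub> x \<in> N" using Ncl(1)[OF y Ncl(2)[OF x x]] by (simp add: a_minus_def)
      ultimately show "y \<in> (\<Union>h\<in>N. {h \<oplus>\<^bsub>E i\<^esub> x})" by blast
    qed
    finally show ?thesis .
  qed
  have comp: "mcomp (pair_local_cohomology R \<bb> J E d i) n =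
      (\<lambda>x. N +>\<^bsub>graded_submodule (E i) C\<^esub> x) ` (mcomp (E i) n \<inter> C)" for n
    by (simp add: pair_local_cohomology_def graded_quotient_def N C_def) (simp add: graded_submodule_def)
  have zero: "\<zero>\<^bsub>pair_local_cohomology R \<bb> J E d i\<^esub> = N"
    by (simp add: pair_local_cohomology_def graded_quotient_def N)
  show ?thesis
  proof (intro exI[of _ n0] allI impI)
    fix n :: int assume n: "n \<ge> n0"
    have sub: "x \<in> N" if "x \<in> mcomp (E i) n" "x \<in> C" for x
      using n0[OF n, of x] that by (simp add: p C_def N_def pair_cocycles_def)
    \<comment> \<open>This makes the component nonempty, so that it equals the singleton and is not
      merely contained in it.\<close>
    have "\<zero>\<^bsub>E i\<^esub> \<in> mcomp (E i) n \<inter> C"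
      using E.M.hom_zero[of i n] E.pair_torsion_zero[OF \<bb>(1) J, of i] d_zero[of i]
      by (simp add: C_def pair_cocycles_def)
    then show "mcomp (pair_local_cohomology R \<bb> J E d i) n = {\<zero>\<^bsub>pair_local_cohomology R \<bb> J E d i\<^esub>}"
      unfolding comp zero using sub coset by blast
  qed
qed

end
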